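(* Let $|\nu|<\tfrac12$ and $z\in\mathbb{C}\setminus(-\infty,0]$. Then $$\int_0^\infty J_\nu(cz)\left[K_{2\nu}\left(2\sqrt{c}\right)-\frac{\pi}{2}\,Y_{2\nu}\left(2\sqrt{c}\right)\right]dc=-\frac{\pi}{2z}\,Y_\nu\left(\frac1z\right).$$
   Context: $J_\nu$ and $Y_\nu$ are the Bessel functions of the first and second kind, and $K_\nu$ is the modified Bessel function of the second kind, of order $\nu$, all defined on $\mathbb{C}\setminus(-\infty,0]$.
   Formalization: For non-real z the integral diverges, since J_ν(cz) grows like exp(c|Im z|); the identity is proved as stated, with convergence of the improper integral, for z>0, and for other z in C\(-∞,0] the left side is read as the holomorphic continuation of the integral from z>0. *)

theory Defs
  imports "HOL-Complex_Analysis.Complex_Analysis"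
begin

(* All functions below are meant on the slit plane, the complement of the non-positive reals:
   powr is the principal power, and rGamma is the entire reciprocal Gamma function, so that the
   series also make sense for negative integer orders. *)

definition Bessel_J :: "complex \<Rightarrow> complex \<Rightarrow> complex" where
  "Bessel_J \<nu> z = (z / 2) powr \<nu> *
     (\<Sum>k. (-1) ^ k * rGamma (\<nu> + of_nat k + 1) / fact k * (z / 2) ^ (2 * k))"

definition Bessel_I :: "complex \<Rightarrow> complex \<Rightarrow> complex" where
  "Bessel_I \<nu> z = (z / 2) powr \<nu> *
     (\<Sum>k. rGamma (\<nu> + of_nat k + 1) / fact k * (z / 2) ^ (2 * k))"

(* At integer orders the quotients for Y and K are 0/0 and are replaced by their limits in the
   order. *)

definition Bessel_Y :: "complex \<Rightarrow> complex \<Rightarrow> complex" where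
  "Bessel_Y \<nu> z =
     (let q = (\<lambda>\<mu>. (Bessel_J \<mu> z * cos (\<mu> * of_real pi) - Bessel_J (- \<mu>) z) / sin (\<mu> * of_real pi))
      in if \<nu> \<in> \<int> then Lim (at \<nu>) q else q \<nu>)"

definition Bessel_K :: "complex \<Rightarrow> complex \<Rightarrow> complex" where
  "Bessel_K \<nu> z =
     (let q = (\<lambda>\<mu>. of_real pi / 2 * (Bessel_I (- \<mu>) z - Bessel_I \<mu> z) / sin (\<mu> * of_real pi))
      in if \<nu> \<in> \<int> then Lim (at \<nu>) q else q \<nu>)"

(* For z > 0 the integral of J_nu(c z) (K_{2 nu}(2 sqrt c) - pi/2 Y_{2 nu}(2 sqrt c)) over the
   positive reals is only conditionally convergent at infinity; the gauge integral (has_integral)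
   over an unbounded interval is exactly the improper integral.  For z off the real axis
   J_nu(c z) grows like exp(c |Im z|) while the bracket decays like a power of c, so the integral
   diverges, and its value at z is that of its holomorphic continuation F from the positive
   half-line to the slit plane.  F is unique by the identity theorem. *)

end

theory Submission
  imports Defs "HOL-Real_Asymp.Real_Asymp"
begin

text \<open>
  Write \<open>G\<close> for the bracket, and substitute \<open>c / x\<close> for \<open>c\<close>, so that for \<open>y = 1 / x\<close> the claim becomes
  \<open>\<integral> J_\<nu>(c) G(c y) dc = - pi/2 Y_\<nu>(y)\<close>.
  Bessel's equation for \<open>J_\<nu>\<close> and one integration by parts show that the integral converges, because
  \<open>G\<close> decays like \<open>c powr (-1/4)\<close> and its derivative like \<open>c powr (-3/4)\<close>. By Abel's theorem its value is
  the limit at 0 of the Laplace transform of the integrand. For \<open>\<nu> \<noteq> 0\<close> the bracket is a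
  combination of \<open>c powr (-\<nu>)\<close> times an even power series and \<open>c powr \<nu>\<close> times a power series, so
  that this transform is a series in the derivatives of the transforms of \<open>c powr (-\<nu>) J_\<nu>(c)\<close> and
  \<open>c powr \<nu> J_\<nu>(c)\<close>. These two transforms solve first-order linear equations in \<open>p\<close>, hence continue
  analytically to a disc around \<open>p = 0\<close>, where their even parts are multiples of
  \<open>(p\<^sup>2 + 1) powr (\<nu> - 1/2)\<close> and \<open>(p\<^sup>2 + 1) powr (- \<nu> - 1/2)\<close>; the duplication formula identifies the
  resulting series with \<open>J_{-\<nu>}(y)\<close> and \<open>J_\<nu>(y)\<close>. The order 0 follows by a limit.
\<close>

section \<open>The entire part of the Bessel functions\<close>

text \<open>Integrating the series of the bracket term by term against \<open>J_\<nu>\<close> is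
  impossible: all but the lowest moments of \<open>J_\<nu>\<close> diverge. The factor
  \<open>exp (- p c)\<close> repairs this, since the power series in \<open>c\<close> have
  coefficients with two factorials and so grow more slowly than \<open>exp (e c)\<close> for every
  \<open>e > 0\<close>; each term is then an honest derivative of a Laplace transform. As
  \<open>p\<close> tends to 0 the divergent moments are replaced by derivatives of the continued
  transform, and Cauchy's estimates carry the limit through the sum. Odd derivatives never
  contribute: one series has no odd terms, the other transform is even. This removes the primitive
  without closed form that occurs in the first transform. A second obstacle is that the decay of
  \<open>K\<close> is invisible in its definition, a difference of two exponentially growing
  functions. It comes from an integral, identified with that difference by Wronskians. The third is
  order 0: every estimate on the way has a constant chosen before the order, so that the limit in
  the order is dominated.\<close>

lemma continuous_bounded_on_cball:
  fixes f :: "complex \<Rightarrow> complex"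
  assumes "continuous_on (cball 0 r) f"
  obtains B where "B > 0" "\<And>x. norm x \<le> r \<Longrightarrow> norm (f x) \<le> B"
proof -
  have "bounded (f ` cball 0 r)"
    by (intro compact_imp_bounded compact_continuous_image assms) auto
  then obtain B where "B > 0" "\<And>x. x \<in> f ` cball 0 r \<Longrightarrow> norm x \<le> B"
    by (metis bounded_pos)
  then show ?thesis by (intro that[of B]) auto
qed

text \<open>Once \<open>k + 1 > 2 N\<close>, the factor \<open>a + k + 1\<close> has modulus at
  least \<open>(k + 1) / 2\<close>, so each use of the functional equation divides by that much and
  builds up \<open>2 ^ k / fact k\<close>. The finitely many earlier \<open>k\<close> are handled by
  compactness in \<open>a\<close>.\<close>

lemma rGamma_shift_bound:
  obtains S :: real where "S > 0"
    "\<And>(a::complex) k. norm a \<le> real N \<Longrightarrow> norm (rGamma (a + of_nat k + 1)) \<le> S * 2 ^ k / fact k"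
proof -
  have "\<exists>B>0. \<forall>a. norm a \<le> real N \<longrightarrow> norm (rGamma (a + of_nat k + 1 :: complex)) \<le> B" for k
  proof -
    have "continuous_on (cball 0 (real N)) (\<lambda>a. rGamma (a + of_nat k + 1 :: complex))"
      by (intro holomorphic_on_imp_continuous_on holomorphic_intros)
    then show ?thesis by (metis continuous_bounded_on_cball)
  qed
  then obtain B where B0: "\<And>k. B k > 0"
    and B: "\<And>k a. norm a \<le> real N \<Longrightarrow> norm (rGamma (a + of_nat k + 1 :: complex)) \<le> B k"
    by metis
  \<comment> \<open>A sum rather than a maximum: every summand is positive, so \<open>S\<close>
    dominates each of them.\<close>
  define S where "S = (\<Sum>k\<le>2*N. B k * fact k / 2 ^ k)"
  have small: "norm (rGamma (a + of_nat k + 1)) \<le> S * 2 ^ k / fact k"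
    if a: "norm a \<le> real N" and k: "k \<le> 2 * N" for a :: complex and k
  proof -
    have "B k * fact k / 2 ^ k \<le> S"
      unfolding S_def using B0 k by (intro member_le_sum) (auto intro!: divide_nonneg_nonneg mult_nonneg_nonneg less_imp_le)
    then have "B k \<le> S * 2 ^ k / fact k" by (simp add: field_simps)
    with B[OF a, of k] show ?thesis by linarith
  qed
  have S: "S > 0"
    unfolding S_def using B0 by (intro sum_pos) auto
  have "norm (rGamma (a + of_nat k + 1)) \<le> S * 2 ^ k / fact k"
    if a: "norm a \<le> real N" for a :: complex and k
  proof (induction k)
    case 0
    show ?case using small[OF a, of 0] by simp
  next
    case (Suc k)
    show ?case
    proof (cases "Suc k \<le> 2 * N")
      case True
      then show ?thesis by (rule small[OF a])
    next
      case False
      have eq: "(a + of_nat k + 1) * rGamma (a + of_nat (Suc k) + 1) = rGamma (a + of_nat k + 1)"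
        using rGamma_plus1[of "a + of_nat k + 1"] by (simp add: add_ac)
      have "norm (of_nat (Suc k) :: complex) \<le> norm (a + of_nat k + 1) + norm a"
        using norm_triangle_ineq4[of "a + of_nat k + 1" a] by (simp add: algebra_simps)
      then have n: "norm (a + of_nat k + 1) \<ge> real (Suc k) / 2"
        using a False unfolding norm_of_nat by (simp add: field_simps)
      have "real (Suc k) / 2 * norm (rGamma (a + of_nat (Suc k) + 1)) \<le> norm (rGamma (a + of_nat k + 1))"
        unfolding eq[symmetric] norm_mult by (intro mult_right_mono n) auto
      also have "\<dots> \<le> S * 2 ^ k / fact k" by (rule Suc.IH)
      finally have "norm (rGamma (a + of_nat (Suc k) + 1)) \<le> S * 2 ^ k / fact k / (real (Suc k) / 2)"
        by (subst pos_le_divide_eq) (simp_all add: mult.commute)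
      also have "\<dots> = S * 2 ^ Suc k / fact (Suc k)" by (simp add: field_simps)
      finally show ?thesis .
    qed
  qed
  with S show ?thesis by (rule that)
qed

text \<open>One term of the exponential series at \<open>1 / e\<close> is below the whole sum. This
  trades one of the two factorials in the coefficients of \<open>Phi\<close> for an arbitrarily
  small geometric ratio.\<close>

lemma inverse_fact_le_exp:
  assumes "e > (0::real)"
  shows "1 / fact k \<le> exp (1 / e) * e ^ k"
proof -
  have "(1 / e) ^ k / fact k \<le> exp (1 / e)"
    using exp_lower_Taylor_quadratic[of "1/e"]
    using sum_le_suminf[OF summable_exp_generic[of "1/e"], of "{k}"] assms
    by (simp add: exp_def field_simps scaleR_conv_of_real)
  then show ?thesis using assms by (simp add: field_simps)
qed

text \<open>The Bessel-Clifford function, that is, the regularized hypergeometric 0F1 with parameter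
  \<open>a + 1\<close>. It is entire in \<open>a\<close> and in \<open>y\<close>; \<open>J\<close>
  and \<open>I\<close> are \<open>(z / 2) powr a\<close> times its values at minus and plus
  \<open>(z / 2)^2\<close>, so all branching is confined to the power.\<close>

definition Phi :: "complex \<Rightarrow> complex \<Rightarrow> complex" where
  "Phi a y = (\<Sum>k. rGamma (a + of_nat k + 1) / fact k * y ^ k)"

lemma sum_power_fact_le_exp:
  assumes "x \<ge> (0::real)"
  shows "(\<Sum>k<n. x ^ k / fact k) \<le> exp x"
  using sum_le_suminf[OF summable_exp_generic[of x], of "{..<n}"] assms
  by (simp add: exp_def field_simps scaleR_conv_of_real)

text \<open>Bounding absolute partial sums, uniformly for orders in a disc, serves convergence,
  growth and domination at once. That \<open>e\<close> may be arbitrarily small is what later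
  permits termwise Laplace transforms for every \<open>Re p > 0\<close>.\<close>

lemma Phi_terms_bound:
  assumes "e > (0::real)"
  obtains S :: real where "S > 0"
    "\<And>(a::complex) y n. norm a \<le> real N \<Longrightarrow>
       (\<Sum>k<n. norm (rGamma (a + of_nat k + 1) / fact k) * norm (y::complex) ^ k) \<le> S * exp (e * norm y)"
proof -
  obtain S :: real where S: "S > 0"
    "\<And>(a::complex) k. norm a \<le> real N \<Longrightarrow> norm (rGamma (a + of_nat k + 1)) \<le> S * 2 ^ k / fact k"
    using rGamma_shift_bound[of N] by blast
  \<comment> \<open>Half of \<open>e\<close>, because the bound on the reciprocal Gamma function
    carries an extra \<open>2 ^ k\<close>.\<close>
  define d where "d = e / 2"
  have d: "d > 0" using assms by (simp add: d_def)
  have "(\<Sum>k<n. norm (rGamma (a + of_nat k + 1) / fact k) * norm y ^ k) \<le> S * exp (1/d) * exp (e * norm y)"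
    if a: "norm a \<le> real N" for a y :: complex and n
  proof -
    have "norm (rGamma (a + of_nat k + 1) / fact k) * norm y ^ k
        \<le> S * exp (1/d) * ((e * norm y) ^ k / fact k)" for k
    proof -
      have "norm (rGamma (a + of_nat k + 1)) \<le> S * 2 ^ k * (1 / fact k)"
        using S(2)[OF a, of k] by simp
      also have "\<dots> \<le> S * 2 ^ k * (exp (1/d) * d ^ k)"
        using S(1) by (intro mult_left_mono inverse_fact_le_exp d) auto
      also have "\<dots> = S * exp (1/d) * e ^ k"
        by (simp add: d_def power_divide)
      finally have "norm (rGamma (a + of_nat k + 1)) * (norm y ^ k / fact k) \<le> S * exp (1/d) * e ^ k * (norm y ^ k / fact k)"
        by (intro mult_right_mono) auto
      then show ?thesis by (simp add: norm_divide power_mult_distrib)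
    qed
    then have "(\<Sum>k<n. norm (rGamma (a + of_nat k + 1) / fact k) * norm y ^ k)
        \<le> (\<Sum>k<n. S * exp (1/d) * ((e * norm y) ^ k / fact k))"
      by (rule sum_mono)
    also have "\<dots> = S * exp (1/d) * (\<Sum>k<n. (e * norm y) ^ k / fact k)"
      by (simp add: sum_distrib_left)
    also have "\<dots> \<le> S * exp (1/d) * exp (e * norm y)"
      using assms S(1) by (intro mult_left_mono sum_power_fact_le_exp) auto
    finally show ?thesis .
  qed
  then show ?thesis using S(1) by (intro that[of "S * exp (1/d)"]) auto
qed

lemma Phi_summable_norm: "summable (\<lambda>k. norm (rGamma ((a::complex) + of_nat k + 1) / fact k) * norm (y::complex) ^ k)"
proof -
  obtain N where N: "norm a \<le> real N" using real_arch_simple by blast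
  show ?thesis
  proof (rule Phi_terms_bound[of 1 N])
    fix S :: real
    assume S: "\<And>(a::complex) y n. norm a \<le> real N \<Longrightarrow>
       (\<Sum>k<n. norm (rGamma (a + of_nat k + 1) / fact k) * norm (y::complex) ^ k) \<le> S * exp (1 * norm y)"
    show ?thesis
    proof (rule bounded_imp_summable)
      show "(\<Sum>k\<le>n. norm (rGamma (a + of_nat k + 1) / fact k) * norm (y::complex) ^ k) \<le> S * exp (1 * norm y)" for n
        using S[OF N, where n = "Suc n" and y = y] unfolding lessThan_Suc_atMost .
    qed auto
  qed auto
qed

lemma Phi_summable: "summable (\<lambda>k. rGamma (a + of_nat k + 1) / fact k * (y::complex) ^ k)"
  using Phi_summable_norm[of a y] by - (rule summable_norm_cancel, simp only: norm_mult norm_power)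

lemma Phi_sums: "(\<lambda>k. rGamma (a + of_nat k + 1) / fact k * y ^ k) sums Phi a y"
  unfolding Phi_def using Phi_summable by (rule summable_sums)

lemma Phi_bound:
  assumes "e > (0::real)"
  obtains S :: real where "S > 0"
    "\<And>a y. norm a \<le> real N \<Longrightarrow> norm (Phi a y) \<le> S * exp (e * norm y)"
proof -
  obtain S :: real where S: "S > 0" "\<And>(a::complex) y n. norm a \<le> real N \<Longrightarrow>
       (\<Sum>k<n. norm (rGamma (a + of_nat k + 1) / fact k) * norm (y::complex) ^ k) \<le> S * exp (e * norm y)"
    using Phi_terms_bound[OF assms, of N thesis] by blast
  have "norm (Phi a y) \<le> S * exp (e * norm y)" if "norm a \<le> real N" for a y
  proof -
    have "norm (Phi a y) \<le> (\<Sum>k. norm (rGamma (a + of_nat k + 1) / fact k) * norm y ^ k)"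
      unfolding Phi_def using summable_norm[of "\<lambda>k. rGamma (a + of_nat k + 1) / fact k * y ^ k"] Phi_summable_norm[of a y]
      by (simp only: norm_mult norm_power)
    also have "\<dots> \<le> S * exp (e * norm y)"
      by (rule suminf_le_const[OF Phi_summable_norm S(2)[OF that]])
    finally show ?thesis .
  qed
  with S(1) show ?thesis by (rule that)
qed

lemma Phi_0 [simp]: "Phi a 0 = rGamma (a + 1)"
  unfolding Phi_def by (subst powser_zero) simp

lemma DERIV_Phi: "(Phi a has_field_derivative Phi (a + 1) y) (at y)"
proof -
  have "((\<lambda>y. \<Sum>k. rGamma (a + of_nat k + 1) / fact k * y ^ k) has_field_derivative
      (\<Sum>k. diffs (\<lambda>k. rGamma (a + of_nat k + 1) / fact k) k * y ^ k)) (at y)"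
    by (rule termdiffs_strong_converges_everywhere) (rule Phi_summable)
  also have "diffs (\<lambda>k. rGamma (a + of_nat k + 1) / fact k) = (\<lambda>k. rGamma ((a + 1) + of_nat k + 1) / fact k)"
  proof
    fix k
    have "a + of_nat (Suc k) + 1 = (a + 1) + of_nat k + 1" by simp
    then have "diffs (\<lambda>k. rGamma (a + of_nat k + 1) / fact k) k = of_nat (Suc k) * (rGamma ((a + 1) + of_nat k + 1) / (of_nat (Suc k) * fact k))"
      by (simp only: diffs_def fact_Suc)
    also have "\<dots> = rGamma ((a + 1) + of_nat k + 1) / fact k"
      using of_nat_neq_0[of k, where 'a = complex] by (simp add: divide_simps del: of_nat_Suc)
    finally show "diffs (\<lambda>k. rGamma (a + of_nat k + 1) / fact k) k = rGamma ((a + 1) + of_nat k + 1) / fact k" .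
  qed
  finally show ?thesis unfolding Phi_def .
qed

lemma holomorphic_Phi [holomorphic_intros]:
  assumes "f holomorphic_on A"
  shows "(\<lambda>z. Phi a (f z)) holomorphic_on A"
proof -
  have "Phi a holomorphic_on UNIV"
    unfolding holomorphic_on_open[OF open_UNIV] using DERIV_Phi by blast
  from holomorphic_on_compose_gen[OF assms this] show ?thesis by (simp add: o_def)
qed

lemma continuous_on_Phi [continuous_intros]:
  assumes "continuous_on A f"
  shows "continuous_on A (\<lambda>z. Phi a (f z))"
proof -
  have "continuous_on UNIV (Phi a)"
    using DERIV_Phi by (meson DERIV_isCont continuous_at_imp_continuous_on)
  from continuous_on_compose2[OF this assms] show ?thesis by simp
qed

text \<open>Write the factor \<open>a + k + 1\<close> of the functional equation as
  \<open>(a + 1) + k\<close> and sum both parts. Since differentiation raises the order by 1, this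
  is also the differential equation \<open>y w'' + (a + 1) w' = w\<close> for
  \<open>w = Phi a\<close>.\<close>

lemma Phi_contiguous: "Phi a y = (a + 1) * Phi (a + 1) y + y * Phi (a + 2) y"
proof -
  let ?c = "\<lambda>a k. rGamma (a + of_nat k + 1) / fact k :: complex"
  have A: "(\<lambda>k. (a + 1) * (?c (a + 1) k * y ^ k)) sums ((a + 1) * Phi (a + 1) y)"
    by (intro sums_mult Phi_sums)
  have "(\<lambda>k. y * (?c (a + 2) k * y ^ k)) sums (y * Phi (a + 2) y)"
    by (intro sums_mult Phi_sums)
  also have "(\<lambda>k. y * (?c (a + 2) k * y ^ k)) = (\<lambda>k. of_nat (Suc k) * ?c (a + 1) (Suc k) * y ^ Suc k)"
  proof
    fix k
    have "a + 2 + of_nat k + 1 = a + 1 + of_nat (Suc k) + 1" by simp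
    then have "?c (a + 2) k = rGamma (a + 1 + of_nat (Suc k) + 1) / fact k" by (simp only:)
    also have "\<dots> = of_nat (Suc k) * ?c (a + 1) (Suc k)"
      using of_nat_neq_0[of k, where 'a = complex] unfolding fact_Suc by (simp add: divide_simps del: of_nat_Suc)
    finally show "y * (?c (a + 2) k * y ^ k) = of_nat (Suc k) * ?c (a + 1) (Suc k) * y ^ Suc k"
      by (simp only: power_Suc mult_ac)
  qed
  finally have "(\<lambda>k. of_nat k * ?c (a + 1) k * y ^ k) sums (y * Phi (a + 2) y)"
    by (subst (asm) sums_Suc_iff) simp
  from sums_add[OF A this]
  have "(\<lambda>k. (a + of_nat k + 1) * rGamma (a + of_nat k + 1 + 1) / fact k * y ^ k) sums
      ((a + 1) * Phi (a + 1) y + y * Phi (a + 2) y)"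
    by (simp add: add_divide_distrib algebra_simps)
  then have "(\<lambda>k. ?c a k * y ^ k) sums ((a + 1) * Phi (a + 1) y + y * Phi (a + 2) y)"
    by (simp only: rGamma_plus1)
  with Phi_sums show ?thesis by (rule sums_unique2)
qed

lemma Phi_uniform_limit:
  "uniform_limit (cball 0 (real N)) (\<lambda>n a. \<Sum>k<n. rGamma (a + of_nat k + 1) / fact k * y ^ k) (\<lambda>a. Phi a y) sequentially"
proof -
  obtain S :: real where S: "S > 0"
    "\<And>(a::complex) k. norm a \<le> real N \<Longrightarrow> norm (rGamma (a + of_nat k + 1)) \<le> S * 2 ^ k / fact k"
    using rGamma_shift_bound[of N] by blast
  show ?thesis unfolding Phi_def
  proof (rule Weierstrass_m_test)
    fix n :: nat and a :: complex assume "a \<in> cball 0 (real N)"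
    then have "norm (rGamma (a + of_nat n + 1)) \<le> S * 2 ^ n / fact n" by (intro S) auto
    also have "\<dots> \<le> S * 2 ^ n" using S(1) by (simp add: field_simps)
    finally have "norm (rGamma (a + of_nat n + 1)) * (norm y ^ n / fact n) \<le> S * 2 ^ n * (norm y ^ n / fact n)"
      by (intro mult_right_mono) auto
    then show "norm (rGamma (a + of_nat n + 1) / fact n * y ^ n) \<le> S * ((2 * norm y) ^ n / fact n)"
      by (simp add: norm_mult norm_divide norm_power power_mult_distrib)
  next
    show "summable (\<lambda>n. S * ((2 * norm y) ^ n / fact n))"
      using summable_exp_generic[of "2 * norm y"] by (intro summable_mult) (simp add: field_simps scaleR_conv_of_real)
  qed
qed

lemma holomorphic_Phi_order: "(\<lambda>a. Phi a y) holomorphic_on A"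
proof -
  have "(\<lambda>a. Phi a y) holomorphic_on UNIV"
  proof (rule holomorphic_uniform_sequence)
    show "(\<lambda>a. \<Sum>k<n. rGamma (a + of_nat k + 1) / fact k * y ^ k) holomorphic_on UNIV" for n
      by (intro holomorphic_intros) auto
    fix x :: complex
    obtain N where N: "norm x + 1 \<le> real N" using real_arch_simple by blast
    have "cball x 1 \<subseteq> cball 0 (real N)"
    proof
      fix z assume "z \<in> cball x 1"
      then show "z \<in> cball 0 (real N)"
        using N norm_triangle_ineq[of x "z - x"] by (auto simp: dist_norm norm_minus_commute)
    qed
    then show "\<exists>d>0. cball x d \<subseteq> UNIV \<and> uniform_limit (cball x d)
        (\<lambda>n a. \<Sum>k<n. rGamma (a + of_nat k + 1) / fact k * y ^ k) (\<lambda>a. Phi a y) sequentially"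
      using uniform_limit_on_subset[OF Phi_uniform_limit] by (intro exI[of _ 1]) auto
  qed auto
  then show ?thesis by (rule holomorphic_on_subset) auto
qed

lemma holomorphic_Phi_order' [holomorphic_intros]:
  assumes "f holomorphic_on A"
  shows "(\<lambda>z. Phi (f z) y) holomorphic_on A"
  using holomorphic_on_compose[OF assms holomorphic_Phi_order] by (simp add: o_def)

text \<open>The derivative in the order at 0: the non-logarithmic part of \<open>Y\<close> at order
  0 is built from it.\<close>

definition Phi_order_deriv :: "complex \<Rightarrow> complex" where
  "Phi_order_deriv y = deriv (\<lambda>a. Phi a y) 0"

lemma DERIV_Phi_order: "((\<lambda>a. Phi a y) has_field_derivative Phi_order_deriv y) (at 0)"
  unfolding Phi_order_deriv_def
  by (rule holomorphic_derivI[OF holomorphic_Phi_order[of y UNIV]]) auto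

text \<open>Locally uniform convergence in the order allows differentiation of the coefficients, so
  the derivative is again an everywhere convergent power series in \<open>y\<close>.\<close>

lemma holomorphic_Phi_order_deriv: "Phi_order_deriv holomorphic_on UNIV"
proof -
  define d :: "nat \<Rightarrow> complex" where "d k = deriv (\<lambda>a. rGamma (a + of_nat k + 1)) 0 / fact k" for k
  have dr: "((\<lambda>a. rGamma (a + of_nat k + 1)) has_field_derivative deriv (\<lambda>a. rGamma (a + of_nat k + 1)) 0) (at (0::complex))" for k
    by (rule holomorphic_derivI[of _ UNIV]) (auto intro!: holomorphic_intros)
  have sums: "(\<lambda>k. d k * y ^ k) sums Phi_order_deriv y" for y
  proof -
    have "\<exists>g'. \<forall>x\<in>ball (0::complex) 1. ((\<lambda>a. Phi a y) has_field_derivative g' x) (at x) \<and>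
       (\<lambda>n. \<Sum>k<n. deriv (\<lambda>a. rGamma (a + of_nat k + 1)) x / fact k * y ^ k) \<longlonglongrightarrow> g' x"
    proof (rule has_complex_derivative_uniform_sequence[of "ball 0 1"
          "\<lambda>n a. \<Sum>k<n. rGamma (a + of_nat k + 1) / fact k * y ^ k"
          "\<lambda>n x. \<Sum>k<n. deriv (\<lambda>a. rGamma (a + of_nat k + 1)) x / fact k * y ^ k" "\<lambda>a. Phi a y"])
      fix n :: nat and x :: complex assume "x \<in> ball 0 1"
      have "((\<lambda>a. rGamma (a + of_nat k + 1)) has_field_derivative deriv (\<lambda>a. rGamma (a + of_nat k + 1)) x) (at x)" for k
        by (rule holomorphic_derivI[of _ UNIV]) (auto intro!: holomorphic_intros)
      then show "((\<lambda>a. \<Sum>k<n. rGamma (a + of_nat k + 1) / fact k * y ^ k) has_field_derivative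
           (\<Sum>k<n. deriv (\<lambda>a. rGamma (a + of_nat k + 1)) x / fact k * y ^ k)) (at x)"
        by (intro DERIV_sum DERIV_cmult_right DERIV_cdivide)
    next
      fix x :: complex assume "x \<in> ball 0 1"
      then obtain e where e: "e > 0" "cball x e \<subseteq> ball 0 1"
        using open_contains_cball[of "ball (0::complex) 1"] open_ball by blast
      then have "uniform_limit (cball x e) (\<lambda>n a. \<Sum>k<n. rGamma (a + of_nat k + 1) / fact k * y ^ k) (\<lambda>a. Phi a y) sequentially"
        by (intro uniform_limit_on_subset[OF Phi_uniform_limit[where N = 1]]) auto
      with e show "\<exists>d>0. cball x d \<subseteq> ball 0 1 \<and> uniform_limit (cball x d) (\<lambda>n a. \<Sum>k<n. rGamma (a + of_nat k + 1) / fact k * y ^ k) (\<lambda>a. Phi a y) sequentially"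
        by blast
    qed auto
    then obtain g' where g': "\<And>x. x \<in> ball (0::complex) 1 \<Longrightarrow> ((\<lambda>a. Phi a y) has_field_derivative g' x) (at x) \<and>
       (\<lambda>n. \<Sum>k<n. deriv (\<lambda>a. rGamma (a + of_nat k + 1)) x / fact k * y ^ k) \<longlonglongrightarrow> g' x"
      by blast
    have "g' 0 = Phi_order_deriv y"
      using g'[of 0] DERIV_unique[OF DERIV_Phi_order[of y], of "g' 0"] by simp
    with g'[of 0] show ?thesis by (simp add: sums_def d_def)
  qed
  have "Phi_order_deriv field_differentiable at y" for y
  proof -
    have "((\<lambda>y. \<Sum>k. d k * y ^ k) has_field_derivative (\<Sum>k. diffs d k * y ^ k)) (at y)"
      by (rule termdiffs_strong_converges_everywhere) (rule sums_summable[OF sums])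
    moreover have "(\<lambda>y. \<Sum>k. d k * y ^ k) = Phi_order_deriv"
      using sums[THEN sums_unique] by (simp add: fun_eq_iff)
    ultimately show ?thesis by (auto simp: field_differentiable_def)
  qed
  then show ?thesis by (simp add: holomorphic_on_open field_differentiable_def)
qed

section \<open>Bessel equation and decay of oscillating solutions\<close>

lemma Bessel_J_Phi: "Bessel_J a z = (z / 2) powr a * Phi a (- ((z / 2)\<^sup>2))"
proof -
  have "(-1) ^ k * rGamma (a + of_nat k + 1) / fact k * (z / 2) ^ (2 * k)
      = rGamma (a + of_nat k + 1) / fact k * (- ((z / 2)\<^sup>2)) ^ k" for k
    unfolding power_minus[of "(z/2)\<^sup>2"] power_mult by simp
  then show ?thesis unfolding Bessel_J_def Phi_def by (simp only:)
qed

lemma Bessel_I_Phi: "Bessel_I a z = (z / 2) powr a * Phi a ((z / 2)\<^sup>2)"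
  unfolding Bessel_I_def Phi_def power_mult by simp

lemma half_notin_nonpos_Reals: "z \<notin> \<real>\<^sub>\<le>\<^sub>0 \<Longrightarrow> z / 2 \<notin> (\<real>\<^sub>\<le>\<^sub>0 :: complex set)"
  by (auto simp: complex_nonpos_Reals_iff)

lemma Bessel_J_contiguous:
  assumes "z \<notin> \<real>\<^sub>\<le>\<^sub>0"
  shows "Bessel_J (a + 2) z = 2 * (a + 1) / z * Bessel_J (a + 1) z - Bessel_J a z"
proof -
  have z: "z \<noteq> 0" using assms by auto
  have p1: "(z/2) powr (a + 1) = (z/2) powr a * (z/2)"
    and p2: "(z/2) powr (a + 2) = (z/2) powr a * (z/2)\<^sup>2"
    using z by (simp_all add: powr_add powr_nat')
  show ?thesis
    unfolding Bessel_J_Phi p1 p2 Phi_contiguous[of a] using z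
    by (simp add: field_simps power2_eq_square)
qed

lemma DERIV_Bessel_J:
  assumes "z \<notin> \<real>\<^sub>\<le>\<^sub>0"
  shows "(Bessel_J a has_field_derivative a / z * Bessel_J a z - Bessel_J (a + 1) z) (at z)"
proof -
  have z: "z \<noteq> 0" "z / 2 \<notin> \<real>\<^sub>\<le>\<^sub>0" using assms half_notin_nonpos_Reals[OF assms] by auto
  have p0: "(z/2) powr (a - 1) * (z / 2) = (z/2) powr a"
    and p1: "(z/2) powr (a + 1) = (z/2) powr a * (z/2)"
    using z by (simp_all add: powr_add powr_diff)
  have "((\<lambda>z. (z / 2) powr a * Phi a (- ((z / 2)\<^sup>2))) has_field_derivative
      (a * (z/2) powr (a - 1) * (1/2)) * Phi a (- ((z / 2)\<^sup>2))
       + (z/2) powr a * (Phi (a + 1) (- ((z / 2)\<^sup>2)) * (- (z / 2)))) (at z)"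
  proof (rule DERIV_mult'[THEN DERIV_cong])
    show "((\<lambda>z. (z / 2) powr a) has_field_derivative a * (z/2) powr (a - 1) * (1/2)) (at z)"
      by (rule DERIV_chain2[OF has_field_derivative_powr[OF z(2)] DERIV_cdivide[OF DERIV_ident]])
    have "((\<lambda>z. - ((z / 2)\<^sup>2)) has_field_derivative - (z / 2)) (at z)"
      by (auto intro!: derivative_eq_intros)
    then show "((\<lambda>z. Phi a (- ((z / 2)\<^sup>2))) has_field_derivative Phi (a + 1) (- ((z / 2)\<^sup>2)) * (- (z / 2))) (at z)"
      by (rule DERIV_chain2[OF DERIV_Phi])
  qed (simp add: algebra_simps)
  moreover have "(a * (z/2) powr (a - 1) * (1/2)) = a / z * (z/2) powr a"
    using z(1) unfolding p0[symmetric] by (simp add: field_simps)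
  ultimately show ?thesis
    unfolding Bessel_J_Phi[abs_def] p1 by (simp only:) (simp add: algebra_simps)
qed

text \<open>The derivative in \<open>z\<close>, in the order-raising form: written without
  \<open>deriv\<close>, it is visibly entire in the order, as the compactness arguments in the order
  require.\<close>

definition Bessel_J' :: "complex \<Rightarrow> complex \<Rightarrow> complex" where
  "Bessel_J' a z = a / z * Bessel_J a z - Bessel_J (a + 1) z"

lemma DERIV_Bessel_J':
  assumes "z \<notin> \<real>\<^sub>\<le>\<^sub>0"
  shows "(Bessel_J' a has_field_derivative - Bessel_J' a z / z - (1 - a\<^sup>2 / z\<^sup>2) * Bessel_J a z) (at z)"
proof -
  have z: "z \<noteq> 0" using assms by auto
  have "((\<lambda>z. a / z * Bessel_J a z - Bessel_J (a + 1) z) has_field_derivative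
      - a / z\<^sup>2 * Bessel_J a z + a / z * (a / z * Bessel_J a z - Bessel_J (a + 1) z)
      - ((a + 1) / z * Bessel_J (a + 1) z - Bessel_J (a + 1 + 1) z)) (at z)"
    by (rule derivative_eq_intros DERIV_Bessel_J assms z refl | simp add: z power2_eq_square)+
  also have "a + 1 + 1 = a + 2" by simp
  finally show ?thesis
    unfolding Bessel_J'_def[abs_def] Bessel_J_contiguous[OF assms]
    by (rule DERIV_cong) (use z in \<open>simp add: field_simps power2_eq_square\<close>)
qed

lemma holomorphic_Bessel_J_arg: "Bessel_J a holomorphic_on - \<real>\<^sub>\<le>\<^sub>0"
  unfolding holomorphic_on_open[OF open_Compl[OF closed_nonpos_Reals_complex]]
  using DERIV_Bessel_J by blast

lemma holomorphic_Bessel_J_order: "z \<noteq> 0 \<Longrightarrow> (\<lambda>a. Bessel_J a z) holomorphic_on A"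
  unfolding Bessel_J_Phi by (intro holomorphic_intros)

lemma holomorphic_Bessel_J'_order: "z \<noteq> 0 \<Longrightarrow> (\<lambda>a. Bessel_J' a z) holomorphic_on A"
  unfolding Bessel_J'_def Bessel_J_Phi by (intro holomorphic_intros) auto

lemma of_real_pos_notin_nonpos: "t > 0 \<Longrightarrow> complex_of_real t \<notin> \<real>\<^sub>\<le>\<^sub>0"
  by (simp add: complex_nonpos_Reals_iff)

text \<open>Bessel's equation as a first-order system, with \<open>b\<close> the square of the
  order. It is linear and depends on the order only through \<open>b\<close>, so combinations of
  \<open>J\<close> at orders \<open>m\<close> and \<open>- m\<close> are covered too.\<close>

definition bessel_system :: "complex \<Rightarrow> (real \<Rightarrow> complex) \<Rightarrow> (real \<Rightarrow> complex) \<Rightarrow> bool" where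
  "bessel_system b f g \<longleftrightarrow> (\<forall>t>0. (f has_vector_derivative g t) (at t) \<and>
     (g has_vector_derivative - g t / of_real t - (1 - b / of_real (t\<^sup>2)) * f t) (at t))"

lemma bessel_system_J: "bessel_system (a\<^sup>2) (\<lambda>t. Bessel_J a (of_real t)) (\<lambda>t. Bessel_J' a (of_real t))"
  unfolding bessel_system_def
proof safe
  fix t :: real assume t: "t > 0"
  note nz = of_real_pos_notin_nonpos[OF t]
  show "((\<lambda>t. Bessel_J a (of_real t)) has_vector_derivative Bessel_J' a (of_real t)) (at t)"
    using DERIV_Bessel_J[OF nz, of a] unfolding Bessel_J'_def
    by (rule has_vector_derivative_real_field)
  show "((\<lambda>t. Bessel_J' a (of_real t)) has_vector_derivative - Bessel_J' a (of_real t) / of_real t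
      - (1 - a\<^sup>2 / of_real (t\<^sup>2)) * Bessel_J a (of_real t)) (at t)"
    using DERIV_Bessel_J'[OF nz, of a] unfolding of_real_power
    by (rule has_vector_derivative_real_field)
qed

lemma bessel_system_combine:
  assumes "bessel_system b f1 g1" "bessel_system b f2 g2"
  shows "bessel_system b (\<lambda>t. c * f1 t + d * f2 t) (\<lambda>t. c * g1 t + d * g2 t)"
  using assms unfolding bessel_system_def
  by (auto intro!: derivative_eq_intros simp: add_divide_distrib diff_divide_distrib algebra_simps)

text \<open>The substitution \<open>u = sqrt t * f\<close> turns Bessel's equation into
  \<open>u'' + (1 - (b - 1/4) / t\<^sup>2) u = 0\<close>; the quantity \<open>E\<close> below is \<open>|u|\<^sup>2 + |u'|\<^sup>2\<close>.\<close>

lemma bessel_energy: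
  assumes sys: "bessel_system b f g" and t0: "0 < t0" "t0 \<le> t"
  defines "E \<equiv> \<lambda>t. t * ((norm (f t))\<^sup>2 + (norm (g t + f t / of_real (2 * t)))\<^sup>2)"
  shows "E t \<le> E t0 * exp (norm (b - 1/4) / t0)"
proof -
  \<comment> \<open>For \<open>u = sqrt t * f\<close> the derivative is
    \<open>u' = sqrt t * h\<close>.\<close>
  define h where "h t = g t + f t / of_real (2 * t)" for t
  define B where "B = b - 1/4"
  \<comment> \<open>The derivative of the energy: the contributions of \<open>u'' + u\<close>
    cancel, and only the perturbation \<open>B u / t^2\<close> is left.\<close>
  define E' where "E' t = 2 * (h t \<bullet> (B * f t)) / t" for t
  have fd: "(f has_vector_derivative h s - f s / of_real (2 * s)) (at s)"
    and hd: "(h has_vector_derivative - h s / of_real (2 * s) - f s + B * f s / of_real (s\<^sup>2)) (at s)" if s: "s > 0" for s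
  proof -
    have f': "(f has_vector_derivative g s) (at s)"
      and g': "(g has_vector_derivative - g s / of_real s - (1 - b / of_real (s\<^sup>2)) * f s) (at s)"
      using sys s unfolding bessel_system_def by auto
    show "(f has_vector_derivative h s - f s / of_real (2 * s)) (at s)"
      using f' by (simp add: h_def)
    have inv: "((\<lambda>t. inverse (of_real (2 * t)) :: complex) has_vector_derivative - 1 / of_real (2 * s\<^sup>2)) (at s)"
    proof -
      have "((\<lambda>t. inverse (2 * t)) has_real_derivative - 1 / (2 * s\<^sup>2)) (at s)"
        using s by (auto intro!: derivative_eq_intros simp: power2_eq_square field_simps)
      from has_vector_derivative_of_real[OF this, where 'a = complex]
      show ?thesis by simp
    qed
    have "(h has_vector_derivative (- g s / of_real s - (1 - b / of_real (s\<^sup>2)) * f s)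
        + (f s * (- 1 / of_real (2 * s\<^sup>2)) + g s * inverse (of_real (2 * s)))) (at s)"
      unfolding h_def[abs_def] divide_inverse[of "f _"]
      by (intro has_vector_derivative_add g' has_vector_derivative_mult f' inv)
    also have "(- g s / of_real s - (1 - b / of_real (s\<^sup>2)) * f s)
        + (f s * (- 1 / of_real (2 * s\<^sup>2)) + g s * inverse (of_real (2 * s)))
       = - h s / of_real (2 * s) - f s + B * f s / of_real (s\<^sup>2)"
      using s unfolding h_def B_def by (simp add: field_simps power2_eq_square)
    finally show "(h has_vector_derivative - h s / of_real (2 * s) - f s + B * f s / of_real (s\<^sup>2)) (at s)" .
  qed
  have E: "E s = s * (f s \<bullet> f s + h s \<bullet> h s)" for s
    by (simp add: E_def h_def power2_norm_eq_inner)
  have Ed: "(E has_real_derivative E' s) (at s)" if s: "s > 0" for s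
  proof -
    have "(E has_derivative (\<lambda>x. x * (f s \<bullet> f s + h s \<bullet> h s) + s *
        ((f s \<bullet> (x *\<^sub>R (h s - f s / of_real (2 * s))) + (x *\<^sub>R (h s - f s / of_real (2 * s))) \<bullet> f s)
       + (h s \<bullet> (x *\<^sub>R (- h s / of_real (2 * s) - f s + B * f s / of_real (s\<^sup>2)))
         + (x *\<^sub>R (- h s / of_real (2 * s) - f s + B * f s / of_real (s\<^sup>2))) \<bullet> h s)))) (at s)"
      unfolding E[abs_def]
      by (rule derivative_eq_intros fd[OF s, unfolded has_vector_derivative_def]
          hd[OF s, unfolded has_vector_derivative_def] refl)+ (simp add: fun_eq_iff algebra_simps)
    also have "(\<lambda>x. x * (f s \<bullet> f s + h s \<bullet> h s) + s *
        ((f s \<bullet> (x *\<^sub>R (h s - f s / of_real (2 * s))) + (x *\<^sub>R (h s - f s / of_real (2 * s))) \<bullet> f s)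
       + (h s \<bullet> (x *\<^sub>R (- h s / of_real (2 * s) - f s + B * f s / of_real (s\<^sup>2)))
         + (x *\<^sub>R (- h s / of_real (2 * s) - f s + B * f s / of_real (s\<^sup>2))) \<bullet> h s))) = (*) (E' s)"
    proof
      fix x
      have 1: "f s / of_real (2 * s) = (1 / (2 * s)) *\<^sub>R f s" "- h s / of_real (2 * s) = - (1 / (2 * s)) *\<^sub>R h s"
        "B * f s / of_real (s\<^sup>2) = (1 / s\<^sup>2) *\<^sub>R (B * f s)"
        by (simp_all add: scaleR_conv_of_real field_simps)
      show "x * (f s \<bullet> f s + h s \<bullet> h s) + s *
        ((f s \<bullet> (x *\<^sub>R (h s - f s / of_real (2 * s))) + (x *\<^sub>R (h s - f s / of_real (2 * s))) \<bullet> f s)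
       + (h s \<bullet> (x *\<^sub>R (- h s / of_real (2 * s) - f s + B * f s / of_real (s\<^sup>2)))
         + (x *\<^sub>R (- h s / of_real (2 * s) - f s + B * f s / of_real (s\<^sup>2))) \<bullet> h s)) = E' s * x"
        unfolding 1 E'_def inner_scaleR_right inner_scaleR_left inner_diff_right inner_diff_left
          inner_add_right inner_add_left inner_commute[of "f s" "h s"] inner_commute[of "B * f s" "h s"]
        using s by (simp add: field_simps power2_eq_square)
    qed
    finally show ?thesis by (simp add: has_field_derivative_def)
  qed
  have E'_le: "E' s \<le> norm B * E s / s\<^sup>2" if s: "s > 0" for s
  proof -
    have "h s \<bullet> (B * f s) \<le> norm (h s) * (norm B * norm (f s))"
      using norm_cauchy_schwarz[of "h s" "B * f s"] by (simp add: norm_mult)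
    moreover have "norm B * (2 * norm (h s) * norm (f s)) \<le> norm B * ((norm (h s))\<^sup>2 + (norm (f s))\<^sup>2)"
      by (intro mult_left_mono sum_squares_bound) auto
    ultimately have "2 * (h s \<bullet> (B * f s)) \<le> norm B * ((norm (h s))\<^sup>2 + (norm (f s))\<^sup>2)"
      by (simp add: mult_ac)
    then have "E' s \<le> norm B * ((norm (h s))\<^sup>2 + (norm (f s))\<^sup>2) / s"
      unfolding E'_def using s by (simp add: divide_right_mono)
    also have "\<dots> = norm B * E s / s\<^sup>2"
      using s by (simp add: E_def h_def power2_eq_square field_simps)
    finally show ?thesis .
  qed
  \<comment> \<open>Gronwall's argument with the integrating factor whose exponent
    \<open>norm B / t\<close> has derivative \<open>- norm B / t^2\<close>; the energy stays bounded
    since \<open>1 / t^2\<close> is integrable at infinity.\<close>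
  have "E t * exp (norm B / t) \<le> E t0 * exp (norm B / t0)"
  proof (rule DERIV_nonpos_imp_nonincreasing[OF t0(2)])
    fix s assume "t0 \<le> s" "s \<le> t"
    then have s: "s > 0" using t0 by auto
    have "((\<lambda>t. E t * exp (norm B / t)) has_real_derivative
        E' s * exp (norm B / s) + E s * (exp (norm B / s) * (- norm B / s\<^sup>2))) (at s)"
      using s by (auto intro!: derivative_eq_intros Ed simp: power2_eq_square)
    moreover have "E' s * exp (norm B / s) + E s * (exp (norm B / s) * (- norm B / s\<^sup>2))
       = exp (norm B / s) * (E' s - norm B * E s / s\<^sup>2)" by (simp add: algebra_simps)
    moreover have "\<dots> \<le> 0" using E'_le[OF s] by (simp add: mult_nonneg_nonpos)
    ultimately show "\<exists>y. ((\<lambda>t. E t * exp (norm B / t)) has_real_derivative y) (at s) \<and> y \<le> 0"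
      by auto
  qed
  moreover have "E t * 1 \<le> E t * exp (norm B / t)"
    unfolding E_def using t0 by (intro mult_left_mono) auto
  ultimately show ?thesis by (simp add: B_def)
qed

text \<open>Built only from the starting point, a bound \<open>\<beta>\<close> for the squared order
  and a bound \<open>A\<close> for the initial values, so the decay holds uniformly in the order.
  The root is that of the energy bound; the factor \<open>1 + 1 / (2 * t0)\<close> recovers
  \<open>g\<close> from \<open>g + f / (2 t)\<close>.\<close>

definition bessel_const :: "real \<Rightarrow> real \<Rightarrow> real \<Rightarrow> real" where
  "bessel_const t0 \<beta> A = sqrt (t0 * (A\<^sup>2 + (A + A / (2 * t0))\<^sup>2) * exp ((\<beta> + 1/4) / t0)) * (1 + 1 / (2 * t0))"

lemma bessel_system_decay:
  assumes sys: "bessel_system b f g" and t0: "0 < t0" "t0 \<le> t"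
    and b: "norm b \<le> \<beta>" and init: "norm (f t0) \<le> A" "norm (g t0) \<le> A"
  shows "norm (f t) \<le> bessel_const t0 \<beta> A / sqrt t" "norm (g t) \<le> bessel_const t0 \<beta> A / sqrt t"
proof -
  define M where "M = t0 * (A\<^sup>2 + (A + A / (2 * t0))\<^sup>2) * exp ((\<beta> + 1/4) / t0)"
  have t: "t > 0" using t0 by simp
  have A: "A \<ge> 0" using init(1) norm_ge_zero[of "f t0"] by linarith
  have nb: "norm (b - 1/4) \<le> \<beta> + 1/4" using norm_triangle_ineq4[of b "1/4"] b by simp
  have h0: "norm (g t0 + f t0 / of_real (2 * t0)) \<le> A + A / (2 * t0)"
    using init t0 by (intro order_trans[OF norm_triangle_ineq] add_mono)
      (auto simp: norm_divide norm_mult intro!: divide_right_mono)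
  have "t * ((norm (f t))\<^sup>2 + (norm (g t + f t / of_real (2 * t)))\<^sup>2)
     \<le> t0 * ((norm (f t0))\<^sup>2 + (norm (g t0 + f t0 / of_real (2 * t0)))\<^sup>2) * exp (norm (b - 1/4) / t0)"
    using bessel_energy[OF sys t0] .
  also have "\<dots> \<le> M" unfolding M_def
    using t0 nb init h0 by (intro mult_mono power_mono add_mono) (auto simp: divide_right_mono)
  finally have *: "(norm (f t))\<^sup>2 + (norm (g t + f t / of_real (2 * t)))\<^sup>2 \<le> M / t"
    using t by (simp add: field_simps)
  have "(norm (f t))\<^sup>2 \<le> M / t" using * zero_le_power2[of "norm (g t + f t / of_real (2 * t))"] by linarith
  then have f: "norm (f t) \<le> sqrt M / sqrt t"
    by (metis real_le_rsqrt real_sqrt_divide)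
  have "(norm (g t + f t / of_real (2 * t)))\<^sup>2 \<le> M / t" using * zero_le_power2[of "norm (f t)"] by linarith
  then have h: "norm (g t + f t / of_real (2 * t)) \<le> sqrt M / sqrt t"
    by (metis real_le_rsqrt real_sqrt_divide)
  have M: "sqrt M \<ge> 0" using order_trans[OF zero_le_power2 \<open>(norm (f t))\<^sup>2 \<le> M / t\<close>] t by (simp add: zero_le_divide_iff)
  have C: "bessel_const t0 \<beta> A = sqrt M * (1 + 1 / (2 * t0))" by (simp add: bessel_const_def M_def)
  have "sqrt M / sqrt t * 1 \<le> sqrt M / sqrt t * (1 + 1 / (2 * t0))"
    using M t t0 by (intro mult_left_mono) auto
  with f show "norm (f t) \<le> bessel_const t0 \<beta> A / sqrt t" by (simp add: C)
  have "norm (g t) \<le> norm (g t + f t / of_real (2 * t)) + norm (f t / of_real (2 * t))"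
    using norm_triangle_ineq4[of "g t + f t / of_real (2 * t)" "f t / of_real (2 * t)"] by simp
  also have "norm (f t / of_real (2 * t)) = norm (f t) * (1 / (2 * t))"
    using t by (simp add: norm_divide norm_mult)
  also have "\<dots> \<le> sqrt M / sqrt t * (1 / (2 * t0))"
    using f M t t0 by (intro mult_mono) (auto simp: frac_le)
  finally show "norm (g t) \<le> bessel_const t0 \<beta> A / sqrt t"
    using h unfolding C by (simp add: algebra_simps add_divide_distrib)
qed

section \<open>Integrals over the positive half-line and the Laplace transform\<close>

lemma integrable_on_continuous_dominated:
  fixes f :: "real \<Rightarrow> complex"
  assumes "continuous_on S f" "S \<in> sets lebesgue" "g integrable_on S" "\<And>x. x \<in> S \<Longrightarrow> norm (f x) \<le> g x"
  shows "f integrable_on S"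
  by (rule measurable_bounded_by_integrable_imp_integrable[OF continuous_imp_measurable_on_sets_lebesgue])
    (use assms in auto)

lemma integrable_powr_exp:
  assumes "\<sigma> > -1" "a > (0::real)"
  shows "(\<lambda>c. c powr \<sigma> * exp (- (a * c))) integrable_on {0<..}"
proof -
  have "(\<lambda>t. complex_of_real t powr (of_real (\<sigma> + 1) - 1) / of_real (exp (a * t))) absolutely_integrable_on {0<..}"
    by (rule absolutely_integrable_Gamma_integral) (use assms in auto)
  then have "(\<lambda>t. norm (complex_of_real t powr (of_real (\<sigma> + 1) - 1) / of_real (exp (a * t)))) integrable_on {0<..}"
    by (simp add: absolutely_integrable_on_def)
  then show ?thesis
    by (rule integrable_eq) (simp add: norm_mult norm_inverse norm_powr_real_powr exp_minus divide_inverse)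
qed

text \<open>Proved from the definition by compact intervals, because the main integral converges
  only conditionally and substitution rules for absolutely integrable functions do not
  apply.\<close>

lemma has_integral_scale_pos:
  fixes f :: "real \<Rightarrow> complex"
  assumes f: "(f has_integral I) {0<..}" and m: "m > 0"
  shows "((\<lambda>c. f (m * c)) has_integral (I / of_real m)) {0<..}"
proof -
  define h where "h x = (if x \<in> {0<..} then f x else 0)" for x
  have h: "h integrable_on cbox a b" for a b
    using f unfolding has_integral_alt'[of f] h_def by blast
  have hm: "((\<lambda>x. h (m * x)) has_integral (integral {m * a..m * b} h / of_real m)) {a..b}" for a b
  proof -
    have "(h has_integral integral (cbox (m * a) (m * b)) h) (cbox (m * a) (m * b))"
      using h by blast
    from has_integral_affinity'[OF this m, of 0]
    have "((\<lambda>x. h (m * x)) has_integral (integral {m * a..m * b} h / of_real m)) {inverse m * (m * a)..inverse m * (m * b)}"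
      by (simp add: scaleR_conv_of_real divide_inverse_commute del: mult_cancel_left)
    moreover have "inverse m * (m * a) = a" "inverse m * (m * b) = b" using m by simp_all
    ultimately show ?thesis by (simp only:)
  qed
  have eq: "(\<lambda>x. if x \<in> {0<..} then f (m * x) else 0) = (\<lambda>x. h (m * x))"
    using m by (auto simp: h_def fun_eq_iff zero_less_mult_iff)
  show ?thesis unfolding has_integral_alt'[of "\<lambda>c. f (m * c)"] eq
  proof (intro conjI allI impI)
    fix a b :: real
    show "(\<lambda>x. h (m * x)) integrable_on cbox a b" using hm[of a b] by auto
  next
    fix e :: real assume "e > 0"
    then have "e * m > 0" using m by simp
    then obtain B where B: "B > 0" "\<And>a b. ball 0 B \<subseteq> cbox a b \<Longrightarrow> norm (integral (cbox a b) h - I) < e * m"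
      using f unfolding has_integral_alt'[of f] h_def[abs_def] by blast
    show "\<exists>B>0. \<forall>a b. ball 0 B \<subseteq> cbox a b \<longrightarrow>
        norm (integral (cbox a b) (\<lambda>x. h (m * x)) - I / of_real m) < e"
    proof (intro exI[of _ "B / m"] conjI allI impI)
      show "B / m > 0" using B(1) m by simp
      fix a b :: real assume ab: "ball 0 (B / m) \<subseteq> cbox a b"
      have "ball 0 B \<subseteq> cbox (m * a) (m * b)"
      proof
        fix x :: real assume "x \<in> ball 0 B"
        then have "x / m \<in> ball 0 (B / m)" using m by (simp add: divide_strict_right_mono)
        then have "x / m \<in> cbox a b" using ab by blast
        then show "x \<in> cbox (m * a) (m * b)" using m by (simp add: field_simps)
      qed
      then have "norm (integral (cbox (m * a) (m * b)) h - I) < e * m" by (rule B)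
      moreover have "integral (cbox a b) (\<lambda>x. h (m * x)) - I / of_real m
          = (integral (cbox (m * a) (m * b)) h - I) / of_real m"
        using integral_unique[OF hm[of a b]] m by (simp add: field_simps)
      ultimately show "norm (integral (cbox a b) (\<lambda>x. h (m * x)) - I / of_real m) < e"
        using m by (simp add: norm_divide field_simps)
    qed
  qed
qed

lemma integral_exhaust_pos:
  fixes f :: "real \<Rightarrow> complex"
  assumes f: "continuous_on {0<..} f" and g: "g integrable_on {0<..}" and le: "\<And>x. x > 0 \<Longrightarrow> norm (f x) \<le> g x"
  shows "(\<lambda>n. integral {1 / real (Suc n)..real (Suc n)} f) \<longlonglongrightarrow> integral {0<..} f"
proof -
  define S where "S n = {1 / real (Suc n)..real (Suc n)}" for n
  have S: "S n \<subseteq> {0<..}" for n by (auto simp: S_def intro: less_le_trans[rotated])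
  have fS: "f integrable_on S n" for n unfolding S_def
    by (intro integrable_continuous_real continuous_on_subset[OF f] S[unfolded S_def])
  have "(\<lambda>n. integral {0<..} (\<lambda>x. if x \<in> S n then f x else 0)) \<longlonglongrightarrow> integral {0<..} f"
  proof (rule dominated_convergence(2)[OF _ g])
    show "(\<lambda>x. if x \<in> S n then f x else 0) integrable_on {0<..}" for n
      using fS[of n] S[of n] by (subst integrable_restrict_Int) (simp add: Int_absorb2)
    show "norm (if x \<in> S n then f x else 0) \<le> g x" if "x \<in> {0<..}" for n x
      using le[of x] that order_trans[OF norm_ge_zero le[of x]] by auto
    show "(\<lambda>n. if x \<in> S n then f x else 0) \<longlonglongrightarrow> f x" if "x \<in> {0<..}" for x
    proof (rule tendsto_eventually)
      have x: "x > 0" using that by simp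
      obtain N where N: "real N \<ge> max x (1 / x)" using real_arch_simple by blast
      show "\<forall>\<^sub>F n in sequentially. (if x \<in> S n then f x else 0) = f x"
        using eventually_ge_at_top[of N]
      proof eventually_elim
        case (elim n)
        then have n: "x \<le> real (Suc n)" "1 / x \<le> real (Suc n)" using N by (auto simp: le_max_iff_disj)
        then have "1 / real (Suc n) \<le> x" using x by (simp add: field_simps)
        with n show ?case by (simp add: S_def)
      qed
    qed
  qed
  also have "(\<lambda>n. integral {0<..} (\<lambda>x. if x \<in> S n then f x else 0)) = (\<lambda>n. integral (S n) f)"
    using S by (subst integral_restrict_Int) (simp add: Int_absorb2)
  finally show ?thesis by (simp add: S_def)
qed

text \<open>Both endpoints may be singular, so the fundamental theorem is used on
  \<open>[1 / k, k]\<close>. Domination makes limits along this single sequence enough; all later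
  integrations by parts on the half-line go through here.\<close>

lemma integral_FTC_pos:
  fixes F f :: "real \<Rightarrow> complex"
  assumes f: "continuous_on {0<..} f" and g: "g integrable_on {0<..}" and le: "\<And>x. x > 0 \<Longrightarrow> norm (f x) \<le> g x"
    and F: "\<And>x. x > 0 \<Longrightarrow> (F has_vector_derivative f x) (at x)"
    and A: "(\<lambda>n. F (1 / real (Suc n))) \<longlonglongrightarrow> A" and B: "(\<lambda>n. F (real (Suc n))) \<longlonglongrightarrow> B"
  shows "integral {0<..} f = B - A"
proof (rule LIMSEQ_unique[OF integral_exhaust_pos[OF f g le]])
  have "integral {1 / real (Suc n)..real (Suc n)} f = F (real (Suc n)) - F (1 / real (Suc n))" for n
  proof (rule integral_unique[OF fundamental_theorem_of_calculus])
    show "1 / real (Suc n) \<le> real (Suc n)" by (simp add: field_simps)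
    fix x assume "x \<in> {1 / real (Suc n)..real (Suc n)}"
    then have "x > 0" by (auto intro: less_le_trans[rotated])
    then show "(F has_vector_derivative f x) (at x within {1 / real (Suc n)..real (Suc n)})"
      by (rule has_vector_derivative_at_within[OF F])
  qed
  then show "(\<lambda>n. integral {1 / real (Suc n)..real (Suc n)} f) \<longlonglongrightarrow> B - A"
    using tendsto_diff[OF B A] by simp
qed auto

text \<open>Two exponents, one for the behaviour at 0 and one for infinity; their sum avoids a case
  distinction at 1. Both exceed -1, so the Laplace transform converges absolutely for
  \<open>Re p > 0\<close>, and multiplication by powers of \<open>c\<close> stays inside the
  class.\<close>

definition pow_bounded :: "(real \<Rightarrow> complex) \<Rightarrow> bool" where
  "pow_bounded w \<longleftrightarrow> continuous_on {0<..} w \<and>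
     (\<exists>B \<sigma> \<tau>. B \<ge> 0 \<and> \<sigma> > -1 \<and> \<tau> > -1 \<and> (\<forall>c>0. norm (w c) \<le> B * (c powr \<sigma> + c powr \<tau>)))"

lemma pow_boundedI:
  assumes "continuous_on {0<..} w" "\<sigma> > -1" "\<tau> > -1" "\<And>c. c > 0 \<Longrightarrow> norm (w c) \<le> B * (c powr \<sigma> + c powr \<tau>)"
  shows "pow_bounded w"
proof -
  have "norm (w c) \<le> \<bar>B\<bar> * (c powr \<sigma> + c powr \<tau>)" if "c > 0" for c
    using assms(4)[OF that] mult_right_mono[of B "\<bar>B\<bar>" "c powr \<sigma> + c powr \<tau>"] by (auto intro: order_trans)
  then show ?thesis unfolding pow_bounded_def using assms by (meson abs_ge_zero)
qed

lemma pow_bounded_mult_power: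
  assumes "pow_bounded w"
  shows "pow_bounded (\<lambda>c. of_real (c ^ k) * w c)"
proof -
  obtain B \<sigma> \<tau> where *: "continuous_on {0<..} w" "B \<ge> 0" "\<sigma> > -1" "\<tau> > -1"
    "\<And>c. c > 0 \<Longrightarrow> norm (w c) \<le> B * (c powr \<sigma> + c powr \<tau>)"
    using assms unfolding pow_bounded_def by blast
  show ?thesis
  proof (rule pow_boundedI)
    show "continuous_on {0<..} (\<lambda>c. of_real (c ^ k) * w c)" by (intro continuous_intros *)
    show "\<sigma> + real k > -1" "\<tau> + real k > -1" using * by auto
    fix c :: real assume c: "c > 0"
    have "norm (of_real (c ^ k) * w c) = c ^ k * norm (w c)" using c by (simp add: norm_mult norm_power)
    also have "\<dots> \<le> c ^ k * (B * (c powr \<sigma> + c powr \<tau>))" using c by (intro mult_left_mono *) auto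
    also have "\<dots> = B * (c powr (\<sigma> + real k) + c powr (\<tau> + real k))"
      using c by (simp add: powr_add powr_realpow algebra_simps)
    finally show "norm (of_real (c ^ k) * w c) \<le> B * (c powr (\<sigma> + real k) + c powr (\<tau> + real k))" .
  qed
qed

lemma pow_bounded_dominant:
  assumes "pow_bounded w" "a > 0"
  obtains g where "g integrable_on {0<..}" "\<And>c. c > 0 \<Longrightarrow> norm (w c) * exp (- (a * c)) \<le> g c"
proof -
  obtain B \<sigma> \<tau> where *: "continuous_on {0<..} w" "B \<ge> 0" "\<sigma> > -1" "\<tau> > -1"
    "\<And>c. c > 0 \<Longrightarrow> norm (w c) \<le> B * (c powr \<sigma> + c powr \<tau>)"
    using assms unfolding pow_bounded_def by blast
  show ?thesis
  proof (rule that)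
    show "(\<lambda>c. B * (c powr \<sigma> * exp (- (a * c)) + c powr \<tau> * exp (- (a * c)))) integrable_on {0<..}"
      by (intro integrable_on_mult_right integrable_add integrable_powr_exp * assms)
    fix c :: real assume c: "c > 0"
    show "norm (w c) * exp (- (a * c)) \<le> B * (c powr \<sigma> * exp (- (a * c)) + c powr \<tau> * exp (- (a * c)))"
      using mult_right_mono[OF *(5)[OF c], of "exp (- (a * c))"] by (simp add: algebra_simps)
  qed
qed

definition Lap :: "(real \<Rightarrow> complex) \<Rightarrow> complex \<Rightarrow> complex" where
  "Lap w p = integral {0<..} (\<lambda>c. exp (- (p * of_real c)) * w c)"

lemma norm_Lap_integrand: "norm (exp (- (p * of_real c)) * w c) = norm (w c) * exp (- (Re p * c))"
  by (simp add: norm_mult)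

lemma Lap_integrable:
  assumes w: "pow_bounded w" and p: "Re p > 0"
  shows "(\<lambda>c. exp (- (p * of_real c)) * w c) integrable_on {0<..}"
proof -
  obtain g where g: "g integrable_on {0<..}" "\<And>c. c > 0 \<Longrightarrow> norm (w c) * exp (- (Re p * c)) \<le> g c"
    using pow_bounded_dominant[OF w p] by blast
  show ?thesis
  proof (rule integrable_on_continuous_dominated[OF _ _ g(1)])
    show "continuous_on {0<..} (\<lambda>c. exp (- (p * of_real c)) * w c)"
      using w unfolding pow_bounded_def by (intro continuous_intros) auto
  qed (use g(2) norm_Lap_integrand[of p _ w] in auto)
qed

lemma norm_exp_minus_one_le: "norm (exp z - 1) \<le> norm z * exp (norm (z::complex))"
proof -
  have "norm (exp z - exp 0) \<le> exp (norm z) * norm (z - 0)"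
  proof (rule field_differentiable_bound[of "cball 0 (norm z)" exp exp])
    show "norm (exp u) \<le> exp (norm z)" if "u \<in> cball 0 (norm z)" for u
      using that norm_exp[of u] by (auto intro: order_trans)
  qed (auto intro!: derivative_eq_intros)
  then show ?thesis by (simp add: mult.commute)
qed

lemma DERIV_Lap:
  assumes w: "pow_bounded w" and p: "Re p > 0"
  shows "(Lap w has_field_derivative - Lap (\<lambda>c. of_real c * w c) p) (at p)"
  unfolding has_field_derivative_iff tendsto_at_iff_sequentially
proof safe
  fix X :: "nat \<Rightarrow> complex" assume X: "\<forall>i. X i \<in> UNIV - {p}" and lim: "X \<longlonglongrightarrow> p"
  have "eventually (\<lambda>i. dist (X i) p < Re p / 2) sequentially"
    using lim p by (intro tendstoD) auto
  then obtain N where N: "\<And>i. i \<ge> N \<Longrightarrow> norm (X i - p) < Re p / 2"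
    unfolding eventually_sequentially dist_norm by blast
  \<comment> \<open>Dropping finitely many terms keeps \<open>Y i\<close> within
    \<open>Re p / 2\<close> of \<open>p\<close>, so that half of the exponential decay survives in
    the dominating function.\<close>
  define Y where "Y i = X (i + N)" for i
  have Y: "norm (Y i - p) < Re p / 2" "Y i \<noteq> p" for i using N X by (auto simp: Y_def)
  have Ylim: "Y \<longlonglongrightarrow> p" unfolding Y_def using lim by (rule LIMSEQ_ignore_initial_segment)
  have ReY: "Re (Y i) > Re p / 2" for i
    using Y(1)[of i] abs_Re_le_cmod[of "Y i - p"] by simp
  have cw: "pow_bounded (\<lambda>c. of_real c * w c)" using pow_bounded_mult_power[OF w, of 1] by simp
  obtain g where g: "g integrable_on {0<..}" "\<And>c. c > 0 \<Longrightarrow> norm (of_real c * w c) * exp (- (Re p / 2 * c)) \<le> g c"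
    using pow_bounded_dominant[OF cw, of "Re p / 2"] p by auto
  define q where "q i c = (exp (- (Y i * of_real c)) * w c - exp (- (p * of_real c)) * w c) / (Y i - p)" for i c
  have int: "(\<lambda>c. exp (- (Y i * of_real c)) * w c) integrable_on {0<..}"
    "(\<lambda>c. exp (- (p * of_real c)) * w c) integrable_on {0<..}" for i
    using ReY[of i] p by (auto intro!: Lap_integrable w)
  have "(\<lambda>i. integral {0<..} (q i)) \<longlonglongrightarrow> integral {0<..} (\<lambda>c. - (exp (- (p * of_real c)) * (of_real c * w c)))"
  proof (rule dominated_convergence(2)[OF _ g(1)])
    show "q i integrable_on {0<..}" for i
      unfolding q_def[abs_def] divide_inverse by (intro integrable_on_mult_left integrable_diff int)
    show "norm (q i c) \<le> g c" if "c \<in> {0<..}" for i c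
    proof -
      have c: "c > 0" using that by simp
      let ?h = "- ((Y i - p) * of_real c)"
      have "q i c = exp (- (p * of_real c)) * w c * (exp ?h - 1) / (Y i - p)"
        unfolding q_def by (simp add: algebra_simps flip: exp_add)
      then have "norm (q i c) = exp (- (Re p * c)) * norm (w c) * norm (exp ?h - 1) / norm (Y i - p)"
        by (simp add: norm_mult norm_divide)
      also have "\<dots> \<le> exp (- (Re p * c)) * norm (w c) * (norm ?h * exp (norm ?h)) / norm (Y i - p)"
        by (intro divide_right_mono mult_left_mono norm_exp_minus_one_le) auto
      also have "\<dots> = exp (- (Re p * c)) * norm (w c) * (c * exp (norm (Y i - p) * c))"
        using Y(2)[of i] c by (simp add: norm_mult)
      also have "\<dots> \<le> exp (- (Re p * c)) * norm (w c) * (c * exp (Re p / 2 * c))"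
        using Y(1)[of i] c by (intro mult_left_mono) auto
      also have "\<dots> = norm (of_real c * w c) * (exp (- (Re p * c)) * exp (Re p / 2 * c))"
        using c by (simp add: norm_mult)
      also have "exp (- (Re p * c)) * exp (Re p / 2 * c) = exp (- (Re p / 2 * c))"
        by (simp flip: exp_add add: algebra_simps)
      also have "norm (of_real c * w c) * \<dots> \<le> g c" by (rule g(2)[OF c])
      finally show ?thesis .
    qed
    show "(\<lambda>i. q i c) \<longlonglongrightarrow> - (exp (- (p * of_real c)) * (of_real c * w c))" if "c \<in> {0<..}" for c
    proof -
      have "((\<lambda>p. exp (- (p * of_real c)) * w c) has_field_derivative - (exp (- (p * of_real c)) * (of_real c * w c))) (at p)"
        by (auto intro!: derivative_eq_intros)
      then have "((\<lambda>y. (exp (- (y * of_real c)) * w c - exp (- (p * of_real c)) * w c) / (y - p)) \<longlongrightarrow>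
          - (exp (- (p * of_real c)) * (of_real c * w c))) (at p)"
        by (simp add: has_field_derivative_iff)
      from this[unfolded tendsto_at_iff_sequentially, rule_format, OF _ Ylim] Y(2)
      show ?thesis unfolding q_def by (simp add: o_def)
    qed
  qed
  moreover have "integral {0<..} (q i) = (Lap w (Y i) - Lap w p) / (Y i - p)" for i
    unfolding q_def Lap_def divide_inverse
    by (subst integral_mult_left, subst integral_diff[OF int]) auto
  ultimately have "(\<lambda>i. (Lap w (X (i + N)) - Lap w p) / (X (i + N) - p)) \<longlonglongrightarrow> - Lap (\<lambda>c. of_real c * w c) p"
    by (simp add: Y_def Lap_def)
  then have "(\<lambda>i. (Lap w (X i) - Lap w p) / (X i - p)) \<longlonglongrightarrow> - Lap (\<lambda>c. of_real c * w c) p"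
    by (rule LIMSEQ_offset)
  then show "((\<lambda>y. (Lap w y - Lap w p) / (y - p)) \<circ> X) \<longlonglongrightarrow> - Lap (\<lambda>c. of_real c * w c) p"
    by (simp add: o_def)
qed

lemma open_Re_pos: "open {p. Re p > 0}"
  by (simp add: open_halfspace_Re_gt)

lemma higher_deriv_Lap:
  assumes "pow_bounded w" "Re p > 0"
  shows "(deriv ^^ k) (Lap w) p = (-1) ^ k * Lap (\<lambda>c. of_real (c ^ k) * w c) p"
  using assms(2)
proof (induction k arbitrary: p)
  case 0
  then show ?case by simp
next
  case (Suc k)
  have "((deriv ^^ k) (Lap w) has_field_derivative (-1) ^ k * - Lap (\<lambda>c. of_real c * (of_real (c ^ k) * w c)) p) (at p)"
  proof (rule has_field_derivative_transform_within_open[OF _ open_Re_pos])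
    show "((\<lambda>p. (-1) ^ k * Lap (\<lambda>c. of_real (c ^ k) * w c) p) has_field_derivative
       (-1) ^ k * - Lap (\<lambda>c. of_real c * (of_real (c ^ k) * w c)) p) (at p)"
      by (intro DERIV_cmult DERIV_Lap pow_bounded_mult_power assms Suc.prems)
  qed (use Suc in auto)
  from DERIV_imp_deriv[OF this] show ?case by (simp add: mult_ac)
qed

section \<open>Abel's theorem for the Laplace transform\<close>

lemma pow_bounded_integral_Icc:
  assumes "pow_bounded f"
  obtains K :: real and \<sigma> \<tau> where "K \<ge> 0" "\<sigma> > 0" "\<tau> > 0" "\<And>R. f integrable_on {0..R}"
    "\<And>R. R \<ge> 0 \<Longrightarrow> norm (integral {0..R} f) \<le> K * (R powr \<sigma> + R powr \<tau>)"
proof -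
  obtain B \<sigma> \<tau> where *: "continuous_on {0<..} f" "B \<ge> 0" "\<sigma> > -1" "\<tau> > -1"
    "\<And>c. c > 0 \<Longrightarrow> norm (f c) \<le> B * (c powr \<sigma> + c powr \<tau>)"
    using assms unfolding pow_bounded_def by blast
  have g: "((\<lambda>c. B * (c powr \<sigma> + c powr \<tau>)) has_integral
      B * (R powr (\<sigma> + 1) / (\<sigma> + 1) + R powr (\<tau> + 1) / (\<tau> + 1))) {0..R}" if "R \<ge> 0" for R
    using * that by (intro has_integral_mult_right has_integral_add has_integral_powr_from_0) auto
  \<comment> \<open>The bound says nothing about the value at 0, which is therefore reset; a single
    point does not affect the integral.\<close>
  define f0 where "f0 c = (if c = 0 then 0 else f c)" for c
  have f0: "f0 integrable_on {0..R}" "norm (integral {0..R} f0) \<le> B * (R powr (\<sigma> + 1) / (\<sigma> + 1) + R powr (\<tau> + 1) / (\<tau> + 1))"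
    if R: "R \<ge> 0" for R
  proof -
    have "f integrable_on {0<..R}"
    proof (rule integrable_on_continuous_dominated)
      show "continuous_on {0<..R} f" by (rule continuous_on_subset[OF *(1)]) auto
      show "(\<lambda>c. B * (c powr \<sigma> + c powr \<tau>)) integrable_on {0<..R}"
        using * R by (intro integrable_on_mult_right integrable_add integrable_on_powr_from_0') auto
    qed (use * in auto)
    then have "f0 integrable_on {0<..R}"
      by (rule integrable_eq) (auto simp: f0_def)
    then show f0: "f0 integrable_on {0..R}"
      by (rule integrable_spike_set) (auto intro: negligible_subset[of "{0}"])
    have "norm (integral {0..R} f0) \<le> integral {0..R} (\<lambda>c. B * (c powr \<sigma> + c powr \<tau>))"
    proof (rule integral_norm_bound_integral[OF f0])
      show "(\<lambda>c. B * (c powr \<sigma> + c powr \<tau>)) integrable_on {0..R}" using g[OF R] by blast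
      show "norm (f0 x) \<le> B * (x powr \<sigma> + x powr \<tau>)" if "x \<in> {0..R}" for x
        using *(5)[of x] that by (auto simp: f0_def)
    qed
    then show "norm (integral {0..R} f0) \<le> B * (R powr (\<sigma> + 1) / (\<sigma> + 1) + R powr (\<tau> + 1) / (\<tau> + 1))"
      unfolding integral_unique[OF g[OF R]] .
  qed
  have eq: "integral {0..R} f0 = integral {0..R} f" for R
    by (rule integral_spike[of "{0}"]) (auto simp: f0_def)
  have int: "f integrable_on {0..R}" for R
  proof (cases "R \<ge> 0")
    case True
    from f0(1)[OF this] show ?thesis
      by (rule integrable_spike[of _ _ "{0}"]) (auto simp: f0_def)
  qed auto
  define K where "K = B * (1 / (\<sigma> + 1) + 1 / (\<tau> + 1))"
  have "B * (R powr (\<sigma> + 1) / (\<sigma> + 1) + R powr (\<tau> + 1) / (\<tau> + 1)) \<le> K * (R powr (\<sigma> + 1) + R powr (\<tau> + 1))" for R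
  proof -
    have "R powr (\<sigma> + 1) / (\<sigma> + 1) + R powr (\<tau> + 1) / (\<tau> + 1)
       \<le> (1 / (\<sigma> + 1) + 1 / (\<tau> + 1)) * (R powr (\<sigma> + 1) + R powr (\<tau> + 1))"
      using * by (simp add: algebra_simps)
    from mult_left_mono[OF this *(2)] show ?thesis by (simp add: K_def mult.assoc)
  qed
  with f0(2) have "norm (integral {0..R} f) \<le> K * (R powr (\<sigma> + 1) + R powr (\<tau> + 1))" if "R \<ge> 0" for R
    unfolding eq[symmetric] using that order_trans by blast
  moreover have "K \<ge> 0" unfolding K_def using * by (intro mult_nonneg_nonneg add_nonneg_nonneg) auto
  ultimately show ?thesis using * int by (intro that[of K "\<sigma> + 1" "\<tau> + 1"]) auto
qed

lemma integral_exp_minus: "((\<lambda>t. exp (- of_real t)) has_integral (1::complex)) {0<..}"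
proof -
  have "((\<lambda>t. of_real t powr (1 - 1) / of_real (exp t)) has_integral Gamma (1::complex)) {0<..}"
    by (rule Gamma_integral_complex') auto
  then have "((\<lambda>t. exp (- of_real t)) has_integral Gamma (1::complex)) {0<..}"
    by (rule has_integral_eq[rotated]) (auto simp: exp_minus divide_inverse exp_of_real[symmetric])
  then show ?thesis by simp
qed

text \<open>With \<open>F\<close> the primitive from 0, parts give
  \<open>Lap f p = p * Lap F p\<close>; for \<open>p = 1 / m\<close> rescaling turns this into the
  integral of \<open>exp (- t) * F (m t)\<close>. As \<open>F\<close> is bounded and tends to
  \<open>l\<close>, dominated convergence applies although \<open>f\<close> need not be absolutely
  integrable.\<close>

lemma Abel_Laplace:
  assumes f: "pow_bounded f" and lim: "((\<lambda>R. integral {0..R} f) \<longlongrightarrow> l) at_top"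
  shows "(\<lambda>n. Lap f (of_real (1 / real (Suc n)))) \<longlonglongrightarrow> l"
proof -
  obtain K :: real and \<sigma> \<tau> where K: "K \<ge> 0" "\<sigma> > 0" "\<tau> > 0" "\<And>R. f integrable_on {0..R}"
    "\<And>R. R \<ge> 0 \<Longrightarrow> norm (integral {0..R} f) \<le> K * (R powr \<sigma> + R powr \<tau>)"
    using pow_bounded_integral_Icc[OF f] by blast
  define F where "F R = integral {0..R} f" for R
  have fc: "continuous_on {0<..} f" using f by (simp add: pow_bounded_def)
  have F': "(F has_vector_derivative f x) (at x)" if x: "x > 0" for x
  proof -
    have "continuous (at x) f" using fc x by (simp add: continuous_on_eq_continuous_at)
    then have "((\<lambda>u. integral {0..u} f) has_vector_derivative f x) (at x within ({0..x+1} - {}))"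
      using x by (intro integral_has_vector_derivative_continuous_at K(4)) (auto intro: continuous_within_subset)
    then show ?thesis unfolding F_def[abs_def]
      using x at_within_Icc_at[of 0 x "x + 1"] by simp
  qed
  have Fc: "continuous_on {0<..} F"
    using F' by (intro continuous_at_imp_continuous_on) (auto intro: has_vector_derivative_continuous)
  obtain R0 where R0: "R0 > 0" "\<And>R. R \<ge> R0 \<Longrightarrow> norm (F R - l) < 1"
  proof -
    have "eventually (\<lambda>R. dist (F R) l < 1) at_top"
      using lim unfolding F_def by (rule tendstoD) auto
    then obtain r where "\<And>R. R \<ge> r \<Longrightarrow> norm (F R - l) < 1"
      by (auto simp: eventually_at_top_linorder dist_norm)
    then show ?thesis by (intro that[of "max r 1"]) auto
  qed
  \<comment> \<open>Beyond \<open>R0\<close> the primitive is within 1 of its limit; before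
    \<open>R0\<close> the power bound is monotone and its value at \<open>R0\<close>
    suffices.\<close>
  define M where "M = norm l + 1 + K * (R0 powr \<sigma> + R0 powr \<tau>)"
  have FM: "norm (F R) \<le> M" if "R > 0" for R
  proof (cases "R \<ge> R0")
    case True
    have "norm (F R) \<le> norm (F R - l) + norm l" using norm_triangle_ineq[of "F R - l" l] by simp
    moreover have "K * (R0 powr \<sigma> + R0 powr \<tau>) \<ge> 0" using K by simp
    ultimately show ?thesis using R0(2)[OF True] unfolding M_def by linarith
  next
    case False
    have "norm (F R) \<le> K * (R powr \<sigma> + R powr \<tau>)" using K(5) that by (simp add: F_def)
    also have "\<dots> \<le> K * (R0 powr \<sigma> + R0 powr \<tau>)"
      using False that K by (intro mult_left_mono add_mono powr_mono2) auto
    also have "\<dots> \<le> M" unfolding M_def by simp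
    finally show ?thesis .
  qed
  have M: "M \<ge> 0" using FM[of 1] norm_ge_zero[of "F 1"] by linarith
  have F0: "(\<lambda>n. F (1 / real (Suc n))) \<longlonglongrightarrow> 0"
  proof (rule Lim_null_comparison)
    show "\<forall>\<^sub>F n in sequentially. norm (F (1 / real (Suc n))) \<le> K * ((1 / real (Suc n)) powr \<sigma> + (1 / real (Suc n)) powr \<tau>)"
      using K(5) by (intro always_eventually) (auto simp: F_def)
    have "(\<lambda>n. (1 / real (Suc n)) powr \<sigma>) \<longlonglongrightarrow> 0" "(\<lambda>n. (1 / real (Suc n)) powr \<tau>) \<longlonglongrightarrow> 0"
      using K(2,3) by real_asymp+
    from tendsto_mult_left[OF tendsto_add[OF this], of K]
    show "(\<lambda>n. K * ((1 / real (Suc n)) powr \<sigma> + (1 / real (Suc n)) powr \<tau>)) \<longlonglongrightarrow> 0"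
      by simp
  qed
  have Fpb: "pow_bounded F"
    by (rule pow_boundedI[OF Fc, of 0 0 M]) (use FM M in force)+
  have parts: "Lap f (of_real p) = of_real p * Lap F (of_real p)" if p: "p > 0" for p :: real
  proof -
    let ?E = "\<lambda>c. exp (- (of_real p * of_real c)) :: complex"
    obtain g where g: "g integrable_on {0<..}" "\<And>c. c > 0 \<Longrightarrow> norm (f c) * exp (- (p * c)) \<le> g c"
      using pow_bounded_dominant[OF f p] by blast
    obtain g2 where g2: "g2 integrable_on {0<..}" "\<And>c. c > 0 \<Longrightarrow> norm (F c) * exp (- (p * c)) \<le> g2 c"
      using pow_bounded_dominant[OF Fpb p] by blast
    have "integral {0<..} (\<lambda>c. ?E c * f c - of_real p * (?E c * F c)) = 0 - 0"
    proof (rule integral_FTC_pos[where F = "\<lambda>c. ?E c * F c"])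
      show "continuous_on {0<..} (\<lambda>c. ?E c * f c - of_real p * (?E c * F c))"
        by (intro continuous_intros fc Fc)
      show "(\<lambda>c. g c + p * g2 c) integrable_on {0<..}"
        by (intro integrable_add integrable_on_mult_right g g2)
      fix c :: real assume c: "c > 0"
      have "norm (?E c * f c - of_real p * (?E c * F c)) \<le> norm (f c) * exp (- (p * c)) + p * (norm (F c) * exp (- (p * c)))"
        using p by (intro order_trans[OF norm_triangle_ineq4]) (auto simp: norm_mult)
      also have "\<dots> \<le> g c + p * g2 c"
        using g(2)[OF c] g2(2)[OF c] p by (intro add_mono mult_left_mono) auto
      finally show "norm (?E c * f c - of_real p * (?E c * F c)) \<le> g c + p * g2 c" .
      have "(?E has_vector_derivative - of_real p * ?E c) (at c)"
        by (rule has_vector_derivative_real_field) (auto intro!: derivative_eq_intros)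
      from has_vector_derivative_mult[OF this F'[OF c]]
      show "((\<lambda>c. ?E c * F c) has_vector_derivative ?E c * f c - of_real p * (?E c * F c)) (at c)"
        by (simp add: algebra_simps)
    next
      have "(\<lambda>n. ?E (1 / real (Suc n))) \<longlonglongrightarrow> exp (- (of_real p * of_real 0))"
        by (intro tendsto_intros LIMSEQ_Suc[OF lim_1_over_n])
      from tendsto_mult[OF this F0] show "(\<lambda>n. ?E (1 / real (Suc n)) * F (1 / real (Suc n))) \<longlonglongrightarrow> 0" by simp
      show "(\<lambda>n. ?E (real (Suc n)) * F (real (Suc n))) \<longlonglongrightarrow> 0"
      proof (rule Lim_null_comparison)
        show "\<forall>\<^sub>F n in sequentially. norm (?E (real (Suc n)) * F (real (Suc n))) \<le> exp (- (p * real (Suc n))) * M"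
          using FM by (intro always_eventually) (auto simp: norm_mult intro!: mult_left_mono)
        show "(\<lambda>n. exp (- (p * real (Suc n))) * M) \<longlonglongrightarrow> 0"
          using p by real_asymp
      qed
    qed
    moreover have "integral {0<..} (\<lambda>c. ?E c * f c - of_real p * (?E c * F c)) = Lap f (of_real p) - of_real p * Lap F (of_real p)"
      unfolding Lap_def using Lap_integrable[OF f, of "of_real p"] Lap_integrable[OF Fpb, of "of_real p"] p
      by (subst integral_diff) (auto intro: integrable_on_mult_right)
    ultimately show ?thesis by simp
  qed
  have scaled: "Lap f (of_real (1 / real (Suc n))) = integral {0<..} (\<lambda>t. exp (- of_real t) * F (t * real (Suc n)))" for n
  proof -
    define m where "m = real (Suc n)"
    have m: "m > 0" by (simp add: m_def)
    have "((\<lambda>c. exp (- (of_real (1/m) * of_real c)) * F c) has_integral Lap F (of_real (1/m))) {0<..}"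
      unfolding Lap_def using m by (intro integrable_integral Lap_integrable[OF Fpb]) auto
    from has_integral_scale_pos[OF this m]
    have "((\<lambda>t. exp (- of_real t) * F (t * m)) has_integral Lap F (of_real (1/m)) / of_real m) {0<..}"
      using m by (simp add: mult.commute)
    then show ?thesis using parts[of "1/m"] m unfolding m_def[symmetric] by (simp add: integral_unique)
  qed
  have "(\<lambda>n. integral {0<..} (\<lambda>t. exp (- of_real t) * F (t * real (Suc n)))) \<longlonglongrightarrow> integral {0<..} (\<lambda>t. exp (- of_real t) * l)"
  proof (rule dominated_convergence(2))
    show int: "(\<lambda>t. t powr 0 * exp (- (1 * t)) * M) integrable_on {0<..}"
      by (intro integrable_on_mult_left integrable_powr_exp) auto
    show le: "norm (exp (- of_real t) * F (t * real (Suc n))) \<le> t powr 0 * exp (- (1 * t)) * M" if "t \<in> {0<..}" for n t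
      using FM[of "t * real (Suc n)"] that by (simp add: norm_mult)
    show "(\<lambda>t. exp (- of_real t) * F (t * real (Suc n))) integrable_on {0<..}" for n
    proof (rule integrable_on_continuous_dominated[OF _ _ int le])
      show "continuous_on {0<..} (\<lambda>t. exp (- of_real t) * F (t * real (Suc n)))"
        by (intro continuous_intros continuous_on_compose2[OF Fc]) auto
    qed auto
    show "(\<lambda>n. exp (- of_real t) * F (t * real (Suc n))) \<longlonglongrightarrow> exp (- of_real t) * l" if "t \<in> {0<..}" for t
    proof -
      have "filterlim (\<lambda>n. t * real (Suc n)) at_top sequentially"
        using that by (intro filterlim_tendsto_pos_mult_at_top[OF tendsto_const] filterlim_compose[OF filterlim_real_sequentially filterlim_Suc]) auto
      from filterlim_compose[OF lim this] show ?thesis unfolding F_def by (intro tendsto_intros)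
    qed
  qed
  moreover have "integral {0<..} (\<lambda>t. exp (- of_real t) * l) = l"
    using integral_unique[OF has_integral_mult_left[OF integral_exp_minus, of l]] by (simp only: mult_1_left)
  ultimately show ?thesis unfolding scaled by (simp only:)
qed

section \<open>An integral representation of the modified Bessel function\<close>

text \<open>After the substitution of \<open>1/t\<close> for \<open>t\<close>, \<open>KInt s c\<close> is the integral of
  \<open>t powr (s - 1) * exp (- t - c / t)\<close>; in this form it is a Laplace transform in \<open>c\<close>.\<close>

definition KInt_kernel :: "complex \<Rightarrow> real \<Rightarrow> complex" where
  "KInt_kernel s t = of_real t powr (- s - 1) * exp (- 1 / of_real t)"

definition KInt :: "complex \<Rightarrow> complex \<Rightarrow> complex" where
  "KInt s = Lap (KInt_kernel s)"

lemma continuous_KInt_kernel: "continuous_on {0<..} (KInt_kernel s)"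
  unfolding KInt_kernel_def by (intro continuous_intros) (auto simp: complex_nonpos_Reals_iff)

lemma norm_KInt_kernel: "t > 0 \<Longrightarrow> norm (KInt_kernel s t) = t powr (- Re s - 1) * exp (- (1 / t))"
  by (simp add: KInt_kernel_def norm_mult norm_powr_real_powr Re_divide_of_real)

lemma exp_minus_inverse_le:
  assumes "t > (0::real)"
  shows "exp (- (1 / t)) \<le> fact n * t ^ n"
proof -
  have "(1 / t) ^ n / fact n \<le> exp (1 / t)"
    using sum_power_fact_le_exp[of "1 / t" "Suc n"] assms
    by (intro order_trans[OF member_le_sum[of n "{..<Suc n}" "\<lambda>k. (1 / t) ^ k / fact k"]]) auto
  then show ?thesis using assms by (simp add: exp_minus field_simps)
qed

lemma pow_bounded_KInt_kernel: "pow_bounded (KInt_kernel s)"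
proof -
  \<comment> \<open>The factor \<open>exp (- 1 / t)\<close> beats any power at 0; this
    \<open>n\<close> makes the resulting exponent \<open>n - Re s - 1\<close> nonnegative.\<close>
  obtain n :: nat where n: "Re s + 1 \<le> real n" using real_arch_simple by blast
  show ?thesis
  proof (rule pow_boundedI[OF continuous_KInt_kernel])
    show "real n - Re s - 1 > -1" "real n - Re s - 1 > -1" using n by auto
    fix t :: real assume t: "t > 0"
    have "norm (KInt_kernel s t) \<le> t powr (- Re s - 1) * (fact n * t ^ n)"
      unfolding norm_KInt_kernel[OF t] using t by (intro mult_left_mono exp_minus_inverse_le) auto
    also have "\<dots> = fact n * t powr (real n - Re s - 1)"
      using t by (simp flip: powr_realpow add: mult_ac powr_add[symmetric] algebra_simps)
    also have "\<dots> = (fact n / 2) * (t powr (real n - Re s - 1) + t powr (real n - Re s - 1))" by simp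
    finally show "norm (KInt_kernel s t) \<le> (fact n / 2) * (t powr (real n - Re s - 1) + t powr (real n - Re s - 1))" .
  qed
qed

lemma KInt_kernel_shift: "t > 0 \<Longrightarrow> of_real t * KInt_kernel s t = KInt_kernel (s - 1) t"
  using powr_add[of "of_real t" "-s-1" 1] by (simp add: KInt_kernel_def)

lemma DERIV_KInt:
  assumes "Re c > 0"
  shows "(KInt s has_field_derivative - KInt (s - 1) c) (at c)"
proof -
  have "Lap (\<lambda>t. of_real t * KInt_kernel s t) c = KInt (s - 1) c"
    unfolding KInt_def Lap_def by (rule integral_cong) (simp add: KInt_kernel_shift)
  then show ?thesis
    using DERIV_Lap[OF pow_bounded_KInt_kernel assms, of s] by (simp add: KInt_def)
qed

text \<open>Integrate the derivative of \<open>t powr (- s) * exp (- 1 / t - c t)\<close>, which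
  vanishes at both ends. As differentiation in \<open>c\<close> lowers the order by 1, this says
  that \<open>KInt s\<close> solves the same second-order equation as
  \<open>Phi (- s)\<close>.\<close>

lemma KInt_recurrence:
  assumes c: "Re c > 0"
  shows "s * KInt s c = KInt (s + 1) c - c * KInt (s - 1) c"
proof -
  let ?E = "\<lambda>t. exp (- (c * of_real t)) :: complex"
  let ?f = "\<lambda>s t. ?E t * KInt_kernel s t"
  define F where "F t = of_real t powr (- s) * exp (- 1 / of_real t) * ?E t" for t :: real
  define r where "r = Re c"
  define q where "q = Re s"
  have r: "r > 0" using c by (simp add: r_def)
  have nF: "norm (F t) = t powr (- q) * exp (- (1 / t)) * exp (- (r * t))" if "t > 0" for t
    using that by (simp add: F_def norm_mult norm_powr_real_powr Re_divide_of_real r_def q_def)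
  have dom: "\<exists>g. g integrable_on {0<..} \<and> (\<forall>t>0. norm (?f s t) \<le> g t)" for s
    using pow_bounded_dominant[OF pow_bounded_KInt_kernel c, of s] unfolding norm_Lap_integrand by metis
  obtain g0 g1 g2 where g: "g0 integrable_on {0<..}" "\<And>t. t > 0 \<Longrightarrow> norm (?f s t) \<le> g0 t"
    "g1 integrable_on {0<..}" "\<And>t. t > 0 \<Longrightarrow> norm (?f (s+1) t) \<le> g1 t"
    "g2 integrable_on {0<..}" "\<And>t. t > 0 \<Longrightarrow> norm (?f (s-1) t) \<le> g2 t"
    using dom[of s] dom[of "s+1"] dom[of "s-1"] by blast
  have int: "?f s integrable_on {0<..}" for s
    by (rule Lap_integrable[OF pow_bounded_KInt_kernel c])
  have "integral {0<..} (\<lambda>t. - s * ?f s t + ?f (s + 1) t - c * ?f (s - 1) t) = 0 - 0"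
  proof (rule integral_FTC_pos[where F = F])
    show "continuous_on {0<..} (\<lambda>t. - s * ?f s t + ?f (s + 1) t - c * ?f (s - 1) t)"
      by (intro continuous_intros continuous_KInt_kernel)
    show "(\<lambda>t. norm s * g0 t + g1 t + norm c * g2 t) integrable_on {0<..}"
      by (intro integrable_add integrable_on_mult_right g)
    fix t :: real assume t: "t > 0"
    have "norm (- s * ?f s t + ?f (s + 1) t - c * ?f (s - 1) t)
       \<le> norm s * norm (?f s t) + norm (?f (s + 1) t) + norm c * norm (?f (s - 1) t)"
      by (rule order_trans[OF norm_triangle_ineq4] order_trans[OF norm_triangle_ineq] add_mono | simp add: norm_mult)+
    also have "\<dots> \<le> norm s * g0 t + g1 t + norm c * g2 t"
      by (intro add_mono mult_left_mono g t) auto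
    finally show "norm (- s * ?f s t + ?f (s + 1) t - c * ?f (s - 1) t) \<le> norm s * g0 t + g1 t + norm c * g2 t" .
    have nt: "complex_of_real t \<notin> \<real>\<^sub>\<le>\<^sub>0" "complex_of_real t \<noteq> 0" using t of_real_pos_notin_nonpos by auto
    have p: "of_real t powr (- (s + 1) - 1) * of_real t * of_real t = of_real t powr (- s)"
      "of_real t powr (- s - 1) * of_real t = of_real t powr (- s)"
      using nt powr_add[of "of_real t" "- (s + 1) - 1" 2] powr_add[of "of_real t" "- s - 1" 1]
      by (simp_all add: powr_nat' power2_eq_square mult.assoc)
    have "((\<lambda>z. z powr (- s) * exp (- 1 / z) * exp (- (c * z))) has_field_derivative
       (- s * z powr (- s - 1) * exp (- 1 / z) + z powr (- s) * (exp (- 1 / z) * (1 / (z * z)))) * exp (- (c * z))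
        + z powr (- s) * exp (- 1 / z) * (exp (- (c * z)) * (- c))) (at z)" if "z \<notin> \<real>\<^sub>\<le>\<^sub>0" "z \<noteq> 0" for z
      using that by (auto intro!: derivative_eq_intros)
    from has_vector_derivative_real_field[OF this[OF nt]]
    have "(F has_vector_derivative
       (- s * of_real t powr (- s - 1) * exp (- 1 / of_real t) + of_real t powr (- s) * (exp (- 1 / of_real t) * (1 / (of_real t * of_real t)))) * ?E t
        + of_real t powr (- s) * exp (- 1 / of_real t) * (?E t * (- c))) (at t)"
      unfolding F_def[abs_def] .
    also have "of_real t powr (- s) * (exp (- 1 / of_real t) * (1 / (of_real t * of_real t)))
        = of_real t powr (- (s + 1) - 1) * exp (- 1 / of_real t)"
      using nt unfolding p(1)[symmetric] by (simp add: field_simps)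
    finally show "(F has_vector_derivative - s * ?f s t + ?f (s + 1) t - c * ?f (s - 1) t) (at t)"
      by (simp add: KInt_kernel_def algebra_simps)
  next
    show "(\<lambda>n. F (1 / real (Suc n))) \<longlonglongrightarrow> 0"
    proof (rule tendsto_norm_zero_cancel)
      have "(\<lambda>n. (1 / real (Suc n)) powr (- q) * exp (- (1 / (1 / real (Suc n)))) * exp (- (r * (1 / real (Suc n))))) \<longlonglongrightarrow> 0"
        using r by real_asymp
      then show "(\<lambda>n. norm (F (1 / real (Suc n)))) \<longlonglongrightarrow> 0" by (subst nF) auto
    qed
    show "(\<lambda>n. F (real (Suc n))) \<longlonglongrightarrow> 0"
    proof (rule tendsto_norm_zero_cancel)
      have "(\<lambda>n. real (Suc n) powr (- q) * exp (- (1 / real (Suc n))) * exp (- (r * real (Suc n)))) \<longlonglongrightarrow> 0"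
        using r by real_asymp
      then show "(\<lambda>n. norm (F (real (Suc n)))) \<longlonglongrightarrow> 0" by (subst nF) auto
    qed
  qed
  moreover have "integral {0<..} (\<lambda>t. - s * ?f s t + ?f (s + 1) t - c * ?f (s - 1) t)
      = - s * KInt s c + KInt (s + 1) c - c * KInt (s - 1) c"
    unfolding KInt_def Lap_def
    by (subst integral_diff integral_add integral_mult_right; (intro integrable_add integrable_on_mult_right int)?)+ simp
  ultimately show ?thesis by (simp add: algebra_simps)
qed

section \<open>Behaviour of the integral representation as its argument tends to 0\<close>

lemma integrable_two_powers:
  assumes "\<sigma> > -1" "\<tau> < (-1::real)"
  shows "(\<lambda>c. if c \<le> 1 then c powr \<sigma> else c powr \<tau>) integrable_on {0<..}"
proof -
  have "(\<lambda>c. if c \<le> 1 then c powr \<sigma> else c powr \<tau>) integrable_on {0<..1}"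
    by (rule integrable_eq[OF integrable_on_powr_from_0'[of \<sigma> 1]]) (use assms in auto)
  moreover have "(\<lambda>c. c powr \<tau>) integrable_on {1..}"
    using has_integral_powr_to_inf[of \<tau> 1] assms by auto
  then have "(\<lambda>c. if c \<le> 1 then c powr \<sigma> else c powr \<tau>) integrable_on {1..}"
    by (rule integrable_spike[of _ _ "{1}"]) auto
  ultimately have "(\<lambda>c. if c \<le> 1 then c powr \<sigma> else c powr \<tau>) integrable_on ({0<..1} \<union> {1..})"
    by (rule integrable_Un') (auto intro: negligible_subset[of "{1}"])
  also have "{0<..1} \<union> {1..} = {0::real<..}" by auto
  finally show ?thesis .
qed

lemma KInt_kernel_dominant:
  assumes "Re s > 0"
  obtains g where "g integrable_on {0<..}" "\<And>t. t > 0 \<Longrightarrow> norm (KInt_kernel s t) \<le> g t"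
proof -
  obtain n :: nat where n: "Re s + 1 \<le> real n" using real_arch_simple by blast
  show ?thesis
  proof (rule that)
    show "(\<lambda>t. fact n * (if t \<le> 1 then t powr (real n - Re s - 1) else t powr (- Re s - 1))) integrable_on {0<..}"
      using assms n by (intro integrable_on_mult_right integrable_two_powers) auto
    fix t :: real assume t: "t > 0"
    show "norm (KInt_kernel s t) \<le> fact n * (if t \<le> 1 then t powr (real n - Re s - 1) else t powr (- Re s - 1))"
    proof (cases "t \<le> 1")
      case True
      have "norm (KInt_kernel s t) \<le> t powr (- Re s - 1) * (fact n * t ^ n)"
        unfolding norm_KInt_kernel[OF t] using t by (intro mult_left_mono exp_minus_inverse_le) auto
      also have "\<dots> = fact n * t powr (real n - Re s - 1)"
        using t by (simp flip: powr_realpow add: mult_ac powr_add[symmetric] algebra_simps)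
      finally show ?thesis using True by simp
    next
      case False
      have "norm (KInt_kernel s t) \<le> t powr (- Re s - 1) * 1"
        unfolding norm_KInt_kernel[OF t] using t by (intro mult_left_mono) auto
      also have "\<dots> \<le> fact n * t powr (- Re s - 1)"
        using fact_ge_1[of n, where 'a = real] mult_right_mono[of 1 "fact n" "t powr (- Re s - 1)"] by simp
      finally show ?thesis using False by simp
    qed
  qed
qed

lemma Gamma_dominant:
  assumes "Re s > 0"
  obtains g where "g integrable_on {0<..}" "\<And>t. t > 0 \<Longrightarrow> norm (of_real t powr (s - 1) * exp (- of_real t)) \<le> g t"
proof (rule that)
  show "(\<lambda>t. t powr (Re s - 1) * exp (- (1 * t))) integrable_on {0<..}"
    by (rule integrable_powr_exp) (use assms in auto)
qed (auto simp: norm_mult norm_powr_real_powr)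

lemma Gamma_integral_exp:
  assumes "Re s > 0"
  shows "integral {0<..} (\<lambda>t. of_real t powr (s - 1) * exp (- of_real t)) = Gamma s"
proof -
  have "((\<lambda>t. of_real t powr (s - 1) * exp (- of_real t)) has_integral Gamma s) {0<..}"
    by (rule has_integral_eq[OF _ Gamma_integral_complex'[OF assms]])
       (auto simp: exp_minus divide_inverse exp_of_real[symmetric])
  then show ?thesis by (rule integral_unique)
qed

text \<open>The substitution of \<open>1 / t\<close> for \<open>t\<close> turns the kernel into
  Euler's integrand. It is made on \<open>[1 / N, N]\<close>, which it maps onto itself, before the
  limit is taken.\<close>

lemma integral_KInt_kernel:
  assumes s: "Re s > 0"
  shows "integral {0<..} (KInt_kernel s) = Gamma s"
proof -
  let ?f = "\<lambda>t. of_real t powr (s - 1) * exp (- of_real t) :: complex"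
  have fc: "continuous_on {0<..} ?f"
    by (intro continuous_intros) (auto simp: complex_nonpos_Reals_iff)
  have eq: "integral {1 / real (Suc n)..real (Suc n)} (KInt_kernel s) = integral {1 / real (Suc n)..real (Suc n)} ?f" for n
  proof -
    define N where "N = real (Suc n)"
    have N: "N \<ge> 1" by (simp add: N_def)
    have pos: "x > 0" if "x \<in> {1 / N..N}" for x using that N by (auto intro: less_le_trans[rotated])
    have le: "1 / N \<le> N" using N mult_mono[of 1 N 1 N] by (simp add: field_simps)
    have "((\<lambda>x. (- 1 / x\<^sup>2) *\<^sub>R ?f (1 / x)) has_integral
        (integral {1 / (1 / N)..1 / N} ?f - integral {1 / N..1 / (1 / N)} ?f)) {1 / N..N}"
    proof (rule has_integral_substitution_general[of "{}" _ _ _ "1 / N" N])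
      show "(\<lambda>x. 1 / x) ` {1 / N..N} \<subseteq> {1 / N..N}"
      proof safe
        fix x assume x: "x \<in> {1 / N..N}"
        with pos[OF x] N show "1 / x \<in> {1 / N..N}" by (auto simp: field_simps)
      qed
      show "continuous_on {1 / N..N} ?f" using pos by (intro continuous_on_subset[OF fc]) auto
      show "continuous_on {1 / N..N} (\<lambda>x. 1 / x)" using pos by (intro continuous_intros) force
      show "((\<lambda>x. 1 / x) has_real_derivative - 1 / x\<^sup>2) (at x within {1 / N..N})" if "x \<in> {1 / N..N} - {}" for x
        using pos[of x] that by (auto intro!: derivative_eq_intros simp: power2_eq_square)
    qed (use le in auto)
    \<comment> \<open>The substitution rule returns a difference of integrals over both
      orientations; the interval from \<open>N\<close> down to \<open>1 / N\<close> is empty, or a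
      point for \<open>N = 1\<close>.\<close>
    moreover have "integral {1 / (1 / N)..1 / N} ?f = 0"
    proof (cases "N = 1")
      case False
      then have "1 / N < N" using N less_1_mult[of N N] by (auto simp: field_simps)
      then show ?thesis by simp
    qed auto
    ultimately have "((\<lambda>x. (- 1 / x\<^sup>2) *\<^sub>R ?f (1 / x)) has_integral - integral {1 / N..N} ?f) {1 / N..N}" by simp
    then have "((\<lambda>x. - ((- 1 / x\<^sup>2) *\<^sub>R ?f (1 / x))) has_integral - (- integral {1 / N..N} ?f)) {1 / N..N}"
      by (rule has_integral_neg)
    then have "(KInt_kernel s has_integral - (- integral {1 / N..N} ?f)) {1 / N..N}"
    proof (rule has_integral_eq[rotated])
      fix x assume x: "x \<in> {1 / N..N}"
      have x0: "x > 0" using pos[OF x] .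
      have "complex_of_real (1 / x) powr (s - 1) = of_real x powr (- s - 1) * (of_real x)\<^sup>2"
      proof -
        have "complex_of_real (1 / x) = inverse (of_real x)" using x0 by (simp add: field_simps)
        then have "complex_of_real (1 / x) powr (s - 1) = of_real x powr (1 - s)"
          using x0 of_real_pos_notin_nonpos[OF x0] by (simp add: powr_def Ln_inverse algebra_simps)
        also have "\<dots> = of_real x powr (- s - 1 + 2)" by (simp add: algebra_simps)
        also have "\<dots> = of_real x powr (- s - 1) * of_real x powr 2" using powr_add by blast
        finally show ?thesis using x0 by (simp add: powr_nat')
      qed
      then show "- ((- 1 / x\<^sup>2) *\<^sub>R ?f (1 / x)) = KInt_kernel s x"
        using x0 by (simp add: KInt_kernel_def scaleR_conv_of_real)
    qed
    from integral_unique[OF this] show ?thesis unfolding N_def by simp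
  qed
  obtain g where g: "g integrable_on {0<..}" "\<And>t. t > 0 \<Longrightarrow> norm (KInt_kernel s t) \<le> g t"
    using KInt_kernel_dominant[OF s] by blast
  obtain g' where g': "g' integrable_on {0<..}" "\<And>t. t > 0 \<Longrightarrow> norm (?f t) \<le> g' t"
    using Gamma_dominant[OF s] by blast
  have "(\<lambda>n. integral {1 / real (Suc n)..real (Suc n)} (KInt_kernel s)) \<longlonglongrightarrow> integral {0<..} (KInt_kernel s)"
    by (rule integral_exhaust_pos[OF continuous_KInt_kernel g])
  moreover have "(\<lambda>n. integral {1 / real (Suc n)..real (Suc n)} ?f) \<longlonglongrightarrow> integral {0<..} ?f"
    by (rule integral_exhaust_pos[OF fc g'])
  ultimately show ?thesis unfolding eq Gamma_integral_exp[OF s] by (rule LIMSEQ_unique)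
qed

lemma KInt_at_0:
  assumes s: "Re s > 0"
  shows "(\<lambda>n. KInt s (of_real (1 / real (Suc n)))) \<longlonglongrightarrow> Gamma s"
proof -
  obtain g where g: "g integrable_on {0<..}" "\<And>t. t > 0 \<Longrightarrow> norm (KInt_kernel s t) \<le> g t"
    using KInt_kernel_dominant[OF s] by blast
  show ?thesis unfolding integral_KInt_kernel[OF s, symmetric] KInt_def Lap_def
  proof (rule dominated_convergence(2)[OF _ g(1)])
    show "(\<lambda>c. exp (- (of_real (1 / real (Suc n)) * of_real c)) * KInt_kernel s c) integrable_on {0<..}" for n
      by (rule Lap_integrable[OF pow_bounded_KInt_kernel]) auto
    show "norm (exp (- (of_real (1 / real (Suc n)) * of_real c)) * KInt_kernel s c) \<le> g c" if "c \<in> {0<..}" for n c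
    proof -
      have "norm (exp (- (of_real (1 / real (Suc n)) * of_real c)) * KInt_kernel s c)
         = norm (KInt_kernel s c) * exp (- (1 / real (Suc n) * c))"
        unfolding norm_Lap_integrand by simp
      also have "\<dots> \<le> norm (KInt_kernel s c) * 1" using that by (intro mult_left_mono) auto
      finally show ?thesis using g(2)[of c] that by simp
    qed
    show "(\<lambda>n. exp (- (of_real (1 / real (Suc n)) * of_real c)) * KInt_kernel s c) \<longlonglongrightarrow> KInt_kernel s c" for c
    proof -
      have "(\<lambda>n. exp (- (of_real (1 / real (Suc n)) * of_real c)) * KInt_kernel s c) \<longlonglongrightarrow> exp (- (of_real 0 * of_real c)) * KInt_kernel s c"
        by (intro tendsto_intros LIMSEQ_Suc[OF lim_1_over_n])
      then show ?thesis by simp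
    qed
  qed
qed

text \<open>Rescaling \<open>t\<close> by \<open>c\<close> exchanges the two exponentials and
  reflects the order: the left-hand side becomes the integral of
  \<open>t powr (- s - 1) * exp (- t - c / t)\<close>, which tends to Euler's integral.\<close>

lemma KInt_reflect_at_0:
  assumes s: "Re s < 0"
  shows "(\<lambda>n. of_real (1 / real (Suc n)) powr (- s) * KInt s (of_real (1 / real (Suc n)))) \<longlonglongrightarrow> Gamma (- s)"
proof -
  have s': "Re (- s) > 0" using s by simp
  let ?f = "\<lambda>t. of_real t powr (- s - 1) * exp (- of_real t) :: complex"
  have fc: "continuous_on {0<..} ?f"
    by (intro continuous_intros) (auto simp: complex_nonpos_Reals_iff)
  obtain g' where g': "g' integrable_on {0<..}" "\<And>t. t > 0 \<Longrightarrow> norm (?f t) \<le> g' t"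
    using Gamma_dominant[OF s'] by blast
  have le: "norm (?f t * exp (- of_real (c / t))) \<le> g' t" if "t > 0" "c > 0" for t c :: real
  proof -
    have "norm (?f t * exp (- of_real (c / t))) = norm (?f t) * exp (- (c / t))" by (simp add: norm_mult)
    also have "\<dots> \<le> norm (?f t) * 1" using that by (intro mult_left_mono) auto
    finally show ?thesis using g'(2)[OF that(1)] by simp
  qed
  have int: "(\<lambda>t. ?f t * exp (- of_real (c / t))) integrable_on {0<..}" if c: "c > 0" for c
  proof (rule integrable_on_continuous_dominated[OF _ _ g'(1)])
    show "continuous_on {0<..} (\<lambda>t. ?f t * exp (- of_real (c / t)))"
      by (intro continuous_on_mult fc continuous_intros) auto
  qed (use le c in auto)
  have scaled: "of_real c powr (- s) * KInt s (of_real c) = integral {0<..} (\<lambda>t. ?f t * exp (- of_real (c / t)))"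
    if c: "c > 0" for c
  proof -
    have "((\<lambda>t. ?f (c * t) * exp (- of_real (c / (c * t)))) has_integral
        integral {0<..} (\<lambda>t. ?f t * exp (- of_real (c / t))) / of_real c) {0<..}"
      by (rule has_integral_scale_pos[OF integrable_integral[OF int[OF c]] c])
    then have "((\<lambda>t. of_real c powr (- s - 1) * (exp (- (of_real c * of_real t)) * KInt_kernel s t)) has_integral
        integral {0<..} (\<lambda>t. ?f t * exp (- of_real (c / t))) / of_real c) {0<..}"
    proof (rule has_integral_eq[rotated])
      fix t :: real assume "t \<in> {0<..}"
      then have t: "t > 0" by simp
      have "complex_of_real (c * t) powr (- s - 1) = of_real c powr (- s - 1) * of_real t powr (- s - 1)"
        using c t powr_times_real[of "of_real c" "of_real t" "- s - 1"] by simp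
      then show "?f (c * t) * exp (- of_real (c / (c * t))) = of_real c powr (- s - 1) * (exp (- (of_real c * of_real t)) * KInt_kernel s t)"
        using c t by (simp add: KInt_kernel_def)
    qed
    from integral_unique[OF this] have "of_real c powr (- s - 1) * KInt s (of_real c) = integral {0<..} (\<lambda>t. ?f t * exp (- of_real (c / t))) / of_real c"
      unfolding KInt_def Lap_def using Lap_integrable[OF pow_bounded_KInt_kernel[of s], of "of_real c"] c
      by (subst (asm) integral_mult_right) auto
    moreover have "of_real c powr (- s) = of_real c powr (- s - 1) * of_real c"
      using c by (simp add: powr_diff)
    ultimately show ?thesis using c by (simp add: field_simps)
  qed
  have "(\<lambda>n. integral {0<..} (\<lambda>t. ?f t * exp (- of_real (1 / real (Suc n) / t)))) \<longlonglongrightarrow> integral {0<..} ?f"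
  proof (rule dominated_convergence(2)[OF int g'(1)])
    show "(\<lambda>n. ?f t * exp (- of_real (1 / real (Suc n) / t))) \<longlonglongrightarrow> ?f t" if "t \<in> {0<..}" for t
    proof -
      have "(\<lambda>n. ?f t * exp (- of_real (1 / real (Suc n) / t))) \<longlonglongrightarrow> ?f t * exp (- of_real (0 / t))"
        using that by (intro tendsto_intros LIMSEQ_Suc[OF lim_1_over_n]) auto
      then show ?thesis by simp
    qed
    show "norm (?f t * exp (- of_real (1 / real (Suc n) / t))) \<le> g' t" if "t \<in> {0<..}" for n t
      using le[of t "1 / real (Suc n)"] that by simp
  qed auto
  also have "(\<lambda>n. integral {0<..} (\<lambda>t. ?f t * exp (- of_real (1 / real (Suc n) / t))))
      = (\<lambda>n. of_real (1 / real (Suc n)) powr (- s) * KInt s (of_real (1 / real (Suc n))))"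
    by (intro ext scaled[symmetric]) simp
  finally show ?thesis unfolding Gamma_integral_exp[OF s'] .
qed

text \<open>Up to the factor \<open>c powr (1 - m)\<close> this is the Wronskian of the two
  solutions \<open>Phi (- m) c\<close> and \<open>c powr m * Phi m c\<close> of one equation. In
  this normalization it is entire with derivative 0, and its value at 0 is Euler's reflection
  formula.\<close>

lemma Phi_Wronskian:
  "m * Phi (- m) c * Phi m c + c * Phi (- m) c * Phi (m + 1) c - c * Phi (1 - m) c * Phi m c = sin (of_real pi * m) / of_real pi"
proof -
  define D where "D c = m * Phi (- m) c * Phi m c + c * Phi (- m) c * Phi (m + 1) c - c * Phi (1 - m) c * Phi m c" for c
  have "(D has_field_derivative 0) (at c)" for c
  proof -
    have d: "(Phi (- m) has_field_derivative Phi (1 - m) c) (at c)"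
      "(Phi m has_field_derivative Phi (m + 1) c) (at c)"
      "(Phi (m + 1) has_field_derivative Phi (m + 2) c) (at c)"
      "(Phi (1 - m) has_field_derivative Phi (2 - m) c) (at c)"
      using DERIV_Phi[of "- m"] DERIV_Phi[of m] DERIV_Phi[of "m + 1"] DERIV_Phi[of "1 - m"] by (simp_all add: algebra_simps)
    have e: "c * Phi (m + 2) c = Phi m c - (m + 1) * Phi (m + 1) c"
      "c * Phi (2 - m) c = Phi (- m) c - (1 - m) * Phi (1 - m) c"
      using Phi_contiguous[of m c] Phi_contiguous[of "- m" c] by (simp_all add: algebra_simps)
    have "(D has_field_derivative
        m * (Phi (1 - m) c * Phi m c + Phi (- m) c * Phi (m + 1) c)
        + (Phi (- m) c * Phi (m + 1) c + c * Phi (1 - m) c * Phi (m + 1) c + Phi (- m) c * (c * Phi (m + 2) c))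
        - (Phi (1 - m) c * Phi m c + (c * Phi (2 - m) c) * Phi m c + c * Phi (1 - m) c * Phi (m + 1) c)) (at c)"
      unfolding D_def[abs_def] by (rule derivative_eq_intros d refl | simp)+ (simp add: algebra_simps)
    then show ?thesis unfolding e by (rule DERIV_cong) (simp add: algebra_simps)
  qed
  then obtain k where k: "\<And>c. D c = k"
    using has_field_derivative_zero_constant[of UNIV D] by (auto simp: convex_UNIV has_field_derivative_at_within)
  have "D c = D 0" unfolding k ..
  also have "D 0 = m * (rGamma (1 - m) * rGamma (m + 1))" by (simp add: D_def)
  also have "\<dots> = (m * rGamma (m + 1)) * rGamma (1 - m)" by simp
  also have "\<dots> = sin (of_real pi * m) / of_real pi" unfolding rGamma_plus1 by (rule rGamma_reflection_complex)
  finally show ?thesis by (simp add: D_def)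
qed

lemma const_on_pos_reals:
  fixes W :: "complex \<Rightarrow> complex"
  assumes "\<And>c. Re c > 0 \<Longrightarrow> (W has_field_derivative 0) (at c)"
    and "(\<lambda>n. W (of_real (1 / real (Suc n)))) \<longlonglongrightarrow> l" and "Re c > 0"
  shows "W c = l"
proof -
  obtain k where k: "\<And>c. Re c > 0 \<Longrightarrow> W c = k"
    using has_field_derivative_zero_constant[of "{c. Re c > 0}" W] assms(1) convex_halfspace_Re_gt[of 0]
    by (auto simp: has_field_derivative_at_within)
  have "W (of_real (1 / real (Suc n))) = k" for n by (rule k) (simp del: of_nat_Suc)
  then have "l = k" using assms(2) LIMSEQ_unique[OF _ tendsto_const, of _ l] by (simp add: LIMSEQ_const_iff)
  then show ?thesis using k[OF assms(3)] by simp
qed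

lemma Phi_seq: "(\<lambda>n. Phi a (of_real (1 / real (Suc n)))) \<longlonglongrightarrow> rGamma (a + 1)"
proof -
  have "isCont (Phi a) 0" by (rule DERIV_isCont[OF DERIV_Phi])
  moreover have "(\<lambda>n. complex_of_real (1 / real (Suc n))) \<longlonglongrightarrow> 0"
    using tendsto_of_real[OF LIMSEQ_Suc[OF lim_1_over_n], where 'a = complex] by simp
  ultimately show ?thesis using isCont_tendsto_compose by fastforce
qed

context
  fixes m :: complex
  assumes m0: "m \<noteq> 0" and m1: "\<bar>Re m\<bar> < 1"
begin

text \<open>For \<open>Re m = 0\<close> neither limit above covers the order \<open>m\<close>
  itself. The recurrence expresses it through the orders \<open>m + 1\<close> and
  \<open>m - 1\<close>, whose real parts have the required signs; dividing by \<open>m\<close> is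
  where order 0 is excluded.\<close>

lemma KInt_vanish:
  shows "(\<lambda>n. of_real (1 / real (Suc n)) powr (1 - m) * KInt m (of_real (1 / real (Suc n)))) \<longlonglongrightarrow> 0" (is ?th1)
    and "(\<lambda>n. of_real (1 / real (Suc n)) * KInt m (of_real (1 / real (Suc n)))) \<longlonglongrightarrow> 0" (is ?th2)
proof -
  define c :: "nat \<Rightarrow> complex" where "c n = of_real (1 / real (Suc n))" for n
  have c: "Re (c n) > 0" "c n \<noteq> 0" for n
  proof -
    show "Re (c n) > 0" by (simp add: c_def del: of_nat_Suc)
    then show "c n \<noteq> 0" by auto
  qed
  have c0: "c \<longlonglongrightarrow> 0" unfolding c_def using tendsto_of_real[OF LIMSEQ_Suc[OF lim_1_over_n], where 'a = complex] by simp
  have cp: "(\<lambda>n. c n powr a) \<longlonglongrightarrow> 0" if "Re a > 0" for a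
  proof (rule tendsto_norm_zero_cancel)
    have "(\<lambda>n. (1 / real (Suc n)) powr Re a) \<longlonglongrightarrow> 0" using that by real_asymp
    then show "(\<lambda>n. norm (c n powr a)) \<longlonglongrightarrow> 0"
      unfolding c_def by (subst norm_powr_real_powr) auto
  qed
  have K1: "(\<lambda>n. KInt (m + 1) (c n)) \<longlonglongrightarrow> Gamma (m + 1)"
    unfolding c_def by (rule KInt_at_0) (use m1 in auto)
  have K2: "(\<lambda>n. c n powr (1 - m) * KInt (m - 1) (c n)) \<longlonglongrightarrow> Gamma (1 - m)"
    unfolding c_def using KInt_reflect_at_0[of "m - 1"] m1 by simp
  have eq: "KInt m (c n) = (KInt (m + 1) (c n) - c n * KInt (m - 1) (c n)) / m" for n
    using KInt_recurrence[OF c(1), of m n] m0 by (simp add: field_simps)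
  have "(\<lambda>n. (c n powr (1 - m) * KInt (m + 1) (c n) - c n * (c n powr (1 - m) * KInt (m - 1) (c n))) / m)
      \<longlonglongrightarrow> (0 * Gamma (m + 1) - 0 * Gamma (1 - m)) / m"
    using m0 m1 by (intro tendsto_intros cp K1 K2 c0) auto
  then show ?th1 unfolding c_def[symmetric] eq by (simp add: algebra_simps)
  have "(\<lambda>n. (c n * KInt (m + 1) (c n) - c n powr (1 + m) * (c n powr (1 - m) * KInt (m - 1) (c n))) / m)
      \<longlonglongrightarrow> (0 * Gamma (m + 1) - 0 * Gamma (1 - m)) / m"
    using m0 m1 by (intro tendsto_intros cp K1 K2 c0) auto
  moreover have "c n powr (1 + m) * c n powr (1 - m) = c n * c n" for n
  proof -
    have "c n powr (1 + m) * c n powr (1 - m) = c n powr 2" by (simp flip: powr_add)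
    then show ?thesis using c(2)[of n] by (simp add: powr_nat' power2_eq_square)
  qed
  then have "c n powr (1 + m) * (c n powr (1 - m) * KInt (m - 1) (c n)) = c n * (c n * KInt (m - 1) (c n))" for n
    by (metis mult.assoc)
  ultimately have "(\<lambda>n. (c n * KInt (m + 1) (c n) - c n * (c n * KInt (m - 1) (c n))) / m) \<longlonglongrightarrow> 0"
    by (simp only: mult_zero_left diff_self div_0)
  then show ?th2 unfolding c_def[symmetric] eq by (simp add: algebra_simps)
qed

text \<open>The normalized Wronskian of \<open>KInt m\<close> with \<open>Phi (- m)\<close>,
  constant because both solve the same equation; the constant is read off at 0.\<close>

lemma KInt_Wronskian1:
  assumes c: "Re c > 0"
  shows "c powr (1 - m) * (KInt m c * Phi (1 - m) c + KInt (m - 1) c * Phi (- m) c) = 1"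
proof (rule const_on_pos_reals[OF _ _ c])
  fix c :: complex assume c: "Re c > 0"
  then have nz: "c \<noteq> 0" "c \<notin> \<real>\<^sub>\<le>\<^sub>0" by (auto simp: complex_nonpos_Reals_iff)
  have d: "(Phi (- m) has_field_derivative Phi (1 - m) c) (at c)"
    "(Phi (1 - m) has_field_derivative Phi (2 - m) c) (at c)"
    using DERIV_Phi[of "- m"] DERIV_Phi[of "1 - m"] by (simp_all add: algebra_simps)
  have dK: "(KInt m has_field_derivative - KInt (m - 1) c) (at c)"
    "(KInt (m - 1) has_field_derivative - KInt (m - 2) c) (at c)"
    using DERIV_KInt[OF c, of m] DERIV_KInt[OF c, of "m - 1"] by (simp_all add: algebra_simps)
  have e: "c * Phi (2 - m) c = Phi (- m) c - (1 - m) * Phi (1 - m) c"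
    using Phi_contiguous[of "- m" c] by (simp add: algebra_simps)
  have eK: "c * KInt (m - 2) c = KInt m c - (m - 1) * KInt (m - 1) c"
    using KInt_recurrence[OF c, of "m - 1"] by (simp add: algebra_simps)
  have p: "c powr (1 - m) = c powr (- m) * c" using nz powr_add[of c "-m" 1] by simp
  have dp: "((\<lambda>c. c powr (1 - m)) has_field_derivative (1 - m) * c powr (- m)) (at c)"
    using has_field_derivative_powr[OF nz(2), of "1 - m"] by simp
  have "((\<lambda>c. c powr (1 - m) * (KInt m c * Phi (1 - m) c + KInt (m - 1) c * Phi (- m) c)) has_field_derivative
      (1 - m) * c powr (- m) * (KInt m c * Phi (1 - m) c + KInt (m - 1) c * Phi (- m) c)
      + c powr (- m) * (KInt m c * (c * Phi (2 - m) c) - c * KInt (m - 1) c * Phi (1 - m) c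
         + KInt (m - 1) c * (c * Phi (1 - m) c) - (c * KInt (m - 2) c) * Phi (- m) c)) (at c)"
    by (rule derivative_eq_intros d dK dp refl)+ (simp add: p algebra_simps)
  then show "((\<lambda>c. c powr (1 - m) * (KInt m c * Phi (1 - m) c + KInt (m - 1) c * Phi (- m) c)) has_field_derivative 0) (at c)"
    unfolding e eK by (rule DERIV_cong) (simp add: algebra_simps)
next
  let ?c = "\<lambda>n. complex_of_real (1 / real (Suc n))"
  have K2: "(\<lambda>n. ?c n powr (1 - m) * KInt (m - 1) (?c n)) \<longlonglongrightarrow> Gamma (1 - m)"
    using KInt_reflect_at_0[of "m - 1"] m1 by simp
  have "(\<lambda>n. (?c n powr (1 - m) * KInt m (?c n)) * Phi (1 - m) (?c n) + (?c n powr (1 - m) * KInt (m - 1) (?c n)) * Phi (- m) (?c n))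
     \<longlonglongrightarrow> 0 * rGamma (1 - m + 1) + Gamma (1 - m) * rGamma (- m + 1)"
    by (intro tendsto_intros KInt_vanish(1) K2 Phi_seq)
  moreover have "Gamma (1 - m) * rGamma (- m + 1) = 1"
  proof -
    have "1 - m \<notin> \<int>\<^sub>\<le>\<^sub>0" using m1 by (auto elim!: nonpos_Ints_cases simp: complex_eq_iff)
    then show ?thesis by (simp add: Gamma_def rGamma_eq_zero_iff)
  qed
  ultimately show "(\<lambda>n. ?c n powr (1 - m) * (KInt m (?c n) * Phi (1 - m) (?c n) + KInt (m - 1) (?c n) * Phi (- m) (?c n))) \<longlonglongrightarrow> 1"
    by (simp add: algebra_simps)
qed

text \<open>The normalized Wronskian of \<open>KInt m\<close> with the second solution
  \<open>c powr m * Phi m c\<close>, after the recurrence has absorbed one term into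
  \<open>KInt (m + 1)\<close>.\<close>

lemma KInt_Wronskian2:
  assumes c: "Re c > 0"
  shows "KInt (m + 1) c * Phi m c + c * KInt m c * Phi (m + 1) c = 1"
proof (rule const_on_pos_reals[OF _ _ c])
  fix c :: complex assume c: "Re c > 0"
  have d: "(Phi m has_field_derivative Phi (m + 1) c) (at c)"
    "(Phi (m + 1) has_field_derivative Phi (m + 2) c) (at c)"
    using DERIV_Phi[of m] DERIV_Phi[of "m + 1"] by (simp_all add: algebra_simps)
  have dK: "(KInt m has_field_derivative - KInt (m - 1) c) (at c)"
    "(KInt (m + 1) has_field_derivative - KInt m c) (at c)"
    using DERIV_KInt[OF c, of m] DERIV_KInt[OF c, of "m + 1"] by (simp_all add: algebra_simps)
  have e: "c * Phi (m + 2) c = Phi m c - (m + 1) * Phi (m + 1) c"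
    using Phi_contiguous[of m c] by (simp add: algebra_simps)
  have eK: "c * KInt (m - 1) c = KInt (m + 1) c - m * KInt m c"
    using KInt_recurrence[OF c, of m] by (simp add: algebra_simps)
  have "((\<lambda>c. KInt (m + 1) c * Phi m c + c * KInt m c * Phi (m + 1) c) has_field_derivative
      - KInt m c * Phi m c + KInt (m + 1) c * Phi (m + 1) c + KInt m c * Phi (m + 1) c
      - (c * KInt (m - 1) c) * Phi (m + 1) c + KInt m c * (c * Phi (m + 2) c)) (at c)"
    by (rule derivative_eq_intros d dK refl)+ (simp add: algebra_simps)
  then show "((\<lambda>c. KInt (m + 1) c * Phi m c + c * KInt m c * Phi (m + 1) c) has_field_derivative 0) (at c)"
    unfolding e eK by (rule DERIV_cong) (simp add: algebra_simps)
next
  let ?c = "\<lambda>n. complex_of_real (1 / real (Suc n))"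
  have K1: "(\<lambda>n. KInt (m + 1) (?c n)) \<longlonglongrightarrow> Gamma (m + 1)"
    by (rule KInt_at_0) (use m1 in auto)
  have "(\<lambda>n. KInt (m + 1) (?c n) * Phi m (?c n) + (?c n * KInt m (?c n)) * Phi (m + 1) (?c n))
     \<longlonglongrightarrow> Gamma (m + 1) * rGamma (m + 1) + 0 * rGamma (m + 1 + 1)"
    by (intro tendsto_intros KInt_vanish(2) K1 Phi_seq)
  moreover have "Gamma (m + 1) * rGamma (m + 1) = 1"
  proof -
    have "m + 1 \<notin> \<int>\<^sub>\<le>\<^sub>0" using m1 by (auto elim!: nonpos_Ints_cases simp: complex_eq_iff)
    then show ?thesis by (simp add: Gamma_def rGamma_eq_zero_iff)
  qed
  ultimately show "(\<lambda>n. KInt (m + 1) (?c n) * Phi m (?c n) + ?c n * KInt m (?c n) * Phi (m + 1) (?c n)) \<longlonglongrightarrow> 1"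
    by simp
qed

text \<open>Cramer's rule: a third solution is expanded in the two \<open>Phi\<close> solutions,
  with coefficients that are quotients of Wronskians, all three now known. So the difference of
  growing series that defines \<open>K\<close> is an integral with visible decay.\<close>

lemma KInt_eq:
  assumes c: "Re c > 0"
  shows "KInt m c * (sin (of_real pi * m) / of_real pi) = Phi (- m) c - c powr m * Phi m c"
proof -
  have nz: "c \<noteq> 0" using c by auto
  have "c powr m * c powr (1 - m) = c" using nz by (simp flip: powr_add)
  then have "c powr m = c * (KInt m c * Phi (1 - m) c + KInt (m - 1) c * Phi (- m) c)"
    using KInt_Wronskian1[OF c] by (metis mult.assoc mult.right_neutral)
  moreover have "KInt (m + 1) c * Phi m c = m * KInt m c * Phi m c + c * KInt (m - 1) c * Phi m c"
  proof -
    have "KInt (m + 1) c = m * KInt m c + c * KInt (m - 1) c"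
      using KInt_recurrence[OF c, of m] by (simp add: algebra_simps)
    then show ?thesis by (simp only: distrib_right)
  qed
  then have "m * KInt m c * Phi m c + c * KInt (m - 1) c * Phi m c + c * KInt m c * Phi (m + 1) c = 1"
    using KInt_Wronskian2[OF c] by simp
  then have "Phi (- m) c = Phi (- m) c * (m * KInt m c * Phi m c + c * KInt (m - 1) c * Phi m c + c * KInt m c * Phi (m + 1) c)"
    by simp
  ultimately have "Phi (- m) c - c powr m * Phi m c
     = KInt m c * (m * Phi (- m) c * Phi m c + c * Phi (- m) c * Phi (m + 1) c - c * Phi (1 - m) c * Phi m c)"
    by (simp add: algebra_simps)
  then show ?thesis unfolding Phi_Wronskian by simp
qed

end

text \<open>The arithmetic-geometric mean inequality gives
  \<open>1 / t + c t \<ge> 2 sqrt c\<close>. Half of the exponent is spent on the factor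
  \<open>exp (- sqrt c)\<close>, the other half keeps the integral convergent uniformly in
  \<open>s\<close> and \<open>c\<close>.\<close>

lemma KInt_decay:
  assumes c0: "c0 > 0"
  obtains C :: real where "C \<ge> 0" "\<And>s c. \<bar>Re s\<bar> \<le> 2 \<Longrightarrow> c \<ge> c0 \<Longrightarrow> norm (KInt s (of_real c)) \<le> C * exp (- sqrt c)"
proof -
  define g where "g t = 49 * (t powr 0 * exp (- (c0 / 2 * t))) + t powr 1 * exp (- (c0 / 2 * t))" for t :: real
  have g: "g integrable_on {0<..}"
    unfolding g_def using c0 by (intro integrable_add integrable_on_mult_right integrable_powr_exp) auto
  have "norm (KInt s (of_real c)) \<le> integral {0<..} g * exp (- sqrt c)" if s: "\<bar>Re s\<bar> \<le> 2" and c: "c \<ge> c0" for s c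
  proof -
    have "norm (KInt s (of_real c)) \<le> integral {0<..} (\<lambda>t. g t * exp (- sqrt c))"
      unfolding KInt_def Lap_def
    proof (rule integral_norm_bound_integral)
      show "(\<lambda>t. exp (- (of_real c * of_real t)) * KInt_kernel s t) integrable_on {0<..}"
        by (rule Lap_integrable[OF pow_bounded_KInt_kernel]) (use c c0 in auto)
      show "(\<lambda>t. g t * exp (- sqrt c)) integrable_on {0<..}" by (intro integrable_on_mult_left g)
      fix t :: real assume "t \<in> {0<..}"
      then have t: "t > 0" by simp
      have cpos: "c > 0" using c c0 by simp
      have "(1 / sqrt t - sqrt c * sqrt t)\<^sup>2 \<ge> 0" by simp
      then have am: "2 * sqrt c \<le> 1 / t + c * t"
        using t cpos by (simp add: power2_diff power_divide power_mult_distrib)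
      have "exp (- (1 / t)) * exp (- (c * t)) = exp (- (1 / t + c * t) / 2) * (exp (- (1 / (2 * t))) * exp (- (c / 2 * t)))"
        by (simp flip: exp_add add: field_simps)
      also have "\<dots> \<le> exp (- sqrt c) * (exp (- (1 / (2 * t))) * exp (- (c0 / 2 * t)))"
        using am t c by (intro mult_mono) auto
      finally have 1: "exp (- (1 / t)) * exp (- (c * t)) \<le> exp (- sqrt c) * (exp (- (1 / (2 * t))) * exp (- (c0 / 2 * t)))" .
      \<comment> \<open>As \<open>\<bar>Re s\<bar> \<le> 2\<close>, the power is at worst
        \<open>t powr (- 3)\<close> for \<open>t \<le> 1\<close>, where the exponential contributes
        \<open>3! * (2 t)^3\<close> and the product is 48, and at most \<open>t\<close> for
        \<open>t > 1\<close>.\<close>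
      have 2: "t powr (- Re s - 1) * exp (- (1 / (2 * t))) \<le> 49 + t"
      proof (cases "t \<le> 1")
        case True
        have "t powr (- Re s - 1) \<le> t powr (- 3)" using True t s by (intro powr_mono') auto
        moreover have "exp (- (1 / (2 * t))) \<le> fact 3 * (2 * t) ^ 3" using t by (intro exp_minus_inverse_le) auto
        ultimately have "t powr (- Re s - 1) * exp (- (1 / (2 * t))) \<le> t powr (- 3) * (fact 3 * (2 * t) ^ 3)"
          by (intro mult_mono) auto
        also have "\<dots> = 48" using t by (simp add: powr_minus powr_numeral fact_numeral power_mult_distrib)
        finally show ?thesis using t by simp
      next
        case False
        have "t powr (- Re s - 1) * exp (- (1 / (2 * t))) \<le> t powr 1 * 1"
          using False t s by (intro mult_mono powr_mono) auto
        then show ?thesis using t by simp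
      qed
      have "norm (exp (- (of_real c * of_real t)) * KInt_kernel s t) = t powr (- Re s - 1) * (exp (- (1 / t)) * exp (- (c * t)))"
        unfolding norm_Lap_integrand norm_KInt_kernel[OF t] by simp
      also have "\<dots> \<le> t powr (- Re s - 1) * (exp (- sqrt c) * (exp (- (1 / (2 * t))) * exp (- (c0 / 2 * t))))"
        by (intro mult_left_mono 1) auto
      also have "\<dots> = (t powr (- Re s - 1) * exp (- (1 / (2 * t)))) * (exp (- (c0 / 2 * t)) * exp (- sqrt c))"
        by simp
      also have "\<dots> \<le> (49 + t) * (exp (- (c0 / 2 * t)) * exp (- sqrt c))"
        by (intro mult_right_mono 2) auto
      also have "\<dots> = g t * exp (- sqrt c)" using t by (simp add: g_def algebra_simps)
      finally show "norm (exp (- (of_real c * of_real t)) * KInt_kernel s t) \<le> g t * exp (- sqrt c)" .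
    qed
    then show ?thesis by simp
  qed
  moreover have "integral {0<..} g \<ge> 0"
    by (rule integral_nonneg[OF g]) (auto simp: g_def)
  ultimately show ?thesis by (intro that[of "integral {0<..} g"]) auto
qed

section \<open>Decay of the kernel, uniformly in the order\<close>

lemma bessel_systemD:
  assumes "bessel_system b f g" "t > 0"
  shows "(f has_vector_derivative g t) (at t)"
    and "(g has_vector_derivative - g t / of_real t - (1 - b / of_real (t\<^sup>2)) * f t) (at t)"
  using assms unfolding bessel_system_def by auto

text \<open>The quotients defining \<open>Y\<close> and \<open>K\<close> degenerate to \<open>0/0\<close> at order 0. Schwarz's lemma bounds
  them by their numerators alone, which gives all estimates uniformly near order 0.\<close>

lemma sin_quotient_bound:
  assumes \<rho>: "0 < \<rho>" "\<rho> < 1"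
  obtains C :: real where "C > 0"
    "\<And>f K z. f holomorphic_on UNIV \<Longrightarrow> f 0 = 0 \<Longrightarrow> (\<And>z. norm z \<le> \<rho> \<Longrightarrow> norm (f z) \<le> K) \<Longrightarrow>
       0 < norm z \<Longrightarrow> norm z \<le> \<rho> \<Longrightarrow> norm (f z / sin (z * of_real pi)) \<le> C * K"
proof -
  \<comment> \<open>This is \<open>sin (pi z) / (pi z)\<close> by reflection; as a product of
    reciprocal Gamma values it needs no separate definition at 0, and its zeros are known.\<close>
  define s :: "complex \<Rightarrow> complex" where "s z = rGamma (1 + z) * rGamma (1 - z)" for z
  have nz: "s z \<noteq> 0" if "norm z \<le> \<rho>" for z
  proof -
    have "\<bar>Re z\<bar> < 1" using that \<rho> abs_Re_le_cmod[of z] by linarith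
    then have "1 + z \<notin> \<int>\<^sub>\<le>\<^sub>0" "1 - z \<notin> \<int>\<^sub>\<le>\<^sub>0"
      by (auto elim!: nonpos_Ints_cases simp: complex_eq_iff)
    then show ?thesis by (simp add: s_def rGamma_eq_zero_iff)
  qed
  have "continuous_on (cball 0 \<rho>) (\<lambda>z. inverse (s z))"
    using nz unfolding s_def
    by (intro continuous_intros holomorphic_on_imp_continuous_on[OF holomorphic_rGamma'] holomorphic_intros) auto
  then obtain B where B: "B > 0" "\<And>z. norm z \<le> \<rho> \<Longrightarrow> norm (inverse (s z)) \<le> B"
    by (rule continuous_bounded_on_cball) blast
  have sin: "sin (z * of_real pi) = of_real pi * (z * s z)" for z :: complex
  proof -
    have "z * s z = (z * rGamma (z + 1)) * rGamma (1 - z)" by (simp add: s_def add.commute)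
    also have "\<dots> = sin (of_real pi * z) / of_real pi" unfolding rGamma_plus1 by (rule rGamma_reflection_complex)
    finally show ?thesis by (simp add: mult.commute)
  qed
  show ?thesis
  proof (rule that[of "2 * B / (pi * \<rho>)"])
    show "2 * B / (pi * \<rho>) > 0" using B \<rho> by simp
    fix f :: "complex \<Rightarrow> complex" and K :: real and z :: complex
    assume f: "f holomorphic_on UNIV" "f 0 = 0" and K: "\<And>z. norm z \<le> \<rho> \<Longrightarrow> norm (f z) \<le> K"
      and z: "0 < norm z" "norm z \<le> \<rho>"
    have K0: "K \<ge> 0" using order_trans[OF norm_ge_zero K[OF z(2)]] .
    have "norm (f z) \<le> 2 * K * (norm z / \<rho>)"
    proof (cases "norm z = \<rho> \<or> K = 0")
      case True
      then show ?thesis using K[OF z(2)] K0 z by auto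
    next
      case False
      then have lt: "norm z < \<rho>" "K > 0" using z K0 by auto
      \<comment> \<open>The factor 2 makes the bound by 1 strict, as Schwarz's lemma
        demands.\<close>
      define g where "g w = f (of_real \<rho> * w) / of_real (2 * K)" for w
      have "norm (g (z / of_real \<rho>)) \<le> norm (z / of_real \<rho>)"
      proof (rule Schwarz_Lemma(1))
        show "g holomorphic_on ball 0 1"
          unfolding g_def using lt
          by (intro holomorphic_intros holomorphic_on_compose_gen[OF _ f(1), unfolded o_def]) auto
        show "g 0 = 0" by (simp add: g_def f)
        show "norm (g w) < 1" if "norm w < 1" for w
        proof -
          have "norm (of_real \<rho> * w) \<le> \<rho>" using that \<rho> by (simp add: norm_mult)
          then have "norm (f (of_real \<rho> * w)) \<le> K" by (rule K)
          then show ?thesis using lt by (simp add: g_def norm_divide norm_mult)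
        qed
        show "norm (z / of_real \<rho>) < 1" using lt \<rho> by (simp add: norm_divide)
      qed
      then show ?thesis using lt \<rho> by (simp add: g_def norm_divide norm_mult field_simps)
    qed
    moreover have "f z / sin (z * of_real pi) = f z * (inverse (s z) / (of_real pi * z))"
      unfolding sin by (simp add: field_simps)
    moreover have "norm (inverse (s z) / (of_real pi * z)) \<le> B / (pi * norm z)"
      using B(2)[OF z(2)] z(1) unfolding norm_divide by (simp add: norm_mult divide_right_mono)
    ultimately have "norm (f z / sin (z * of_real pi)) \<le> 2 * K * (norm z / \<rho>) * (B / (pi * norm z))"
      using K0 \<rho> by (simp only: norm_mult) (intro mult_mono; simp)
    also have "\<dots> = 2 * B / (pi * \<rho>) * K" using z \<rho> by (simp add: field_simps)
    finally show "norm (f z / sin (z * of_real pi)) \<le> 2 * B / (pi * \<rho>) * K" .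
  qed
qed

lemma small_notin_Ints:
  assumes "z \<noteq> 0" "norm (z :: complex) < 1"
  shows "z \<notin> \<int>"
proof
  assume "z \<in> \<int>"
  then obtain k where "z = of_int k" by (auto elim: Ints_cases)
  then show False using assms by simp
qed

section \<open>Large-argument bounds for \<open>J\<close>, for the quotient defining
  \<open>Y\<close>, and for the bracket\<close>

definition Yq :: "complex \<Rightarrow> complex \<Rightarrow> complex" where
  "Yq m z = (Bessel_J m z * cos (m * of_real pi) - Bessel_J (- m) z) / sin (m * of_real pi)"

definition Yq' :: "complex \<Rightarrow> complex \<Rightarrow> complex" where
  "Yq' m z = (Bessel_J' m z * cos (m * of_real pi) - Bessel_J' (- m) z) / sin (m * of_real pi)"

lemma Bessel_Y_eq: "m \<notin> \<int> \<Longrightarrow> Bessel_Y m z = Yq m z"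
  by (simp add: Bessel_Y_def Yq_def)

lemma bessel_system_Yq: "bessel_system (m\<^sup>2) (\<lambda>t. Yq m (of_real t)) (\<lambda>t. Yq' m (of_real t))"
  using bessel_system_combine[OF bessel_system_J[of m] bessel_system_J[of "- m", unfolded power2_minus],
      of "cos (m * of_real pi) / sin (m * of_real pi)" "- 1 / sin (m * of_real pi)"]
  unfolding Yq_def Yq'_def by (simp add: diff_divide_distrib mult_ac)

text \<open>At the fixed point 1 the initial values are continuous in the order, hence bounded on
  the closed unit disc; the energy estimate carries this bound to all larger
  \<open>t\<close>.\<close>

lemma Bessel_J_decay:
  obtains B where "B \<ge> 0" "\<And>n t. norm n \<le> 1 \<Longrightarrow> t \<ge> 1 \<Longrightarrow>
     norm (Bessel_J n (of_real t)) \<le> B / sqrt t \<and> norm (Bessel_J' n (of_real t)) \<le> B / sqrt t"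
proof -
  obtain A1 where A1: "A1 > 0" "\<And>n. norm n \<le> 1 \<Longrightarrow> norm (Bessel_J n 1) \<le> A1"
    using continuous_bounded_on_cball[OF holomorphic_on_imp_continuous_on[OF holomorphic_Bessel_J_order[of 1]], of 1]
    by (metis zero_neq_one)
  obtain A2 where A2: "A2 > 0" "\<And>n. norm n \<le> 1 \<Longrightarrow> norm (Bessel_J' n 1) \<le> A2"
    using continuous_bounded_on_cball[OF holomorphic_on_imp_continuous_on[OF holomorphic_Bessel_J'_order[of 1]], of 1]
    by (metis zero_neq_one)
  define A where "A = max A1 A2"
  have *: "norm (Bessel_J n (of_real t)) \<le> bessel_const 1 1 A / sqrt t \<and> norm (Bessel_J' n (of_real t)) \<le> bessel_const 1 1 A / sqrt t"
    if "norm n \<le> 1" "t \<ge> 1" for n t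
    using that A1(2)[of n] A2(2)[of n] power_le_one[of "norm n" 2]
    by (intro conjI bessel_system_decay[OF bessel_system_J[of n]]) (auto simp: A_def norm_power)
  show ?thesis
  proof (rule that)
    show "bessel_const 1 1 A \<ge> 0" using order_trans[OF norm_ge_zero conjunct1[OF *[of 0 1]]] by simp
  qed (use * in blast)
qed

text \<open>Only the initial values at \<open>t0\<close> need care: there the numerators are entire
  in the order and vanish at order 0, so their quotients by the sine are bounded on the punctured
  disc. The energy estimate then propagates the bound.\<close>

lemma Yq_decay:
  assumes t0: "t0 > 0" and \<rho>: "0 < \<rho>" "\<rho> < 1"
  obtains B where "B \<ge> 0" "\<And>m t. 0 < norm m \<Longrightarrow> norm m \<le> \<rho> \<Longrightarrow> t \<ge> t0 \<Longrightarrow>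
     norm (Yq m (of_real t)) \<le> B / sqrt t \<and> norm (Yq' m (of_real t)) \<le> B / sqrt t"
proof -
  obtain C :: real where C: "C > 0"
    "\<And>f K z. f holomorphic_on UNIV \<Longrightarrow> f 0 = 0 \<Longrightarrow> (\<And>z. norm z \<le> \<rho> \<Longrightarrow> norm (f z) \<le> K) \<Longrightarrow>
       0 < norm z \<Longrightarrow> norm z \<le> \<rho> \<Longrightarrow> norm (f z / sin (z * of_real pi)) \<le> C * K"
    using sin_quotient_bound[OF \<rho>] by blast
  have nz: "complex_of_real t0 \<noteq> 0" using t0 by simp
  define f1 where "f1 m = Bessel_J m (of_real t0) * cos (m * of_real pi) - Bessel_J (- m) (of_real t0)" for m
  define f2 where "f2 m = Bessel_J' m (of_real t0) * cos (m * of_real pi) - Bessel_J' (- m) (of_real t0)" for m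
  have h: "f1 holomorphic_on UNIV" "f2 holomorphic_on UNIV"
    unfolding f1_def f2_def
    using nz holomorphic_on_compose[OF holomorphic_on_minus[OF holomorphic_on_ident] holomorphic_Bessel_J_order[OF nz]]
      holomorphic_on_compose[OF holomorphic_on_minus[OF holomorphic_on_ident] holomorphic_Bessel_J'_order[OF nz]]
    by (auto intro!: holomorphic_intros holomorphic_Bessel_J_order holomorphic_Bessel_J'_order simp: o_def)
  obtain K1 where K1: "\<And>m. norm m \<le> \<rho> \<Longrightarrow> norm (f1 m) \<le> K1"
    using continuous_bounded_on_cball[OF holomorphic_on_imp_continuous_on[OF holomorphic_on_subset[OF h(1) subset_UNIV]]] by blast
  obtain K2 where K2: "\<And>m. norm m \<le> \<rho> \<Longrightarrow> norm (f2 m) \<le> K2"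
    using continuous_bounded_on_cball[OF holomorphic_on_imp_continuous_on[OF holomorphic_on_subset[OF h(2) subset_UNIV]]] by blast
  define A where "A = C * max K1 K2"
  have A: "norm (Yq m (of_real t0)) \<le> A" "norm (Yq' m (of_real t0)) \<le> A" if "0 < norm m" "norm m \<le> \<rho>" for m
    using C(2)[OF h(1), of "max K1 K2" m] C(2)[OF h(2), of "max K1 K2" m] that K1 K2
    by (auto simp: Yq_def Yq'_def f1_def f2_def A_def le_max_iff_disj)
  have *: "norm (Yq m (of_real t)) \<le> bessel_const t0 1 A / sqrt t \<and> norm (Yq' m (of_real t)) \<le> bessel_const t0 1 A / sqrt t"
    if m: "0 < norm m" "norm m \<le> \<rho>" "t \<ge> t0" for m t
  proof -
    have "norm (m\<^sup>2) \<le> 1" using m \<rho> by (simp add: norm_power power_le_one)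
    then show ?thesis
      using m A[OF m(1,2)] t0 by (intro conjI bessel_system_decay[OF bessel_system_Yq[of m]]) auto
  qed
  show ?thesis
  proof (rule that)
    have "0 \<le> bessel_const t0 1 A / sqrt t0"
      using *[of "of_real \<rho>" t0] \<rho> order_trans[OF norm_ge_zero] by fastforce
    then show "bessel_const t0 1 A \<ge> 0" using t0 by (simp add: zero_le_divide_iff)
  qed (use * in blast)
qed

definition KYq :: "complex \<Rightarrow> real \<Rightarrow> complex" where
  "KYq n c = Bessel_K (2 * n) (2 * of_real (sqrt c)) - of_real pi / 2 * Bessel_Y (2 * n) (2 * of_real (sqrt c))"

lemma of_real_sqrt_powr:
  assumes "c > 0"
  shows "complex_of_real (sqrt c) powr (2 * a) = of_real c powr a"
  using assms by (simp add: powr_def Ln_of_real ln_sqrt)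

text \<open>This form serves for large \<open>c\<close>, where the two \<open>I\<close> terms of the
  definition grow exponentially and cancel; the explicit expansion in \<open>Phi\<close> serves near
  0 and for the Laplace transform.\<close>

lemma Bessel_K_eq_KInt:
  assumes c: "c > 0" and n: "n \<noteq> 0" "norm n < 1/2"
  shows "Bessel_K (2 * n) (2 * of_real (sqrt c)) = of_real c powr (- n) * KInt (2 * n) (of_real c) / 2"
proof -
  have m: "2 * n \<noteq> 0" "norm (2 * n) < 1" using n by (auto simp: norm_mult)
  have ni: "2 * n \<notin> \<int>" by (rule small_notin_Ints[OF m])
  have sin: "sin (2 * n * of_real pi) \<noteq> 0"
  proof
    assume "sin (2 * n * of_real pi) = 0"
    then obtain k where "2 * n * of_real pi = of_int k * of_real pi" unfolding sin_eq_0 by auto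
    then have "2 * n = of_int k" by simp
    then show False using ni by auto
  qed
  have "Bessel_I (- (2 * n)) (2 * of_real (sqrt c)) - Bessel_I (2 * n) (2 * of_real (sqrt c))
      = of_real c powr (- n) * (Phi (- (2 * n)) (of_real c) - of_real c powr (2 * n) * Phi (2 * n) (of_real c))"
  proof -
    have "complex_of_real (sqrt c) powr (- (2 * n)) = of_real c powr (- n)" "complex_of_real (sqrt c) powr (2 * n) = of_real c powr n"
      using of_real_sqrt_powr[OF c, of "- n"] of_real_sqrt_powr[OF c, of n] by simp_all
    moreover have "of_real c powr (- n) * complex_of_real c powr (2 * n) = of_real c powr n"
      by (simp flip: powr_add)
    moreover have "(complex_of_real (sqrt c))\<^sup>2 = of_real c" using c by (simp flip: of_real_power)
    ultimately show ?thesis unfolding Bessel_I_Phi by (simp add: algebra_simps)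
  qed
  also have "\<dots> = of_real c powr (- n) * (KInt (2 * n) (of_real c) * (sin (of_real pi * (2 * n)) / of_real pi))"
    using KInt_eq[OF m(1), of "of_real c"] m(2) c abs_Re_le_cmod[of "2 * n"] by simp
  finally show ?thesis
    using ni sin by (simp add: Bessel_K_def mult_ac field_simps)
qed

lemma KYq_eq:
  assumes c: "c > 0" and n: "n \<noteq> 0" "norm n < 1/2"
  shows "KYq n c = of_real pi / 2 * ((of_real c powr (- n) * (Phi (- 2 * n) (of_real c) + Phi (- 2 * n) (- of_real c))
      - of_real c powr n * (Phi (2 * n) (of_real c) + cos (2 * n * of_real pi) * Phi (2 * n) (- of_real c))) / sin (2 * n * of_real pi))"
proof -
  have m: "2 * n \<noteq> 0" "norm (2 * n) < 1" using n by (auto simp: norm_mult)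
  have ni: "2 * n \<notin> \<int>" by (rule small_notin_Ints[OF m])
  have "complex_of_real (sqrt c) powr (- (2 * n)) = of_real c powr (- n)" "complex_of_real (sqrt c) powr (2 * n) = of_real c powr n"
    using of_real_sqrt_powr[OF c, of "- n"] of_real_sqrt_powr[OF c, of n] by simp_all
  moreover have "(complex_of_real (sqrt c))\<^sup>2 = of_real c" using c by (simp flip: of_real_power)
  ultimately show ?thesis
    using ni by (simp add: KYq_def Bessel_K_def Bessel_Y_def Bessel_I_Phi Bessel_J_Phi diff_divide_distrib add_divide_distrib algebra_simps)
qed

text \<open>The \<open>K\<close> part is exponentially small. The \<open>Y\<close> part decays like
  the inverse root of its argument \<open>2 sqrt c\<close>, which is \<open>c powr (- 1/4)\<close>,
  and the chain rule adds \<open>c powr (- 1/2)\<close> to its derivative. \<open>B\<close> is fixed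
  before the order.\<close>

lemma KYq_decay:
  assumes c0: "c0 > 0" and r: "0 < r" "r < 1/2"
  obtains B where "B \<ge> 0" "\<And>n. 0 < norm n \<Longrightarrow> norm n \<le> r \<Longrightarrow>
    \<exists>G'. (\<forall>c>0. (KYq n has_vector_derivative G' c) (at c)) \<and> continuous_on {0<..} G' \<and>
      (\<forall>c\<ge>c0. norm (KYq n c) \<le> B * c powr (- 1/4) \<and> norm (G' c) \<le> B * c powr (- 3/4))"
proof -
  define t0 where "t0 = 2 * sqrt c0"
  have t0: "t0 > 0" using c0 by (simp add: t0_def)
  obtain BY where BY: "BY \<ge> 0" "\<And>m t. 0 < norm m \<Longrightarrow> norm m \<le> 2 * r \<Longrightarrow> t \<ge> t0 \<Longrightarrow>
     norm (Yq m (of_real t)) \<le> BY / sqrt t \<and> norm (Yq' m (of_real t)) \<le> BY / sqrt t"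
    using Yq_decay[OF t0, of "2 * r"] r by auto
  obtain C where C: "C \<ge> 0" "\<And>s c. \<bar>Re s\<bar> \<le> 2 \<Longrightarrow> c \<ge> c0 \<Longrightarrow> norm (KInt s (of_real c)) \<le> C * exp (- sqrt c)"
    using KInt_decay[OF c0] by blast
  \<comment> \<open>The powers \<open>1/2\<close> and \<open>- 1/2\<close> bound the modulus of
    \<open>c powr (- n)\<close> for every admissible order. The exponential wins at infinity, and
    compactness covers the rest of the ray from \<open>c0\<close>.\<close>
  have "\<exists>D. \<forall>c\<ge>c0. (c powr (1/2) + c powr (- 1/2)) * exp (- sqrt c) \<le> D * c powr (- 3/4)"
  proof -
    have "((\<lambda>c. (c powr (1/2) + c powr (- 1/2)) * exp (- sqrt c) / c powr (- 3/4)) \<longlongrightarrow> 0) at_top" by real_asymp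
    then have "eventually (\<lambda>c. (c powr (1/2) + c powr (- 1/2)) * exp (- sqrt c) / c powr (- 3/4) < 1) at_top"
      by (rule order_tendstoD) auto
    then obtain c1 where c1: "\<And>c. c \<ge> c1 \<Longrightarrow> (c powr (1/2) + c powr (- 1/2)) * exp (- sqrt c) / c powr (- 3/4) < 1"
      by (auto simp: eventually_at_top_linorder)
    have "continuous_on {c0..c1} (\<lambda>c. (c powr (1/2) + c powr (- 1/2)) * exp (- sqrt c) / c powr (- 3/4))"
      using c0 by (intro continuous_intros) auto
    from compact_imp_bounded[OF compact_continuous_image[OF this compact_Icc]]
    obtain D where D: "\<And>c. c \<in> {c0..c1} \<Longrightarrow> norm ((c powr (1/2) + c powr (- 1/2)) * exp (- sqrt c) / c powr (- 3/4)) \<le> D"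
      unfolding bounded_iff by blast
    have *: "(c powr (1/2) + c powr (- 1/2)) * exp (- sqrt c) / c powr (- 3/4) \<le> max 1 D" if "c \<ge> c0" for c
      using c1[of c] D[of c] that by (cases "c \<le> c1") auto
    have "(c powr (1/2) + c powr (- 1/2)) * exp (- sqrt c) \<le> max 1 D * c powr (- 3/4)" if "c \<ge> c0" for c
    proof -
      have "c powr (- 3/4) > 0" using that c0 by simp
      from iffD1[OF pos_divide_le_eq[OF this] *[OF that]] show ?thesis .
    qed
    then show ?thesis by blast
  qed
  then obtain D where D: "\<And>c. c \<ge> c0 \<Longrightarrow> (c powr (1/2) + c powr (- 1/2)) * exp (- sqrt c) \<le> D * c powr (- 3/4)" by blast
  have D0: "D \<ge> 0"
  proof -
    have "0 \<le> (c0 powr (1/2) + c0 powr (- 1/2)) * exp (- sqrt c0)" by simp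
    also have "\<dots> \<le> D * c0 powr (- 3/4)" by (rule D) simp
    finally show ?thesis using c0 by (simp add: zero_le_mult_iff)
  qed
  \<comment> \<open>Converts the rate \<open>c powr (- 3/4)\<close> of the \<open>K\<close> part
    into \<open>c powr (- 1/4)\<close> for \<open>c \<ge> c0\<close>.\<close>
  define E where "E = (c0 powr (-1/2) + 1) * D"
  define B where "B = C * (E + D + D / c0) + pi / 2 * BY"
  show ?thesis
  proof (rule that[of B])
    show "B \<ge> 0" unfolding B_def E_def using C BY D0 c0 by simp
    fix n :: complex assume n: "0 < norm n" "norm n \<le> r"
    then have n': "n \<noteq> 0" "norm n < 1/2" using r by auto
    have m: "2 * n \<notin> \<int>" "norm (2 * n) \<le> 2 * r" "0 < norm (2 * n)"
      using small_notin_Ints[of "2 * n"] n' n by (auto simp: norm_mult)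
    have Ren: "\<bar>Re n\<bar> < 1/2" using n'(2) abs_Re_le_cmod[of n] by linarith
    define k where "k c = of_real c powr (- n) * KInt (2 * n) (of_real c) / 2" for c :: real
    define k' where "k' c = - n * of_real c powr (- n - 1) * KInt (2 * n) (of_real c) / 2 - of_real c powr (- n) * KInt (2 * n - 1) (of_real c) / 2" for c :: real
    define y where "y c = Yq (2 * n) (of_real (2 * sqrt c))" for c :: real
    define y' where "y' c = Yq' (2 * n) (of_real (2 * sqrt c)) * of_real (1 / sqrt c)" for c :: real
    have eq: "KYq n c = k c - of_real pi / 2 * y c" if "c > 0" for c
      unfolding KYq_def k_def y_def Bessel_Y_eq[OF m(1)] Bessel_K_eq_KInt[OF that n'] by simp
    have kd: "(k has_vector_derivative k' c) (at c)" if c: "c > 0" for c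
    proof -
      have nz: "complex_of_real c \<notin> \<real>\<^sub>\<le>\<^sub>0" using of_real_pos_notin_nonpos[OF c] .
      have d: "(KInt (2 * n) has_field_derivative - KInt (2 * n - 1) (of_real c)) (at (of_real c))"
        by (rule DERIV_KInt) (use c in simp)
      have "((\<lambda>z. z powr (- n) * KInt (2 * n) z / 2) has_field_derivative
         (- n * of_real c powr (- n - 1) * KInt (2 * n) (of_real c) + of_real c powr (- n) * (- KInt (2 * n - 1) (of_real c))) / 2) (at (of_real c))"
        by (rule DERIV_cdivide[OF DERIV_cong[OF DERIV_mult'[OF has_field_derivative_powr[OF nz] d]]]) simp
      from has_vector_derivative_real_field[OF this]
      have "(k has_vector_derivative (- n * of_real c powr (- n - 1) * KInt (2 * n) (of_real c) + of_real c powr (- n) * (- KInt (2 * n - 1) (of_real c))) / 2) (at c)"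
        unfolding k_def[abs_def] .
      also have "(- n * of_real c powr (- n - 1) * KInt (2 * n) (of_real c) + of_real c powr (- n) * (- KInt (2 * n - 1) (of_real c))) / 2 = k' c"
        by (simp add: k'_def diff_divide_distrib)
      finally show ?thesis .
    qed
    have yd: "(y has_vector_derivative y' c) (at c)" if c: "c > 0" for c
    proof -
      have s: "((\<lambda>c. 2 * sqrt c) has_real_derivative 1 / sqrt c) (at c)"
        using c by (auto intro!: derivative_eq_intros simp: field_simps)
      have "((\<lambda>t. Yq (2 * n) (of_real t)) has_vector_derivative Yq' (2 * n) (of_real (2 * sqrt c))) (at (2 * sqrt c))"
        by (rule bessel_systemD(1)[OF bessel_system_Yq]) (use c in simp)
      from vector_diff_chain_at[OF s[unfolded has_real_derivative_iff_has_vector_derivative] this]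
      show ?thesis unfolding y_def[abs_def] y'_def by (simp add: o_def scaleR_conv_of_real mult.commute)
    qed
    have cont_k': "continuous_on {0<..} k'"
    proof -
      have Kc: "continuous_on {0<..} (\<lambda>c. KInt s (of_real c))" for s
      proof (rule continuous_on_compose2[of "{z. Re z > 0}" "KInt s"])
        show "continuous_on {z. Re z > 0} (KInt s)"
          using DERIV_KInt by (auto intro!: continuous_at_imp_continuous_on DERIV_isCont)
      qed (auto intro!: continuous_intros)
      show ?thesis unfolding k'_def by (intro continuous_intros Kc) (auto simp: complex_nonpos_Reals_iff)
    qed
    have cont_y': "continuous_on {0<..} y'"
    proof -
      have "continuous_on {0<..} (\<lambda>t. Yq' (2 * n) (of_real t))"
        by (intro continuous_at_imp_continuous_on)
          (auto intro: has_vector_derivative_continuous bessel_systemD(2)[OF bessel_system_Yq])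
      then have "continuous_on {0<..} (\<lambda>c. Yq' (2 * n) (of_real (2 * sqrt c)))"
        by (rule continuous_on_compose2[of "{0<..}"]) (auto intro!: continuous_intros)
      then show ?thesis unfolding y'_def by (intro continuous_intros) auto
    qed
    show "\<exists>G'. (\<forall>c>0. (KYq n has_vector_derivative G' c) (at c)) \<and> continuous_on {0<..} G' \<and>
      (\<forall>c\<ge>c0. norm (KYq n c) \<le> B * c powr (- 1/4) \<and> norm (G' c) \<le> B * c powr (- 3/4))"
    proof (intro exI[of _ "\<lambda>c. k' c - of_real pi / 2 * y' c"] conjI allI impI)
      fix c :: real assume c: "c > 0"
      have "((\<lambda>c. k c - of_real pi / 2 * y c) has_vector_derivative k' c - of_real pi / 2 * y' c) (at c)"
        by (intro has_vector_derivative_diff has_vector_derivative_mult_right kd yd c)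
      then show "(KYq n has_vector_derivative k' c - of_real pi / 2 * y' c) (at c)"
        by (rule has_vector_derivative_transform_within_open[of _ _ _ "{0<..}"]) (use c eq in auto)
    next
      show "continuous_on {0<..} (\<lambda>c. k' c - of_real pi / 2 * y' c)"
        by (intro continuous_intros cont_k' cont_y')
    next
      fix c assume c: "c \<ge> c0"
      then have c': "c > 0" using c0 by simp
      have t: "2 * sqrt c \<ge> t0" using c by (simp add: t0_def)
      have sq: "1 / sqrt (2 * sqrt c) \<le> c powr (- 1/4)"
      proof -
        have "c powr (1/4) = sqrt (sqrt c)" using c' by (simp add: powr_half_sqrt[symmetric] powr_powr)
        also have "\<dots> \<le> sqrt (2 * sqrt c)" using c' by simp
        finally have "inverse (sqrt (2 * sqrt c)) \<le> inverse (c powr (1/4))" using c' by (intro le_imp_inverse_le) auto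
        then show ?thesis by (simp add: powr_minus inverse_eq_divide)
      qed
      have yb: "norm (y c) \<le> BY * c powr (- 1/4)"
      proof -
        have "norm (y c) \<le> BY * (1 / sqrt (2 * sqrt c))" using BY(2)[OF m(3,2) t] by (simp add: y_def)
        also have "\<dots> \<le> BY * c powr (- 1/4)" by (intro mult_left_mono sq BY)
        finally show ?thesis .
      qed
      have y'b: "norm (y' c) \<le> BY * c powr (- 3/4)"
      proof -
        have "norm (Yq' (2 * n) (of_real (2 * sqrt c))) \<le> BY * (1 / sqrt (2 * sqrt c))" using BY(2)[OF m(3,2) t] by simp
        also have "\<dots> \<le> BY * c powr (- 1/4)" by (intro mult_left_mono sq BY)
        finally have "norm (y' c) \<le> BY * c powr (- 1/4) * (1 / sqrt c)"
          unfolding y'_def norm_mult using c' by (intro mult_mono) (auto simp: BY norm_divide)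
        also have "1 / sqrt c = c powr (- 1/2)" using c' by (simp add: powr_half_sqrt[symmetric] powr_minus inverse_eq_divide)
        also have "BY * c powr (- 1/4) * c powr (- 1/2) = BY * c powr (- 3/4)"
          by (simp add: mult.assoc flip: powr_add)
        finally show ?thesis .
      qed
      have pn: "norm (of_real c powr (- n)) \<le> c powr (1/2) + c powr (- 1/2)"
      proof (cases "c \<ge> 1")
        case True
        then have "c powr (- Re n) \<le> c powr (1/2)" using Ren by (intro powr_mono) auto
        then show ?thesis using c' by (simp add: norm_powr_real_powr add_increasing2)
      next
        case False
        then have "c powr (- Re n) \<le> c powr (- 1/2)" using Ren c' by (intro powr_mono') auto
        then show ?thesis using c' by (simp add: norm_powr_real_powr add_increasing)
      qed
      have K2: "norm (KInt (2 * n) (of_real c)) \<le> C * exp (- sqrt c)" "norm (KInt (2 * n - 1) (of_real c)) \<le> C * exp (- sqrt c)"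
        using Ren by (intro C(2) c; simp)+
      have base: "norm (of_real c powr (- n) * KInt s (of_real c)) \<le> C * (D * c powr (- 3/4))"
        if "norm (KInt s (of_real c)) \<le> C * exp (- sqrt c)" for s
      proof -
        have "norm (of_real c powr (- n) * KInt s (of_real c)) \<le> (c powr (1/2) + c powr (- 1/2)) * (C * exp (- sqrt c))"
          unfolding norm_mult using that pn by (intro mult_mono) auto
        also have "\<dots> = C * ((c powr (1/2) + c powr (- 1/2)) * exp (- sqrt c))" by simp
        also have "\<dots> \<le> C * (D * c powr (- 3/4))" by (intro mult_left_mono D c C)
        finally show ?thesis .
      qed
      have half: "norm (x / 2) \<le> norm x" for x :: complex by (simp add: norm_divide)
      have "norm (k c) \<le> C * (D * c powr (- 3/4))"
        unfolding k_def by (rule order_trans[OF half base[OF K2(1)]])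
      also have "\<dots> \<le> C * (E * c powr (- 1/4))"
      proof -
        have "c powr (- 3/4) = c powr (- 1/2) * c powr (- 1/4)" by (simp flip: powr_add)
        also have "\<dots> \<le> (c0 powr (- 1/2) + 1) * c powr (- 1/4)"
          using c c0 powr_mono2'[of "- 1/2" c0 c] by (intro mult_right_mono) auto
        finally have "D * c powr (- 3/4) \<le> D * ((c0 powr (- 1/2) + 1) * c powr (- 1/4))" by (rule mult_left_mono[OF _ D0])
        then show ?thesis using C(1) by (intro mult_left_mono) (auto simp: E_def mult_ac)
      qed
      finally have kb: "norm (k c) \<le> C * (E * c powr (- 1/4))" .
      have "norm (k' c) \<le> norm (n / of_real c * (of_real c powr (- n) * KInt (2 * n) (of_real c)) / 2) + norm (of_real c powr (- n) * KInt (2 * n - 1) (of_real c) / 2)"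
      proof -
        have "complex_of_real c powr (- n - 1) = of_real c powr (- n) / of_real c" using c' by (simp add: powr_diff)
        then have "k' c = - (n / of_real c * (of_real c powr (- n) * KInt (2 * n) (of_real c)) / 2) - of_real c powr (- n) * KInt (2 * n - 1) (of_real c) / 2"
          by (simp add: k'_def)
        then show ?thesis using norm_triangle_ineq4 by (metis norm_minus_cancel)
      qed
      also have "\<dots> \<le> C * (D * c powr (- 3/4)) / c0 + C * (D * c powr (- 3/4))"
      proof (rule add_mono)
        have nc: "norm n / c \<le> 1 / c0" using n'(2) c c0 by (intro frac_le) auto
        have "norm (n / of_real c * (of_real c powr (- n) * KInt (2 * n) (of_real c)) / 2)
            = norm n / c * norm (of_real c powr (- n) * KInt (2 * n) (of_real c)) / 2"
          using c' by (simp add: norm_mult norm_divide)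
        also have "\<dots> \<le> 1 / c0 * (C * (D * c powr (- 3/4))) / 1"
          using c0 C(1) D0 by (intro frac_le mult_mono base[OF K2(1)] nc) auto
        finally show "norm (n / of_real c * (of_real c powr (- n) * KInt (2 * n) (of_real c)) / 2) \<le> C * (D * c powr (- 3/4)) / c0" by simp
        show "norm (of_real c powr (- n) * KInt (2 * n - 1) (of_real c) / 2) \<le> C * (D * c powr (- 3/4))"
          by (rule order_trans[OF half base[OF K2(2)]])
      qed
      finally have k'b: "norm (k' c) \<le> C * ((D / c0 + D) * c powr (- 3/4))" by (simp add: algebra_simps)
      have "norm (KYq n c) \<le> norm (k c) + pi / 2 * norm (y c)"
        unfolding eq[OF c'] by (rule order_trans[OF norm_triangle_ineq4]) (simp add: norm_mult)
      also have "\<dots> \<le> C * (E * c powr (- 1/4)) + pi / 2 * (BY * c powr (- 1/4))"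
        by (intro add_mono kb mult_left_mono yb) auto
      also have "\<dots> \<le> B * c powr (- 1/4)"
      proof -
        have "C * E + pi / 2 * BY \<le> B" using C(1) D0 c0 by (simp add: B_def algebra_simps)
        from mult_right_mono[OF this, of "c powr (- 1/4)"] show ?thesis by (simp add: algebra_simps)
      qed
      finally show "norm (KYq n c) \<le> B * c powr (- 1/4)" .
      have "norm (k' c - of_real pi / 2 * y' c) \<le> norm (k' c) + pi / 2 * norm (y' c)"
        by (rule order_trans[OF norm_triangle_ineq4]) (simp add: norm_mult)
      also have "\<dots> \<le> C * ((D / c0 + D) * c powr (- 3/4)) + pi / 2 * (BY * c powr (- 3/4))"
        by (intro add_mono k'b mult_left_mono y'b) auto
      also have "\<dots> \<le> B * c powr (- 3/4)"
      proof -
        have "E \<ge> 0" using D0 by (simp add: E_def)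
        then have "C * (D / c0 + D) + pi / 2 * BY \<le> B" using C(1) by (simp add: B_def algebra_simps)
        from mult_right_mono[OF this, of "c powr (- 3/4)"] show ?thesis by (simp add: algebra_simps)
      qed
      finally show "norm (k' c - of_real pi / 2 * y' c) \<le> B * c powr (- 3/4)" .
    qed
  qed
qed

section \<open>Tails of the integral\<close>

definition JK :: "complex \<Rightarrow> real \<Rightarrow> real \<Rightarrow> complex" where
  "JK n y c = Bessel_J n (of_real c) * KYq n (c * y)"

lemma continuous_J_real: "continuous_on {0<..} (\<lambda>c. Bessel_J n (of_real c))"
  by (intro continuous_at_imp_continuous_on)
    (auto intro: has_vector_derivative_continuous bessel_systemD(1)[OF bessel_system_J])

text \<open>Bessel's equation for \<open>J\<close> gives \<open>J K = - (J' K)' - J' K / c + n\<^sup>2 J K / c\<^sup>2 + J' K'\<close>,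
  in which every term decays like \<open>c powr (-5/4)\<close>.\<close>

lemma JK_tail:
  assumes y: "y > 0" and r: "0 < r" "r < 1/2"
  obtains B where "B \<ge> 0" "\<And>n R R'. 0 < norm n \<Longrightarrow> norm n \<le> r \<Longrightarrow> 1 \<le> R \<Longrightarrow> R \<le> R' \<Longrightarrow>
     norm (integral {R..R'} (JK n y)) \<le> B * R powr (- 1/4)"
proof -
  obtain B1 where B1: "B1 \<ge> 0" "\<And>n t. norm n \<le> 1 \<Longrightarrow> t \<ge> 1 \<Longrightarrow>
     norm (Bessel_J n (of_real t)) \<le> B1 / sqrt t \<and> norm (Bessel_J' n (of_real t)) \<le> B1 / sqrt t"
    using Bessel_J_decay by blast
  obtain B2 where B2: "B2 \<ge> 0" "\<And>n. 0 < norm n \<Longrightarrow> norm n \<le> r \<Longrightarrow>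
    \<exists>G'. (\<forall>c>0. (KYq n has_vector_derivative G' c) (at c)) \<and> continuous_on {0<..} G' \<and>
      (\<forall>c\<ge>y. norm (KYq n c) \<le> B2 * c powr (- 1/4) \<and> norm (G' c) \<le> B2 * c powr (- 3/4))"
    using KYq_decay[OF y r] by blast
  \<comment> \<open>Effect of the rescaling by \<open>y\<close>: \<open>y powr (- 1/4)\<close> for
    the values and \<open>y * y powr (- 3/4)\<close> for the derivative.\<close>
  define B3 where "B3 = B2 * y powr (- 1/4) + B2 * y powr (1/4)"
  have B3: "B3 \<ge> 0" using B2 by (simp add: B3_def)
  define K where "K = B1 * B3"
  have K: "K \<ge> 0" using B1 B3 by (simp add: K_def)
  show ?thesis
  \<comment> \<open>Each of the two boundary terms costs \<open>K\<close>. The three terms of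
    \<open>q\<close> cost \<open>3 * K\<close>, times 4 from integrating
    \<open>c powr (- 5/4)\<close>, which makes 12.\<close>
  proof (rule that[of "14 * K"])
    show "14 * K \<ge> 0" using K by simp
    fix n :: complex and R R' :: real
    assume n: "0 < norm n" "norm n \<le> r" and R: "1 \<le> R" "R \<le> R'"
    have n1: "norm n \<le> 1" "norm (n\<^sup>2) \<le> 1" using n r by (auto simp: norm_power power_le_one)
    obtain G' where G': "\<And>c. c > 0 \<Longrightarrow> (KYq n has_vector_derivative G' c) (at c)" "continuous_on {0<..} G'"
      "\<And>c. c \<ge> y \<Longrightarrow> norm (KYq n c) \<le> B2 * c powr (- 1/4)" "\<And>c. c \<ge> y \<Longrightarrow> norm (G' c) \<le> B2 * c powr (- 3/4)"
      using B2(2)[OF n] by blast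
    define f where "f c = Bessel_J n (of_real c)" for c :: real
    define f1 where "f1 c = Bessel_J' n (of_real c)" for c :: real
    define g where "g c = KYq n (c * y)" for c
    define g1 where "g1 c = of_real y * G' (c * y)" for c
    have fd: "(f has_vector_derivative f1 c) (at c)"
      "(f1 has_vector_derivative - f1 c / of_real c - (1 - n\<^sup>2 / of_real (c\<^sup>2)) * f c) (at c)" if "c > 0" for c
      unfolding f_def[abs_def] f1_def[abs_def] by (rule bessel_systemD[OF bessel_system_J that])+
    have gd: "(g has_vector_derivative g1 c) (at c)" if c: "c > 0" for c
    proof -
      have "((\<lambda>c. c * y) has_vector_derivative y) (at c)"
        by (auto intro!: derivative_eq_intros)
      from vector_diff_chain_at[OF this G'(1)] c y show ?thesis
        unfolding g_def[abs_def] g1_def by (simp add: o_def scaleR_conv_of_real)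
    qed
    have fb: "norm (f c) \<le> B1 * c powr (- 1/2)" "norm (f1 c) \<le> B1 * c powr (- 1/2)" if "c \<ge> 1" for c
    proof -
      have "1 / sqrt c = c powr (- 1/2)" using that by (simp add: powr_half_sqrt[symmetric] powr_minus inverse_eq_divide)
      then have "B1 / sqrt c = B1 * c powr (- 1/2)" by (metis mult.right_neutral times_divide_eq_right)
      then show "norm (f c) \<le> B1 * c powr (- 1/2)" "norm (f1 c) \<le> B1 * c powr (- 1/2)"
        using B1(2)[OF n1(1) that] unfolding f_def f1_def by auto
    qed
    have gb: "norm (g c) \<le> B3 * c powr (- 1/4)" "norm (g1 c) \<le> B3 * c powr (- 3/4)" if c: "c \<ge> 1" for c
    proof -
      have cy: "c * y \<ge> y" using c y by simp
      have "norm (g c) \<le> B2 * (c * y) powr (- 1/4)" unfolding g_def by (rule G'(3)[OF cy])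
      also have "\<dots> = (B2 * y powr (- 1/4)) * c powr (- 1/4)" using c y by (simp add: powr_mult)
      also have "\<dots> \<le> B3 * c powr (- 1/4)" unfolding B3_def by (intro mult_right_mono) (use B2(1) in auto)
      finally show "norm (g c) \<le> B3 * c powr (- 1/4)" .
      have "norm (g1 c) \<le> y * (B2 * (c * y) powr (- 3/4))"
        unfolding g1_def norm_mult using G'(4)[OF cy] y by (intro mult_mono) auto
      also have "\<dots> = B2 * (y powr 1 * y powr (- 3/4)) * c powr (- 3/4)" using c y by (simp add: powr_mult)
      also have "y powr 1 * y powr (- 3/4) = y powr (1/4)" by (simp only: powr_add[symmetric]) simp
      also have "B2 * y powr (1/4) * c powr (- 3/4) \<le> B3 * c powr (- 3/4)" unfolding B3_def
        by (intro mult_right_mono) (use B2(1) in auto)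
      finally show "norm (g1 c) \<le> B3 * c powr (- 3/4)" .
    qed
    define q where "q c = - f1 c * g c / of_real c + n\<^sup>2 * f c * g c / of_real (c\<^sup>2) + f1 c * g1 c" for c
    have cont: "continuous_on {0<..} f" "continuous_on {0<..} f1" "continuous_on {0<..} g" "continuous_on {0<..} g1"
    proof -
      show "continuous_on {0<..} f" "continuous_on {0<..} f1" "continuous_on {0<..} g"
        using fd gd by (auto intro!: continuous_at_imp_continuous_on has_vector_derivative_continuous)
      show "continuous_on {0<..} g1" unfolding g1_def
        using y by (intro continuous_intros continuous_on_compose2[OF G'(2)]) auto
    qed
    have contq: "continuous_on {0<..} q" unfolding q_def by (intro continuous_intros cont) auto
    have sub: "{R..R'} \<subseteq> {0<..}" using R by auto
    have qb: "norm (q c) \<le> 3 * K * c powr (- 5/4)" if c: "c \<ge> 1" for c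
    proof -
      have c0: "c > 0" using c by simp
      have e: "c powr (- 1/2) * c powr (- 1/4) = c powr (- 3/4)" "c powr (- 1/2) * c powr (- 3/4) = c powr (- 5/4)"
        by (simp_all only: powr_add[symmetric]) simp_all
      have ff: "norm (f1 c) * norm (g c) \<le> K * c powr (- 3/4)" "norm (f c) * norm (g c) \<le> K * c powr (- 3/4)"
        "norm (f1 c) * norm (g1 c) \<le> K * c powr (- 5/4)"
        using mult_mono[OF fb(2)[OF c] gb(1)[OF c]] mult_mono[OF fb(1)[OF c] gb(1)[OF c]] mult_mono[OF fb(2)[OF c] gb(2)[OF c]] B1(1)
        unfolding e[symmetric] by (simp_all add: K_def mult_ac)
      have le: "c powr (- 3/4) / c \<le> c powr (- 5/4)" "c powr (- 3/4) / c\<^sup>2 \<le> c powr (- 5/4)"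
      proof -
        have "c powr (- 3/4) / c = c powr (- 7/4)" using c0 powr_diff[of c "-3/4" 1] by simp
        also have "\<dots> \<le> c powr (- 5/4)" using c by (intro powr_mono) auto
        finally show 1: "c powr (- 3/4) / c \<le> c powr (- 5/4)" .
        have "c powr (- 3/4) / c\<^sup>2 \<le> c powr (- 3/4) / c"
          using c c0 by (intro divide_left_mono) (auto simp: power2_eq_square)
        with 1 show "c powr (- 3/4) / c\<^sup>2 \<le> c powr (- 5/4)" by simp
      qed
      have "norm (q c) \<le> norm (f1 c) * norm (g c) / c + norm (n\<^sup>2) * (norm (f c) * norm (g c) / c\<^sup>2) + norm (f1 c) * norm (g1 c)"
        unfolding q_def using c0
        by (intro order_trans[OF norm_triangle_ineq] add_mono) (auto simp: norm_mult norm_divide norm_power mult_ac)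
      also have "\<dots> \<le> K * (c powr (- 3/4) / c) + 1 * (K * (c powr (- 3/4) / c\<^sup>2)) + K * c powr (- 5/4)"
      proof (intro add_mono)
        show "norm (f1 c) * norm (g c) / c \<le> K * (c powr (- 3/4) / c)"
          using divide_right_mono[OF ff(1), of c] c0 by simp
        have "norm (f c) * norm (g c) / c\<^sup>2 \<le> K * (c powr (- 3/4) / c\<^sup>2)"
          using divide_right_mono[OF ff(2), of "c\<^sup>2"] by simp
        then show "norm (n\<^sup>2) * (norm (f c) * norm (g c) / c\<^sup>2) \<le> 1 * (K * (c powr (- 3/4) / c\<^sup>2))"
          using n1(2) by (intro mult_mono) auto
      qed (rule ff(3))
      also have "\<dots> \<le> K * c powr (- 5/4) + 1 * (K * c powr (- 5/4)) + K * c powr (- 5/4)"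
        using K by (intro add_mono mult_left_mono le) auto
      finally show ?thesis by simp
    qed
    have P: "((\<lambda>c. f c * g c - q c) has_integral (- (f1 R' * g R') - (- (f1 R * g R)))) {R..R'}"
    proof (rule fundamental_theorem_of_calculus[OF R(2)])
      fix c assume "c \<in> {R..R'}"
      then have c: "c > 0" using R by auto
      have "((\<lambda>c. - (f1 c * g c)) has_vector_derivative
          - (f1 c * g1 c + (- f1 c / of_real c - (1 - n\<^sup>2 / of_real (c\<^sup>2)) * f c) * g c)) (at c)"
        by (intro has_vector_derivative_minus has_vector_derivative_mult fd gd c)
      also have "- (f1 c * g1 c + (- f1 c / of_real c - (1 - n\<^sup>2 / of_real (c\<^sup>2)) * f c) * g c) = f c * g c - q c"
        unfolding q_def using c by (simp add: algebra_simps)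
      finally show "((\<lambda>c. - (f1 c * g c)) has_vector_derivative f c * g c - q c) (at c within {R..R'})"
        by (rule has_vector_derivative_at_within)
    qed
    have qint: "q integrable_on {R..R'}"
      by (intro integrable_continuous_real continuous_on_subset[OF contq] sub)
    have JK: "JK n y = (\<lambda>c. f c * g c)" by (simp add: JK_def f_def g_def fun_eq_iff)
    have "((\<lambda>c. (f c * g c - q c) + q c) has_integral (- (f1 R' * g R') - (- (f1 R * g R)) + integral {R..R'} q)) {R..R'}"
      by (intro has_integral_add P integrable_integral qint)
    then have eq: "integral {R..R'} (JK n y) = - (f1 R' * g R') + f1 R * g R + integral {R..R'} q"
      unfolding JK by (simp add: integral_unique)
    have bd: "norm (f1 c * g c) \<le> K * R powr (- 1/4)" if "c \<ge> R" for c
    proof -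
      have c: "c \<ge> 1" using that R by simp
      have "norm (f1 c * g c) \<le> (B1 * c powr (- 1/2)) * (B3 * c powr (- 1/4))"
        unfolding norm_mult using fb(2)[OF c] gb(1)[OF c] B1 by (intro mult_mono) auto
      also have "\<dots> = K * c powr (- 1/2) * c powr (- 1/4)" by (simp add: K_def)
      also have "\<dots> \<le> K * 1 * R powr (- 1/4)"
        using c that R K powr_mono2'[of "- 1/4" R c] powr_mono[of "- 1/2" 0 c] by (intro mult_mono) auto
      finally show ?thesis by simp
    qed
    have int54: "((\<lambda>c. 3 * K * c powr (- 5/4)) has_integral 3 * K * (4 * R powr (- 1/4) - 4 * R' powr (- 1/4))) {R..R'}"
    proof (rule has_integral_mult_right)
      have "((\<lambda>c. c powr (- 5/4)) has_integral (- 4 * R' powr (- 1/4) - (- 4 * R powr (- 1/4)))) {R..R'}"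
      proof (rule fundamental_theorem_of_calculus[OF R(2)])
        fix c assume "c \<in> {R..R'}"
        then have c: "c > 0" using R by auto
        have "((\<lambda>c. - 4 * c powr (- 1/4)) has_real_derivative c powr (- 5/4)) (at c)"
          using c by (auto intro!: derivative_eq_intros)
        then show "((\<lambda>c. - 4 * c powr (- 1/4)) has_vector_derivative c powr (- 5/4)) (at c within {R..R'})"
          by (simp add: has_real_derivative_iff_has_vector_derivative has_vector_derivative_at_within)
      qed
      then show "((\<lambda>c. c powr (- 5/4)) has_integral (4 * R powr (- 1/4) - 4 * R' powr (- 1/4))) {R..R'}" by simp
    qed
    have "norm (integral {R..R'} q) \<le> integral {R..R'} (\<lambda>c. 3 * K * c powr (- 5/4))"
      by (rule integral_norm_bound_integral[OF qint]) (use int54 qb R in auto)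
    also have "\<dots> = 3 * K * (4 * R powr (- 1/4) - 4 * R' powr (- 1/4))" by (rule integral_unique[OF int54])
    also have "\<dots> \<le> 3 * K * (4 * R powr (- 1/4))" using K by (intro mult_left_mono) auto
    finally have qi: "norm (integral {R..R'} q) \<le> 12 * (K * R powr (- 1/4))" by simp
    have "norm (integral {R..R'} (JK n y)) \<le> norm (f1 R' * g R') + norm (f1 R * g R) + norm (integral {R..R'} q)"
      unfolding eq by (rule order_trans[OF norm_triangle_ineq], rule add_mono, rule order_trans[OF norm_triangle_ineq]) auto
    also have "\<dots> \<le> 14 * K * R powr (- 1/4)" using bd[of R] bd[of R'] R qi by simp
    finally show "norm (integral {R..R'} (JK n y)) \<le> 14 * K * R powr (- 1/4)" .
  qed
qed

section \<open>Bounds near the origin, uniform in the order\<close>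

lemma norm_powr_le:
  assumes "c > 0" "\<bar>Re a\<bar> \<le> r"
  shows "norm (complex_of_real c powr a) \<le> c powr r + c powr (- r)"
proof (cases "c \<ge> 1")
  case True
  then have "c powr Re a \<le> c powr r" using assms by (intro powr_mono) auto
  then show ?thesis using assms by (simp add: norm_powr_real_powr add_increasing2)
next
  case False
  then have "c powr Re a \<le> c powr (- r)" using assms by (intro powr_mono') auto
  then show ?thesis using assms by (simp add: norm_powr_real_powr add_increasing)
qed

lemma Bessel_J_near_0:
  obtains C where "C \<ge> 0" "\<And>n c r. norm n \<le> r \<Longrightarrow> r \<le> 1 \<Longrightarrow> c > 0 \<Longrightarrow>
     norm (Bessel_J n (of_real c)) \<le> C * (c powr r + c powr (- r)) * exp (c\<^sup>2)"
proof -
  obtain S :: real where S: "S > 0" "\<And>a y. norm a \<le> real 1 \<Longrightarrow> norm (Phi a y) \<le> S * exp (1 * norm y)"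
    using Phi_bound[of 1 1] by auto
  have "norm (Bessel_J n (of_real c)) \<le> 4 * S * (c powr r + c powr (- r)) * exp (c\<^sup>2)"
    if n: "norm n \<le> r" "r \<le> 1" and c: "c > 0" for n c r
  proof -
    have rn: "\<bar>Re n\<bar> \<le> r" using n abs_Re_le_cmod[of n] by linarith
    have r0: "r \<ge> 0" using n norm_ge_zero order_trans by blast
    have "norm (Phi n (- ((of_real c / 2)\<^sup>2))) \<le> S * exp (1 * norm (- ((complex_of_real c / 2)\<^sup>2)))" by (rule S) (use n in simp)
    also have "\<dots> \<le> S * exp (c\<^sup>2)" using S c by (simp add: norm_power norm_divide power_divide)
    finally have 1: "norm (Phi n (- ((of_real c / 2)\<^sup>2))) \<le> S * exp (c\<^sup>2)" .
    have "norm ((complex_of_real c / 2) powr n) = norm (complex_of_real (c / 2) powr n)" by simp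
    also have "\<dots> \<le> (c/2) powr r + (c/2) powr (- r)" by (rule norm_powr_le) (use c rn in auto)
    also have "\<dots> = c powr r * 2 powr (- r) + c powr (- r) * 2 powr r"
      using c powr_divide[of c 2 r] powr_divide[of c 2 "- r"] powr_minus_divide[of 2 r] by simp
    also have "\<dots> \<le> c powr r * 4 + c powr (- r) * 4"
    proof (intro add_mono mult_left_mono)
      have "(2::real) powr r \<le> 2 powr 2" using n(2) by (intro powr_mono) auto
      then show "(2::real) powr r \<le> 4" by simp
      have "(2::real) powr (- r) \<le> 2 powr 0" using r0 by (intro powr_mono) auto
      then show "(2::real) powr (- r) \<le> 4" by simp
    qed auto
    finally have 2: "norm ((complex_of_real c / 2) powr n) \<le> 4 * (c powr r + c powr (- r))" by simp
    have "norm (Bessel_J n (of_real c)) \<le> (4 * (c powr r + c powr (- r))) * (S * exp (c\<^sup>2))"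
      unfolding Bessel_J_Phi norm_mult by (rule mult_mono[OF 2 1]) auto
    then show ?thesis by (simp add: mult_ac)
  qed
  then show ?thesis using S(1) by (intro that[of "4 * S"]) auto
qed

text \<open>The numerator of the explicit expansion is entire in \<open>m = 2 * n\<close> and
  vanishes at \<open>m = 0\<close>, so Schwarz's lemma on the disc of radius
  \<open>2 * r < 1\<close> controls the quotient without loss as the order tends to 0.\<close>

lemma KYq_near_0:
  assumes r: "0 < r" "r < 1/2"
  obtains C where "C \<ge> 0" "\<And>n c. 0 < norm n \<Longrightarrow> norm n \<le> r \<Longrightarrow> c > 0 \<Longrightarrow>
     norm (KYq n c) \<le> C * (c powr r + c powr (- r)) * exp c"
proof -
  obtain C0 :: real where C0: "C0 > 0"
    "\<And>f K z. f holomorphic_on UNIV \<Longrightarrow> f 0 = 0 \<Longrightarrow> (\<And>z. norm z \<le> 2 * r \<Longrightarrow> norm (f z) \<le> K) \<Longrightarrow>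
       0 < norm z \<Longrightarrow> norm z \<le> 2 * r \<Longrightarrow> norm (f z / sin (z * of_real pi)) \<le> C0 * K"
    using sin_quotient_bound[of "2 * r"] r by auto
  obtain S :: real where S: "S > 0" "\<And>a y. norm a \<le> real 1 \<Longrightarrow> norm (Phi a y) \<le> S * exp (1 * norm y)"
    using Phi_bound[of 1 1] by auto
  have "continuous_on (cball 0 1) (\<lambda>z::complex. cos (z * of_real pi))" by (intro continuous_intros)
  then obtain Q where Q: "Q > 0" "\<And>z. norm z \<le> 1 \<Longrightarrow> norm (cos (z * of_real pi :: complex)) \<le> Q"
    by (rule continuous_bounded_on_cball) blast
  define C where "C = pi / 2 * C0 * (S * (3 + Q))"
  have "norm (KYq n c) \<le> C * (c powr r + c powr (- r)) * exp c" if n: "0 < norm n" "norm n \<le> r" and c: "c > 0" for n c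
  proof -
    define f where "f m = (of_real c powr (- m / 2) * (Phi (- m) (of_real c) + Phi (- m) (- of_real c))
      - of_real c powr (m / 2) * (Phi m (of_real c) + cos (m * of_real pi) * Phi m (- of_real c)))" for m
    define p where "p = c powr r + c powr (- r)"
    have p: "p \<ge> 0" by (simp add: p_def)
    have cz: "complex_of_real c \<noteq> 0" using c by simp
    have "f holomorphic_on UNIV"
      unfolding f_def using cz by (intro holomorphic_intros) auto
    moreover have "f 0 = 0" using cz by (simp add: f_def)
    moreover have "norm (f m) \<le> S * (3 + Q) * p * exp c" if m: "norm m \<le> 2 * r" for m
    proof -
      have m1: "norm m \<le> 1" using m r by simp
      have rm: "\<bar>Re (- m / 2)\<bar> \<le> r" "\<bar>Re (m / 2)\<bar> \<le> r" using m abs_Re_le_cmod[of m] by auto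
      have P: "norm (Phi a z) \<le> S * exp c" if "a = m \<or> a = - m" "z = of_real c \<or> z = - of_real c" for a z
        using S(2)[of a z] that m1 c by auto
      have "norm (f m) \<le> norm (complex_of_real c powr (- m / 2)) * (norm (Phi (- m) (of_real c)) + norm (Phi (- m) (- of_real c)))
         + norm (complex_of_real c powr (m / 2)) * (norm (Phi m (of_real c)) + norm (cos (m * of_real pi)) * norm (Phi m (- of_real c)))"
        unfolding f_def
        by (intro order_trans[OF norm_triangle_ineq4] add_mono; simp only: norm_mult;
            intro mult_left_mono order_trans[OF norm_triangle_ineq]) (auto simp: norm_mult)
      also have "\<dots> \<le> p * (S * exp c + S * exp c) + p * (S * exp c + Q * (S * exp c))"
        unfolding p_def using m1 Q S(1)
        by (intro add_mono mult_mono norm_powr_le P rm c Q(2)) auto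
      also have "\<dots> = S * (3 + Q) * p * exp c" by (simp add: algebra_simps)
      finally show ?thesis .
    qed
    ultimately have "norm (f (2 * n) / sin (2 * n * of_real pi)) \<le> C0 * (S * (3 + Q) * p * exp c)"
      using n by (intro C0(2)) (auto simp: norm_mult)
    moreover have "KYq n c = of_real pi / 2 * (f (2 * n) / sin (2 * n * of_real pi))"
      using KYq_eq[OF c, of n] n r by (simp add: f_def)
    then have "norm (KYq n c) = pi / 2 * norm (f (2 * n) / sin (2 * n * of_real pi))"
      by (simp add: norm_mult norm_divide)
    ultimately show ?thesis unfolding C_def p_def by (simp add: mult_left_mono mult_ac)
  qed
  moreover have "C \<ge> 0" using C0(1) S(1) Q(1) by (simp add: C_def)
  ultimately show ?thesis by (intro that) auto
qed

text \<open>Each factor costs \<open>c powr (- r)\<close>. As \<open>2 * r < 1\<close>, the product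
  is an integrable majorant common to all orders of modulus at most \<open>r\<close>; the limit to
  order 0 is taken under it.\<close>

lemma JK_near_0:
  assumes y: "y > 0" and r: "0 < r" "r < 1/2" and R: "R > 0"
  obtains C where "C \<ge> 0" "\<And>n c. 0 < norm n \<Longrightarrow> norm n \<le> r \<Longrightarrow> 0 < c \<Longrightarrow> c \<le> R \<Longrightarrow>
     norm (JK n y c) \<le> C * c powr (- 2 * r)"
proof -
  obtain C1 where C1: "C1 \<ge> 0" "\<And>n c r. norm n \<le> r \<Longrightarrow> r \<le> 1 \<Longrightarrow> c > 0 \<Longrightarrow>
     norm (Bessel_J n (of_real c)) \<le> C1 * (c powr r + c powr (- r)) * exp (c\<^sup>2)"
    using Bessel_J_near_0 by blast
  obtain C2 where C2: "C2 \<ge> 0" "\<And>n c. 0 < norm n \<Longrightarrow> norm n \<le> r \<Longrightarrow> c > 0 \<Longrightarrow>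
     norm (KYq n c) \<le> C2 * (c powr r + c powr (- r)) * exp c"
    using KYq_near_0[OF r] by blast
  define D1 where "D1 = C1 * (R powr (2 * r) + 1) * exp (R\<^sup>2)"
  define D2 where "D2 = C2 * ((R * y) powr (2 * r) + 1) * y powr (- r) * exp (R * y)"
  have le: "c powr r + c powr (- r) \<le> (R powr (2 * r) + 1) * c powr (- r)" if "0 < c" "c \<le> R" for c R :: real
  proof -
    have "c powr r = c powr (2 * r) * c powr (- r)" by (simp flip: powr_add)
    also have "\<dots> \<le> R powr (2 * r) * c powr (- r)" using that r by (intro mult_right_mono powr_mono2) auto
    finally show ?thesis by (simp add: algebra_simps)
  qed
  have "norm (JK n y c) \<le> (D1 * D2) * c powr (- 2 * r)" if n: "0 < norm n" "norm n \<le> r" and c: "0 < c" "c \<le> R" for n c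
  proof -
    have "norm (Bessel_J n (of_real c)) \<le> C1 * (c powr r + c powr (- r)) * exp (c\<^sup>2)"
      by (rule C1) (use n c r in auto)
    also have "\<dots> \<le> C1 * ((R powr (2 * r) + 1) * c powr (- r)) * exp (R\<^sup>2)"
      using c by (intro mult_mono le C1) (auto simp: power_mono C1)
    finally have 1: "norm (Bessel_J n (of_real c)) \<le> D1 * c powr (- r)" by (simp add: D1_def mult_ac)
    have "norm (KYq n (c * y)) \<le> C2 * ((c * y) powr r + (c * y) powr (- r)) * exp (c * y)"
      by (rule C2) (use n c y in auto)
    also have "\<dots> \<le> C2 * (((R * y) powr (2 * r) + 1) * (c * y) powr (- r)) * exp (R * y)"
      using c y by (intro mult_mono le C2) (auto simp: C2)
    finally have 2: "norm (KYq n (c * y)) \<le> D2 * c powr (- r)" using c y by (simp add: D2_def powr_mult mult_ac)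
    have "norm (JK n y c) \<le> (D1 * c powr (- r)) * (D2 * c powr (- r))"
      unfolding JK_def norm_mult using C1(1) by (intro mult_mono 1 2) (auto simp: D1_def)
    also have "\<dots> = (D1 * D2) * (c powr (- r) * c powr (- r))" by (simp add: mult_ac)
    also have "c powr (- r) * c powr (- r) = c powr (- 2 * r)" by (simp flip: powr_add)
    finally show ?thesis .
  qed
  moreover have "D1 * D2 \<ge> 0" unfolding D1_def D2_def using C1(1) C2(1) by simp
  ultimately show ?thesis by (intro that) auto
qed

lemma continuous_JK:
  assumes y: "y > 0" and n: "0 < norm n" "norm n < 1/2"
  shows "continuous_on {0<..} (JK n y)"
proof -
  have "continuous_on {0<..} (KYq n)"
  proof -
    have "\<exists>G'. \<forall>c>0. (KYq n has_vector_derivative G' c) (at c)"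
    proof (rule KYq_decay[OF zero_less_one n])
      fix B assume "\<And>m. 0 < norm m \<Longrightarrow> norm m \<le> norm n \<Longrightarrow>
        \<exists>G'. (\<forall>c>0. (KYq m has_vector_derivative G' c) (at c)) \<and> continuous_on {0<..} G' \<and>
          (\<forall>c\<ge>1. norm (KYq m c) \<le> B * c powr (- 1/4) \<and> norm (G' c) \<le> B * c powr (- 3/4))"
      from this[OF n(1) order_refl] show ?thesis by blast
    qed
    then obtain G' where "\<And>c. c > 0 \<Longrightarrow> (KYq n has_vector_derivative G' c) (at c)" by blast
    then show ?thesis by (intro continuous_at_imp_continuous_on) (auto intro: has_vector_derivative_continuous)
  qed
  moreover have "continuous_on {0<..} (\<lambda>c. c * y)" "(\<lambda>c. c * y) ` {0<..} \<subseteq> {0<..}"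
    using y by (auto intro!: continuous_intros)
  ultimately have "continuous_on {0<..} (\<lambda>c. KYq n (c * y))" by (rule continuous_on_compose2)
  then show ?thesis unfolding JK_def by (intro continuous_on_mult continuous_J_real)
qed

lemma pow_bounded_JK:
  assumes y: "y > 0" and n: "0 < norm n" "norm n < 1/2"
  shows "pow_bounded (JK n y)"
proof -
  define r where "r = norm n"
  have r: "0 < r" "r < 1/2" using n by (auto simp: r_def)
  obtain C where C0: "C \<ge> 0" "\<And>n c. 0 < norm n \<Longrightarrow> norm n \<le> r \<Longrightarrow> 0 < c \<Longrightarrow> c \<le> 1 \<Longrightarrow>
     norm (JK n y c) \<le> C * c powr (- 2 * r)"
    using JK_near_0[OF y r zero_less_one] by blast
  have C: "C \<ge> 0" "\<And>c. 0 < c \<Longrightarrow> c \<le> 1 \<Longrightarrow> norm (JK n y c) \<le> C * c powr (- 2 * r)"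
    using C0 n(1) by (auto simp: r_def)
  obtain B1 where B1: "B1 \<ge> 0" "\<And>n t. norm n \<le> 1 \<Longrightarrow> t \<ge> 1 \<Longrightarrow>
     norm (Bessel_J n (of_real t)) \<le> B1 / sqrt t \<and> norm (Bessel_J' n (of_real t)) \<le> B1 / sqrt t"
    using Bessel_J_decay by blast
  obtain B2 where B2: "B2 \<ge> 0" "\<And>n. 0 < norm n \<Longrightarrow> norm n \<le> r \<Longrightarrow>
    \<exists>G'. (\<forall>c>0. (KYq n has_vector_derivative G' c) (at c)) \<and> continuous_on {0<..} G' \<and>
      (\<forall>c\<ge>y. norm (KYq n c) \<le> B2 * c powr (- 1/4) \<and> norm (G' c) \<le> B2 * c powr (- 3/4))"
    using KYq_decay[OF y r] by blast
  have K: "norm (KYq n c) \<le> B2 * c powr (- 1/4)" if "c \<ge> y" for c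
    using B2(2)[OF n(1)] that by (auto simp: r_def)
  show ?thesis
  proof (rule pow_boundedI[OF continuous_JK[OF y n], of "- 2 * r" 0 "C + B1 * (B2 * y powr (- 1/4))"])
    fix c :: real assume c: "c > 0"
    have D: "B1 * (B2 * y powr (- 1/4)) \<ge> 0" using B1 B2 by simp
    show "norm (JK n y c) \<le> (C + B1 * (B2 * y powr (- 1/4))) * (c powr (- 2 * r) + c powr 0)"
    proof (cases "c \<le> 1")
      case True
      have "norm (JK n y c) \<le> C * c powr (- 2 * r)" by (rule C(2)[OF c True])
      also have "\<dots> \<le> (C + B1 * (B2 * y powr (- 1/4))) * (c powr (- 2 * r) + c powr 0)"
        using C D by (intro mult_mono) auto
      finally show ?thesis .
    next
      case False
      then have c1: "c \<ge> 1" by simp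
      have "norm (Bessel_J n (of_real c)) \<le> B1 / sqrt c" using B1(2)[OF _ c1, of n] n by auto
      also have "\<dots> \<le> B1 / 1" using c1 B1(1) by (intro divide_left_mono) auto
      finally have 1: "norm (Bessel_J n (of_real c)) \<le> B1" by simp
      have "norm (KYq n (c * y)) \<le> B2 * (c * y) powr (- 1/4)" by (rule K) (use c1 y in simp)
      also have "\<dots> \<le> B2 * y powr (- 1/4)" using c1 y B2(1) by (intro mult_left_mono powr_mono2') auto
      finally have 2: "norm (KYq n (c * y)) \<le> B2 * y powr (- 1/4)" .
      have "norm (JK n y c) \<le> B1 * (B2 * y powr (- 1/4)) * 1"
        unfolding JK_def norm_mult using 1 2 B1(1) by (simp add: mult_mono)
      also have "\<dots> \<le> (C + B1 * (B2 * y powr (- 1/4))) * (c powr (- 2 * r) + c powr 0)"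
        using C D c by (intro mult_mono) auto
      finally show ?thesis .
    qed
  qed (use r in auto)
qed

section \<open>A beta integral\<close>

text \<open>The beta integral is found without the Gaussian integral: the recurrence in \<open>a\<close> determines
  \<open>Tint a\<close> up to a constant independent of \<open>a\<close>, and \<open>Tint 1 = pi / 2\<close>.\<close>

definition Tint :: "complex \<Rightarrow> complex" where
  "Tint a = integral {0<..} (\<lambda>q. of_real (1 + q\<^sup>2) powr (- a))"

lemma one_plus_square_pos: "1 + q\<^sup>2 > (0::real)"
  by (simp add: add_pos_nonneg)

lemma continuous_Tint_integrand: "continuous_on A (\<lambda>q. complex_of_real (1 + q\<^sup>2) powr b)"
proof -
  have "isCont (\<lambda>q. complex_of_real (1 + q\<^sup>2) powr b) q" for q
    using of_real_pos_notin_nonpos[OF one_plus_square_pos[of q]]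
    by (intro isCont_powr_complex continuous_intros) auto
  then show ?thesis by (intro continuous_at_imp_continuous_on) auto
qed

lemma norm_Tint_integrand: "norm (complex_of_real (1 + q\<^sup>2) powr b) = (1 + q\<^sup>2) powr Re b"
  using one_plus_square_pos[of q] by (subst norm_powr_real_powr) (auto simp: less_imp_le)

lemma integrable_inverse_one_plus_square: "(\<lambda>q::real. 1 / (1 + q\<^sup>2)) integrable_on {0<..}"
proof (rule measurable_bounded_by_integrable_imp_integrable_real)
  show "(\<lambda>q::real. 1 / (1 + q\<^sup>2)) \<in> borel_measurable (lebesgue_on {0<..})"
    by (intro continuous_imp_measurable_on_sets_lebesgue continuous_intros)
      (use one_plus_square_pos in \<open>auto simp: less_imp_neq[symmetric] add_nonneg_eq_0_iff\<close>)
  show "(\<lambda>c::real. (if c \<le> 1 then c powr 0 else c powr (- 2))) integrable_on {0<..}"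
    by (intro integrable_two_powers) auto
  fix x :: real assume "x \<in> {0<..}"
  then have x: "x > 0" by simp
  show "\<bar>1 / (1 + x\<^sup>2)\<bar> \<le> (if x \<le> 1 then x powr 0 else x powr (- 2))"
  proof (cases "x \<le> 1")
    case True then show ?thesis using x one_plus_square_pos[of x] by (simp add: divide_le_eq)
  next
    case False
    have "1 / (1 + x\<^sup>2) \<le> 1 / x\<^sup>2" using x by (intro frac_le) auto
    then show ?thesis using False x one_plus_square_pos[of x] by (simp add: powr_minus powr_numeral divide_inverse)
  qed
qed auto

lemma one_plus_square_powr_le: "Re b \<le> - 1 \<Longrightarrow> (1 + q\<^sup>2) powr Re b \<le> 1 / (1 + q\<^sup>2)"
proof -
  assume "Re b \<le> - 1"
  then have "(1 + q\<^sup>2) powr Re b \<le> (1 + q\<^sup>2) powr (- 1)" by (intro powr_mono) auto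
  then show ?thesis using one_plus_square_pos[of q] by (simp add: powr_minus inverse_eq_divide)
qed

lemma Tint_integrable:
  assumes "Re a \<ge> 1"
  shows "(\<lambda>q. complex_of_real (1 + q\<^sup>2) powr (- a)) integrable_on {0<..}"
proof (rule integrable_on_continuous_dominated[OF continuous_Tint_integrand _ integrable_inverse_one_plus_square])
  show "norm (complex_of_real (1 + q\<^sup>2) powr (- a)) \<le> 1 / (1 + q\<^sup>2)" for q
    unfolding norm_Tint_integrand by (rule one_plus_square_powr_le) (use assms in simp)
qed auto

lemma DERIV_one_plus_square_powr:
  assumes "z\<^sup>2 + 1 \<notin> (\<real>\<^sub>\<le>\<^sub>0 :: complex set)"
  shows "((\<lambda>z. (z\<^sup>2 + 1) powr b) has_field_derivative 2 * b * z * (z\<^sup>2 + 1) powr (b - 1)) (at z)"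
proof -
  have "((\<lambda>z::complex. z\<^sup>2 + 1) has_field_derivative 2 * z) (at z)"
    by (auto intro!: derivative_eq_intros)
  from DERIV_chain2[OF has_field_derivative_powr[OF assms, of b] this] show ?thesis by (simp add: mult_ac)
qed

lemma real_square_plus_one: "(complex_of_real q)\<^sup>2 + 1 = of_real (1 + q\<^sup>2)" by simp

lemma real_square_plus_one_notin: "(complex_of_real q)\<^sup>2 + 1 \<notin> \<real>\<^sub>\<le>\<^sub>0"
  unfolding real_square_plus_one by (rule of_real_pos_notin_nonpos[OF one_plus_square_pos])

lemma q_powr_tendsto_0:
  assumes "Re a \<ge> 1"
  shows "(\<lambda>n. of_real (real (Suc n)) * complex_of_real (1 + (real (Suc n))\<^sup>2) powr (- a)) \<longlonglongrightarrow> 0"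
proof (rule Lim_null_comparison)
  show "(\<lambda>n. 1 / real (Suc n)) \<longlonglongrightarrow> 0" by (rule LIMSEQ_Suc[OF lim_1_over_n])
  show "\<forall>\<^sub>F n in sequentially. norm (of_real (real (Suc n)) * complex_of_real (1 + (real (Suc n))\<^sup>2) powr (- a)) \<le> 1 / real (Suc n)"
  proof (rule always_eventually, rule allI)
    fix n
    define q where "q = real (Suc n)"
    have q: "q > 0" by (simp add: q_def)
    have "norm (of_real q * complex_of_real (1 + q\<^sup>2) powr (- a)) = q * (1 + q\<^sup>2) powr Re (- a)"
      using q unfolding norm_mult norm_Tint_integrand by simp
    also have "\<dots> \<le> q * (1 / (1 + q\<^sup>2))" using assms q by (intro mult_left_mono one_plus_square_powr_le) auto
    also have "\<dots> \<le> 1 / q" using q one_plus_square_pos[of q] by (simp add: field_simps power2_eq_square)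
    finally show "norm (of_real (real (Suc n)) * complex_of_real (1 + (real (Suc n))\<^sup>2) powr (- a)) \<le> 1 / real (Suc n)"
      by (simp only: q_def)
  qed
qed

lemma q_powr_at_0: "(\<lambda>n. of_real (1 / real (Suc n)) * complex_of_real (1 + (1 / real (Suc n))\<^sup>2) powr (- a)) \<longlonglongrightarrow> 0"
proof -
  have "isCont (\<lambda>q. complex_of_real q * complex_of_real (1 + q\<^sup>2) powr (- a)) 0"
    using continuous_on_mult[OF continuous_on_of_real_id continuous_Tint_integrand, of UNIV "- a"]
    by (simp add: continuous_on_eq_continuous_at)
  from isCont_tendsto_compose[OF this LIMSEQ_Suc[OF lim_1_over_n]] show ?thesis by simp
qed

lemma q_powr_derivative:
  "((\<lambda>q. of_real q * complex_of_real (1 + q\<^sup>2) powr (- a)) has_vector_derivative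
     (1 - 2 * a) * of_real (1 + q\<^sup>2) powr (- a) + 2 * a * of_real (1 + q\<^sup>2) powr (- (a + 1))) (at q)"
proof -
  define z where "z = complex_of_real q"
  have nz: "z\<^sup>2 + 1 \<notin> \<real>\<^sub>\<le>\<^sub>0" unfolding z_def by (rule real_square_plus_one_notin)
  then have nz0: "z\<^sup>2 + 1 \<noteq> 0" by auto
  have "((\<lambda>z. z * (z\<^sup>2 + 1) powr (- a)) has_field_derivative
      z * (2 * (- a) * z * (z\<^sup>2 + 1) powr (- a - 1)) + 1 * (z\<^sup>2 + 1) powr (- a)) (at z)"
    by (rule DERIV_mult'[OF DERIV_ident DERIV_one_plus_square_powr[OF nz]])
  also have "z * (2 * (- a) * z * (z\<^sup>2 + 1) powr (- a - 1)) + 1 * (z\<^sup>2 + 1) powr (- a)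
      = (1 - 2 * a) * (z\<^sup>2 + 1) powr (- a) + 2 * a * (z\<^sup>2 + 1) powr (- (a + 1))"
  proof -
    have e: "- (a + 1) = - a - 1" by simp
    have "(z\<^sup>2 + 1) powr (- a) = (z\<^sup>2 + 1) * (z\<^sup>2 + 1) powr (- a - 1)" using nz0 by (simp add: powr_diff)
    then show ?thesis unfolding e by (simp add: algebra_simps power2_eq_square)
  qed
  finally have "((\<lambda>z. z * (z\<^sup>2 + 1) powr (- a)) has_field_derivative
      (1 - 2 * a) * (of_real q ^ 2 + 1) powr (- a) + 2 * a * (of_real q ^ 2 + 1) powr (- (a + 1))) (at (of_real q))"
    by (simp only: z_def)
  from has_vector_derivative_real_field[OF this] show ?thesis unfolding real_square_plus_one .
qed

text \<open>Integrate the derivative of \<open>q * (1 + q^2) powr (- a)\<close>; the boundary terms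
  vanish for \<open>Re a \<ge> 1\<close>.\<close>

lemma Tint_recurrence:
  assumes a: "Re a \<ge> 1"
  shows "(a - 1/2) * Tint a = a * Tint (a + 1)"
proof -
  let ?f = "\<lambda>a q. complex_of_real (1 + q\<^sup>2) powr (- a)"
  have "integral {0<..} (\<lambda>q. (1 - 2 * a) * ?f a q + 2 * a * ?f (a + 1) q) = 0 - 0"
  proof (rule integral_FTC_pos[where F = "\<lambda>q. of_real q * ?f a q"])
    show "continuous_on {0<..} (\<lambda>q. (1 - 2 * a) * ?f a q + 2 * a * ?f (a + 1) q)"
      by (intro continuous_on_add continuous_on_mult continuous_on_const continuous_Tint_integrand)
    show "(\<lambda>q. (norm (1 - 2 * a) + norm (2 * a)) * (1 / (1 + q\<^sup>2))) integrable_on {0<..}"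
      by (intro integrable_on_mult_right integrable_inverse_one_plus_square)
    fix q :: real
    have le: "norm (?f b q) \<le> 1 / (1 + q\<^sup>2)" if "Re b \<ge> 1" for b
      unfolding norm_Tint_integrand by (rule one_plus_square_powr_le) (use that in simp)
    have "norm ((1 - 2 * a) * ?f a q + 2 * a * ?f (a + 1) q) \<le> norm (1 - 2 * a) * norm (?f a q) + norm (2 * a) * norm (?f (a + 1) q)"
      by (rule order_trans[OF norm_triangle_ineq]) (simp only: norm_mult order_refl)
    also have "\<dots> \<le> norm (1 - 2 * a) * (1 / (1 + q\<^sup>2)) + norm (2 * a) * (1 / (1 + q\<^sup>2))"
      by (intro add_mono mult_left_mono le) (use a in auto)
    finally show "norm ((1 - 2 * a) * ?f a q + 2 * a * ?f (a + 1) q) \<le> (norm (1 - 2 * a) + norm (2 * a)) * (1 / (1 + q\<^sup>2))"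
      by (simp only: distrib_right)
    show "((\<lambda>q. of_real q * ?f a q) has_vector_derivative (1 - 2 * a) * ?f a q + 2 * a * ?f (a + 1) q) (at q)"
      by (rule q_powr_derivative)
  qed (rule q_powr_at_0 q_powr_tendsto_0[OF a])+
  moreover have "integral {0<..} (\<lambda>q. (1 - 2 * a) * ?f a q + 2 * a * ?f (a + 1) q) = (1 - 2 * a) * Tint a + 2 * a * Tint (a + 1)"
  proof -
    have "?f a integrable_on {0<..}" "?f (a + 1) integrable_on {0<..}" by (rule Tint_integrable; use a in simp)+
    then show ?thesis unfolding Tint_def
      by (subst integral_add) (auto intro: integrable_on_mult_right simp del: of_real_add of_real_1 of_real_power)
  qed
  ultimately have "(1 - 2 * a) * Tint a + 2 * a * Tint (a + 1) = 0" by simp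
  then show ?thesis by (simp add: field_simps)
qed

lemma Tint_pochhammer:
  assumes a: "Re a \<ge> 1"
  shows "pochhammer (a - 1/2) k * Tint a = pochhammer a k * Tint (a + of_nat k)"
proof (induction k)
  case (Suc k)
  have "pochhammer (a - 1/2) (Suc k) * Tint a = (a - 1/2 + of_nat k) * (pochhammer (a - 1/2) k * Tint a)"
    by (simp add: pochhammer_Suc)
  also have "\<dots> = pochhammer a k * ((a + of_nat k - 1/2) * Tint (a + of_nat k))"
    unfolding Suc by (simp add: algebra_simps)
  also have "(a + of_nat k - 1/2) * Tint (a + of_nat k) = (a + of_nat k) * Tint (a + of_nat k + 1)"
    by (rule Tint_recurrence) (use a in simp)
  finally show ?case by (simp add: pochhammer_Suc algebra_simps)
qed auto

text \<open>Laplace's method: with \<open>q = t / sqrt k\<close> the integrand tends to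
  \<open>exp (- t^2)\<close>, and Bernoulli's inequality bounds it by \<open>1 / (1 + t^2)\<close>
  for every \<open>k\<close>. The Gaussian integral may stay unevaluated.\<close>

lemma Tint_asymp:
  assumes a: "Re a \<ge> 1"
  shows "(\<lambda>k. of_real (sqrt (real (Suc k))) * Tint (a + of_nat (Suc k))) \<longlonglongrightarrow> integral {0<..} (\<lambda>t. of_real (exp (- t\<^sup>2)))"
proof -
  define f where "f k t = complex_of_real (1 + (t / sqrt (real (Suc k)))\<^sup>2) powr (- (a + of_nat (Suc k)))" for k t
  have eq: "of_real (sqrt (real (Suc k))) * Tint (a + of_nat (Suc k)) = integral {0<..} (f k)" for k
  proof -
    define m where "m = 1 / sqrt (real (Suc k))"
    have m: "m > 0" by (simp add: m_def)
    have "((\<lambda>q. complex_of_real (1 + q\<^sup>2) powr (- (a + of_nat (Suc k)))) has_integral Tint (a + of_nat (Suc k))) {0<..}"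
      unfolding Tint_def by (intro integrable_integral Tint_integrable) (use a in simp)
    from has_integral_scale_pos[OF this m]
    have "(f k has_integral Tint (a + of_nat (Suc k)) / of_real m) {0<..}"
      by (simp add: f_def[abs_def] m_def del: of_nat_Suc)
    then show ?thesis by (simp add: integral_unique m_def mult.commute del: of_nat_Suc)
  qed
  have le: "norm (f k t) \<le> 1 / (1 + t\<^sup>2)" for k t
  proof -
    define x where "x = (t / sqrt (real (Suc k)))\<^sup>2"
    have x: "x \<ge> 0" "real (Suc k) * x = t\<^sup>2" by (auto simp: x_def power_divide simp del: of_nat_Suc)
    have "norm (f k t) = (1 + x) powr (- (Re a + real (Suc k)))"
      unfolding f_def norm_Tint_integrand x_def by simp
    also have "\<dots> \<le> (1 + x) powr (- real (Suc k))" using a x by (intro powr_mono) auto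
    also have "\<dots> = 1 / (1 + x) ^ Suc k" using x by (simp add: powr_minus powr_realpow inverse_eq_divide del: of_nat_Suc power_Suc)
    also have "\<dots> \<le> 1 / (1 + t\<^sup>2)"
    proof (rule divide_left_mono)
      show "1 + t\<^sup>2 \<le> (1 + x) ^ Suc k" using Bernoulli_inequality[of x "Suc k"] x by simp
      show "0 < (1 + x) ^ Suc k * (1 + t\<^sup>2)" using x one_plus_square_pos[of t] by (intro mult_pos_pos zero_less_power) auto
    qed simp
    finally show ?thesis .
  qed
  show ?thesis unfolding eq
  proof (rule dominated_convergence(2)[OF _ integrable_inverse_one_plus_square])
    have cont: "continuous_on {0<..} (f k)" for k
    proof -
      have "continuous_on {0<..} (\<lambda>t. t / sqrt (real (Suc k)))" by (intro continuous_intros) auto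
      from continuous_on_compose2[OF continuous_Tint_integrand this, of UNIV] show ?thesis by (simp add: f_def[abs_def])
    qed
    show "f k integrable_on {0<..}" for k
      by (rule integrable_on_continuous_dominated[OF cont _ integrable_inverse_one_plus_square le]) auto
    fix t :: real assume t: "t \<in> {0<..}"
    show "(\<lambda>k. f k t) \<longlonglongrightarrow> of_real (exp (- t\<^sup>2))"
    proof -
      define g where "g k = 1 + (t / sqrt (real (Suc k)))\<^sup>2" for k
      have g: "g k = 1 + t\<^sup>2 / real (Suc k)" "g k > 0" for k
      proof -
        show "g k = 1 + t\<^sup>2 / real (Suc k)" by (simp add: g_def power_divide)
        show "g k > 0" unfolding g_def by (rule one_plus_square_pos)
      qed
      have fk: "f k t = of_real (g k) powr (- a) * of_real (inverse (g k ^ Suc k))" for k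
      proof -
        have "f k t = of_real (g k) powr (- a - of_nat (Suc k))" by (simp add: f_def g_def del: of_nat_Suc)
        also have "\<dots> = of_real (g k) powr (- a) / of_real (g k) powr (of_nat (Suc k))" by (rule powr_diff)
        also have "of_real (g k) powr (of_nat (Suc k)) = complex_of_real (g k) ^ Suc k"
          using g(2)[of k] by (intro powr_nat') auto
        finally show ?thesis by (simp add: divide_inverse del: power_Suc of_nat_Suc)
      qed
      have g1: "g \<longlonglongrightarrow> 1"
      proof -
        have "(\<lambda>k. 1 + t\<^sup>2 * (1 / real (Suc k))) \<longlonglongrightarrow> 1 + t\<^sup>2 * 0"
          by (intro tendsto_intros LIMSEQ_Suc[OF lim_1_over_n])
        then show ?thesis unfolding g(1)[abs_def] by simp
      qed
      have "(\<lambda>k. complex_of_real (g k) powr (- a)) \<longlonglongrightarrow> of_real 1 powr (- a)"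
        by (intro tendsto_powr_complex tendsto_intros g1) auto
      moreover have "(\<lambda>k. g k ^ Suc k) \<longlonglongrightarrow> exp (t\<^sup>2)"
        unfolding g(1) using LIMSEQ_Suc[OF tendsto_exp_limit_sequentially[of "t\<^sup>2"]] .
      then have "(\<lambda>k. complex_of_real (inverse (g k ^ Suc k))) \<longlonglongrightarrow> of_real (inverse (exp (t\<^sup>2)))"
        by (intro tendsto_of_real tendsto_inverse) auto
      ultimately have "(\<lambda>k. f k t) \<longlonglongrightarrow> of_real 1 powr (- a) * of_real (inverse (exp (t\<^sup>2)))"
        unfolding fk by (rule tendsto_mult)
      then show ?thesis by (simp add: exp_minus)
    qed
  qed (rule le)
qed

text \<open>Iterating the recurrence moves \<open>Tint\<close> to a large parameter and produces two
  Pochhammer symbols; with their normalizations these are the partial products for the reciprocal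
  Gamma function at \<open>a - 1/2\<close> and \<open>a\<close>.\<close>

lemma Tint_Gamma_ratio:
  assumes a: "Re a \<ge> 1"
  shows "rGamma (a - 1/2) * Tint a = rGamma a * integral {0<..} (\<lambda>t. of_real (exp (- t\<^sup>2)))"
proof -
  let ?G = "integral {0<..} (\<lambda>t. of_real (exp (- t\<^sup>2))) :: complex"
  have "(\<lambda>k. rGamma_series (a - 1/2) (Suc k) * Tint a) \<longlonglongrightarrow> rGamma (a - 1/2) * Tint a"
    by (intro tendsto_intros LIMSEQ_Suc[OF rGamma_series_LIMSEQ])
  moreover have "(\<lambda>k. rGamma_series (a - 1/2) (Suc k) * Tint a) \<longlonglongrightarrow> rGamma a * ?G"
  proof -
    have "rGamma_series (a - 1/2) (Suc k) * Tint a
        = rGamma_series a (Suc k) * (of_real (sqrt (real (Suc k)) / sqrt (real (Suc (Suc k)))) * (of_real (sqrt (real (Suc (Suc k)))) * Tint (a + of_nat (Suc (Suc k)))))" for k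
    proof -
      define N where "N = Suc k"
      have N: "real N > 0" by (simp add: N_def)
      \<comment> \<open>The shift of the parameter by \<open>1/2\<close> changes the normalizing
        power of \<open>N\<close> by exactly the root that the asymptotics of \<open>Tint\<close>
        require.\<close>
      have e: "exp ((a - 1/2) * of_real (ln (real N))) * of_real (sqrt (real N)) = exp (a * of_real (ln (real N)))"
      proof -
        have "sqrt (real N) = exp (ln (real N) / 2)"
          using N by (simp add: ln_sqrt[symmetric])
        then have "complex_of_real (sqrt (real N)) = exp (of_real (ln (real N) / 2))" by (simp only: exp_of_real)
        then show ?thesis by (simp add: algebra_simps flip: exp_add)
      qed
      have "rGamma_series (a - 1/2) N * Tint a = pochhammer (a - 1/2) (N + 1) * Tint a / (fact N * exp ((a - 1/2) * of_real (ln (real N))))"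
        by (simp add: rGamma_series_def)
      also have "\<dots> = pochhammer a (N + 1) * Tint (a + of_nat (N + 1)) / (fact N * exp ((a - 1/2) * of_real (ln (real N))))"
        unfolding Tint_pochhammer[OF a] ..
      also have "\<dots> = rGamma_series a N * (of_real (sqrt (real N)) * Tint (a + of_nat (N + 1)))"
        unfolding rGamma_series_def e[symmetric] using N by (simp add: field_simps)
      finally have "rGamma_series (a - 1/2) N * Tint a = rGamma_series a N * (of_real (sqrt (real N)) * Tint (a + of_nat (Suc N)))"
        by simp
      \<comment> \<open>The partial product of index \<open>N\<close> has \<open>N + 1\<close>
        factors, so the parameter has moved by \<open>N + 1\<close> while the root is that of
        \<open>N\<close>; the quotient of the two roots tends to 1.\<close>
      also have "of_real (sqrt (real N)) * Tint (a + of_nat (Suc N))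
          = of_real (sqrt (real N) / sqrt (real (Suc N))) * (of_real (sqrt (real (Suc N))) * Tint (a + of_nat (Suc N)))"
        by (simp del: of_nat_Suc)
      finally show ?thesis unfolding N_def .
    qed
    moreover have "(\<lambda>k. rGamma_series a (Suc k) * (of_real (sqrt (real (Suc k)) / sqrt (real (Suc (Suc k)))) * (of_real (sqrt (real (Suc (Suc k)))) * Tint (a + of_nat (Suc (Suc k))))))
        \<longlonglongrightarrow> rGamma a * (of_real 1 * ?G)"
    proof (intro tendsto_mult LIMSEQ_Suc[OF rGamma_series_LIMSEQ] tendsto_of_real)
      show "(\<lambda>k. sqrt (real (Suc k)) / sqrt (real (Suc (Suc k)))) \<longlonglongrightarrow> 1" by real_asymp
      show "(\<lambda>k. of_real (sqrt (real (Suc (Suc k)))) * Tint (a + of_nat (Suc (Suc k)))) \<longlonglongrightarrow> ?G"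
        by (rule LIMSEQ_Suc[OF Tint_asymp[OF a]])
    qed
    ultimately show ?thesis by simp
  qed
  ultimately show ?thesis by (rule LIMSEQ_unique)
qed

lemma Tint_1: "Tint 1 = of_real pi / 2"
proof -
  have "integral {0<..} (\<lambda>q. complex_of_real (1 + q\<^sup>2) powr (- 1)) = of_real (pi / 2) - of_real 0"
  proof (rule integral_FTC_pos[OF continuous_Tint_integrand integrable_inverse_one_plus_square, where F = "\<lambda>q. of_real (arctan q)"])
    fix q :: real
    show "norm (complex_of_real (1 + q\<^sup>2) powr (- 1)) \<le> 1 / (1 + q\<^sup>2)"
        unfolding norm_Tint_integrand by (rule one_plus_square_powr_le) simp
    have "((\<lambda>q. complex_of_real (arctan q)) has_vector_derivative of_real (inverse (1 + q\<^sup>2))) (at q)"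
      by (rule has_vector_derivative_of_real[OF DERIV_arctan])
    then show "((\<lambda>q. complex_of_real (arctan q)) has_vector_derivative complex_of_real (1 + q\<^sup>2) powr (- 1)) (at q)"
      using one_plus_square_pos[of q] by (simp add: powr_minus)
  next
    have "isCont arctan 0" by (rule isCont_arctan)
    from isCont_tendsto_compose[OF this LIMSEQ_Suc[OF lim_1_over_n]]
    show "(\<lambda>n. complex_of_real (arctan (1 / real (Suc n)))) \<longlonglongrightarrow> of_real 0" by (intro tendsto_of_real) simp
    show "(\<lambda>n. complex_of_real (arctan (real (Suc n)))) \<longlonglongrightarrow> of_real (pi / 2)"
      by (intro tendsto_of_real filterlim_compose[OF tendsto_arctan_at_top]
          filterlim_compose[OF filterlim_real_sequentially filterlim_Suc])
  qed
  then show ?thesis by (simp add: Tint_def)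
qed

lemma rGamma_one_half_complex: "rGamma (1/2 :: complex) * of_real (sqrt pi) = 1"
proof -
  have "Gamma (1/2 :: complex) = of_real (sqrt pi)" by (rule Gamma_one_half_complex)
  moreover have "rGamma (1/2 :: complex) = inverse (Gamma (1/2))" by (rule rGamma_inverse_Gamma)
  ultimately show ?thesis by simp
qed

text \<open>The case \<open>a = 1\<close>, where the integral is an arctangent, evaluates the
  unknown Gaussian constant as \<open>sqrt pi / 2\<close>.\<close>

lemma Tint_eq:
  assumes a: "Re a \<ge> 1"
  shows "rGamma (a - 1/2) * Tint a = rGamma a * (of_real (sqrt pi) / 2)"
proof -
  let ?G = "integral {0<..} (\<lambda>t. of_real (exp (- t\<^sup>2))) :: complex"
  have "rGamma (1/2) * (of_real pi / 2) = ?G"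
    using Tint_Gamma_ratio[of 1] unfolding Tint_1 by simp
  moreover have "complex_of_real pi = of_real (sqrt pi) * of_real (sqrt pi)" by (simp flip: of_real_mult)
  ultimately have "?G = (rGamma (1/2) * of_real (sqrt pi)) * (of_real (sqrt pi) / 2)"
    by (metis mult.assoc times_divide_eq_right)
  then have "?G = of_real (sqrt pi) / 2" unfolding rGamma_one_half_complex by (simp only: mult_1_left)
  then show ?thesis using Tint_Gamma_ratio[OF a] by simp
qed

section \<open>Laplace transforms of solutions of the Bessel equation\<close>

lemma Lap_integrand_dominant:
  assumes "pow_bounded w" "Re p > 0"
  obtains g where "g integrable_on {0<..}" "\<And>c. c > 0 \<Longrightarrow> norm (exp (- (p * of_real c)) * w c) \<le> g c"
  using pow_bounded_dominant[OF assms] unfolding norm_Lap_integrand by metis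

text \<open>The function \<open>exp (- p c) * (c v' + p c v + 2 a v)\<close> of \<open>c\<close> is a primitive of
  \<open>exp (- p c) * (p (1 - 2 a) - (p\<^sup>2 + 1) c) * v\<close>.\<close>

lemma Lap_bessel_ode:
  assumes vd: "\<And>c. c > 0 \<Longrightarrow> (v has_vector_derivative v1 c) (at c)"
    and v1d: "\<And>c. c > 0 \<Longrightarrow> (v1 has_vector_derivative - (2 * a + 1) * v1 c / of_real c - v c) (at c)"
    and pb: "pow_bounded v"
    and at0: "(\<lambda>n. of_real (1 / real (Suc n)) * v1 (1 / real (Suc n)) + 2 * a * v (1 / real (Suc n))) \<longlonglongrightarrow> \<beta>"
      "(\<lambda>n. of_real (1 / real (Suc n)) * v (1 / real (Suc n))) \<longlonglongrightarrow> 0"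
    and inf: "\<And>c. c \<ge> 1 \<Longrightarrow> norm (v c) \<le> K * c" "\<And>c. c \<ge> 1 \<Longrightarrow> norm (of_real c * v1 c + 2 * a * v c) \<le> K * c\<^sup>2"
    and p: "Re p > 0"
  shows "(p\<^sup>2 + 1) * Lap (\<lambda>c. of_real c * v c) p = p * (1 - 2 * a) * Lap v p + \<beta>"
proof -
  let ?E = "\<lambda>c. exp (- (p * of_real c)) :: complex"
  have pb1: "pow_bounded (\<lambda>c. of_real c * v c)" using pow_bounded_mult_power[OF pb, of 1] by simp
  obtain g where g: "g integrable_on {0<..}" "\<And>c. c > 0 \<Longrightarrow> norm (?E c * v c) \<le> g c"
    using Lap_integrand_dominant[OF pb p] by blast
  obtain g1 where g1: "g1 integrable_on {0<..}" "\<And>c. c > 0 \<Longrightarrow> norm (?E c * (of_real c * v c)) \<le> g1 c"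
    using Lap_integrand_dominant[OF pb1 p] by blast
  have vc: "continuous_on {0<..} v" using pb by (simp add: pow_bounded_def)
  define F where "F c = ?E c * (of_real c * v1 c + p * (of_real c * v c) + 2 * a * v c)" for c
  have "integral {0<..} (\<lambda>c. - (p\<^sup>2 + 1) * (?E c * (of_real c * v c)) + p * (1 - 2 * a) * (?E c * v c)) = 0 - \<beta>"
  proof (rule integral_FTC_pos[where F = F])
    show "continuous_on {0<..} (\<lambda>c. - (p\<^sup>2 + 1) * (?E c * (of_real c * v c)) + p * (1 - 2 * a) * (?E c * v c))"
      by (intro continuous_intros vc)
    show "(\<lambda>c. norm (p\<^sup>2 + 1) * g1 c + norm (p * (1 - 2 * a)) * g c) integrable_on {0<..}"
      by (intro integrable_add integrable_on_mult_right g g1)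
    fix c :: real assume c: "c > 0"
    have "norm (- (p\<^sup>2 + 1) * (?E c * (of_real c * v c)) + p * (1 - 2 * a) * (?E c * v c))
       \<le> norm (p\<^sup>2 + 1) * norm (?E c * (of_real c * v c)) + norm (p * (1 - 2 * a)) * norm (?E c * v c)"
      by (rule order_trans[OF norm_triangle_ineq]) (simp only: norm_mult norm_minus_cancel order_refl)
    also have "\<dots> \<le> norm (p\<^sup>2 + 1) * g1 c + norm (p * (1 - 2 * a)) * g c"
      by (intro add_mono mult_left_mono g(2) g1(2) c) auto
    finally show "norm (- (p\<^sup>2 + 1) * (?E c * (of_real c * v c)) + p * (1 - 2 * a) * (?E c * v c)) \<le> norm (p\<^sup>2 + 1) * g1 c + norm (p * (1 - 2 * a)) * g c" .
    have Ed: "(?E has_vector_derivative - p * ?E c) (at c)"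
      by (rule has_vector_derivative_real_field) (auto intro!: derivative_eq_intros)
    have cd: "(complex_of_real has_vector_derivative 1) (at c)"
      by (auto intro!: derivative_eq_intros)
    have "(F has_vector_derivative ?E c * ((of_real c * (- (2 * a + 1) * v1 c / of_real c - v c) + 1 * v1 c)
        + p * (of_real c * v1 c + 1 * v c) + 2 * a * v1 c)
        + - p * ?E c * (of_real c * v1 c + p * (of_real c * v c) + 2 * a * v c)) (at c)"
      unfolding F_def[abs_def]
      by (intro has_vector_derivative_mult has_vector_derivative_add has_vector_derivative_mult_right Ed cd vd v1d c)
    also have "?E c * ((of_real c * (- (2 * a + 1) * v1 c / of_real c - v c) + 1 * v1 c)
        + p * (of_real c * v1 c + 1 * v c) + 2 * a * v1 c)
        + - p * ?E c * (of_real c * v1 c + p * (of_real c * v c) + 2 * a * v c)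
       = - (p\<^sup>2 + 1) * (?E c * (of_real c * v c)) + p * (1 - 2 * a) * (?E c * v c)"
    proof -
      have e: "of_real c * (- (2 * a + 1) * v1 c / of_real c - v c) = - (2 * a + 1) * v1 c - of_real c * v c"
        using c by (simp add: right_diff_distrib)
      show ?thesis unfolding e by (simp add: algebra_simps power2_eq_square)
    qed
    finally show "(F has_vector_derivative - (p\<^sup>2 + 1) * (?E c * (of_real c * v c)) + p * (1 - 2 * a) * (?E c * v c)) (at c)" .
  next
    have "(\<lambda>n. ?E (1 / real (Suc n))) \<longlonglongrightarrow> exp (- (p * of_real 0))"
      by (intro tendsto_intros LIMSEQ_Suc[OF lim_1_over_n])
    from tendsto_mult[OF this tendsto_add[OF at0(1) tendsto_mult_left[OF at0(2), of p]]]
    show "(\<lambda>n. F (1 / real (Suc n))) \<longlonglongrightarrow> \<beta>"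
      unfolding F_def by (simp add: add_ac)
    have K: "K \<ge> 0" using order_trans[OF norm_ge_zero inf(1)[of 1]] by simp
    show "(\<lambda>n. F (real (Suc n))) \<longlonglongrightarrow> 0"
    proof (rule Lim_null_comparison)
      show "\<forall>\<^sub>F n in sequentially. norm (F (real (Suc n))) \<le> exp (- (Re p * real (Suc n))) * (K * (real (Suc n))\<^sup>2 * (1 + norm p))"
      proof (rule always_eventually, rule allI)
        fix n
        define c where "c = real (Suc n)"
        have c: "c \<ge> 1" by (simp add: c_def)
        have "norm (of_real c * v1 c + p * (of_real c * v c) + 2 * a * v c)
           \<le> norm (of_real c * v1 c + 2 * a * v c) + norm (p * (of_real c * v c))"
          using norm_triangle_ineq[of "of_real c * v1 c + 2 * a * v c" "p * (of_real c * v c)"] by (simp add: add_ac)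
        also have "\<dots> \<le> K * c\<^sup>2 + norm p * (c * (K * c))"
          unfolding norm_mult using c by (intro add_mono inf mult_mono) (auto simp: inf)
        finally have "norm (of_real c * v1 c + p * (of_real c * v c) + 2 * a * v c) \<le> K * c\<^sup>2 * (1 + norm p)"
          by (simp add: algebra_simps power2_eq_square)
        then show "norm (F (real (Suc n))) \<le> exp (- (Re p * real (Suc n))) * (K * (real (Suc n))\<^sup>2 * (1 + norm p))"
          unfolding F_def c_def[symmetric] norm_mult by (intro mult_mono) auto
      qed
      show "(\<lambda>n. exp (- (Re p * real (Suc n))) * (K * (real (Suc n))\<^sup>2 * (1 + norm p))) \<longlonglongrightarrow> 0"
      proof -
        define q where "q = Re p"
        define M where "M = K * (1 + norm p)"
        have "q > 0" using p by (simp add: q_def)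
        then have "(\<lambda>n. M * (exp (- (q * real (Suc n))) * (real (Suc n))\<^sup>2)) \<longlonglongrightarrow> M * 0"
          by (intro tendsto_mult_left) real_asymp
        then show ?thesis by (simp add: q_def M_def mult_ac)
      qed
    qed
  qed
  moreover have "integral {0<..} (\<lambda>c. - (p\<^sup>2 + 1) * (?E c * (of_real c * v c)) + p * (1 - 2 * a) * (?E c * v c))
      = - (p\<^sup>2 + 1) * Lap (\<lambda>c. of_real c * v c) p + p * (1 - 2 * a) * Lap v p"
    unfolding Lap_def using Lap_integrable[OF pb p] Lap_integrable[OF pb1 p]
    by (subst integral_add) (auto intro: integrable_on_mult_right)
  ultimately have "- (p\<^sup>2 + 1) * Lap (\<lambda>c. of_real c * v c) p + p * (1 - 2 * a) * Lap v p = - \<beta>" by simp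
  then show ?thesis by (simp add: algebra_simps)
qed

text \<open>The set contains the half-plane of convergence and a neighbourhood of 0, and avoids the branch
  cuts of \<open>(p\<^sup>2 + 1) powr b\<close>, which start at the two imaginary units.\<close>

definition Dom :: "complex set" where "Dom = {p. Re p > 0} \<union> ball 0 1"

lemma open_Dom: "open Dom"
  unfolding Dom_def by (intro open_Un open_Re_pos) auto

text \<open>If \<open>p^2 + 1\<close> is real and nonpositive, then \<open>p\<close> is purely
  imaginary of modulus at least 1, and \<open>Dom\<close> contains no such point.\<close>

lemma square_plus_one_notin:
  assumes "p \<in> Dom"
  shows "p\<^sup>2 + 1 \<notin> \<real>\<^sub>\<le>\<^sub>0"
proof
  assume "p\<^sup>2 + 1 \<in> \<real>\<^sub>\<le>\<^sub>0"
  then have "Re (p\<^sup>2) + 1 \<le> 0" "Im (p\<^sup>2) = 0" by (auto simp: complex_nonpos_Reals_iff)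
  then have *: "(Re p)\<^sup>2 - (Im p)\<^sup>2 + 1 \<le> 0" "Re p * Im p = 0"
    by (auto simp: power2_eq_square)
  show False
  proof (cases "Re p = 0")
    case True
    then have "(norm p)\<^sup>2 \<ge> 1" using *(1) by (simp add: cmod_power2)
    moreover have "norm p < 1" using assms True by (auto simp: Dom_def)
    ultimately show False using power_less_one_iff[of "norm p" 2] by simp
  next
    case False
    then have "Im p = 0" using *(2) by simp
    then show False using *(1) zero_le_power2[of "Re p"] by (simp del: zero_le_power2)
  qed
qed

lemma starlike_Dom: "starlike Dom"
  unfolding starlike_def
proof (intro bexI[of _ 0] ballI subsetI)
  show "0 \<in> Dom" by (simp add: Dom_def)
  fix p z assume p: "p \<in> Dom" and z: "z \<in> closed_segment 0 p"
  then obtain t where t: "0 \<le> t" "t \<le> 1" "z = of_real t * p"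
    by (auto simp: closed_segment_def scaleR_conv_of_real)
  show "z \<in> Dom"
  proof (cases "t = 0")
    case False
    then show ?thesis using p t mult_le_cancel_right1[of t "norm p"]
      by (auto simp: Dom_def norm_mult intro: le_less_trans[OF mult_left_le_one_le])
  qed (use t in \<open>auto simp: Dom_def\<close>)
qed

lemma primitive_exists:
  "\<exists>E. E 0 = 0 \<and> (\<forall>p\<in>Dom. (E has_field_derivative (p\<^sup>2 + 1) powr b) (at p))"
proof -
  have h: "(\<lambda>p. (p\<^sup>2 + 1) powr b) holomorphic_on Dom"
    using square_plus_one_notin by (intro holomorphic_intros) auto
  obtain g where g: "\<And>p. p \<in> Dom \<Longrightarrow> (g has_field_derivative (p\<^sup>2 + 1) powr b) (at p)"
    using holomorphic_starlike_primitive[of Dom "\<lambda>p. (p\<^sup>2 + 1) powr b" "{}"]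
      holomorphic_on_imp_continuous_on[OF h] holomorphic_on_imp_differentiable_at[OF h open_Dom] starlike_Dom open_Dom by auto
  have "((\<lambda>p. g p - g 0) has_field_derivative (p\<^sup>2 + 1) powr b) (at p)" if "p \<in> Dom" for p
    using DERIV_diff[OF g[OF that] DERIV_const[of "g 0"]] by simp
  then show ?thesis by (intro exI[of _ "\<lambda>p. g p - g 0"]) auto
qed

text \<open>On \<open>Dom\<close>, the integral of \<open>(q^2 + 1) powr b\<close> from 0 to
  \<open>p\<close>. Being starlike about 0, \<open>Dom\<close> admits the primitive although it is
  not convex; the choice is normalized at 0.\<close>

definition Prim :: "complex \<Rightarrow> complex \<Rightarrow> complex" where
  "Prim b = (SOME E. E 0 = 0 \<and> (\<forall>p\<in>Dom. (E has_field_derivative (p\<^sup>2 + 1) powr b) (at p)))"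

lemma Prim_0 [simp]: "Prim b 0 = 0"
  and DERIV_Prim: "p \<in> Dom \<Longrightarrow> (Prim b has_field_derivative (p\<^sup>2 + 1) powr b) (at p)"
  using someI_ex[OF primitive_exists[of b]] unfolding Prim_def by auto

text \<open>The integrand is even and the normalization is at 0. Only in the unit disc do both
  \<open>p\<close> and \<open>- p\<close> lie in \<open>Dom\<close>.\<close>

lemma Prim_odd:
  assumes "norm p < 1"
  shows "Prim b (- p) = - Prim b p"
proof -
  have "((\<lambda>p. Prim b (- p) + Prim b p) has_field_derivative 0) (at p)" if "p \<in> ball 0 1" for p
  proof -
    have "p \<in> Dom" "- p \<in> Dom" using that by (auto simp: Dom_def)
    from DERIV_add[OF DERIV_chain2[OF DERIV_Prim[OF this(2), of b] DERIV_minus[OF DERIV_ident]] DERIV_Prim[OF this(1), of b]]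
    show ?thesis by simp
  qed
  then obtain k where k: "\<And>p. p \<in> ball 0 1 \<Longrightarrow> Prim b (- p) + Prim b p = k"
    using has_field_derivative_zero_constant[of "ball 0 1" "\<lambda>p. Prim b (- p) + Prim b p"]
    by (auto simp: has_field_derivative_at_within)
  have "k = 0" using k[of 0] by simp
  then show ?thesis using k[of p] assms by (simp add: add_eq_0_iff)
qed

text \<open>The hypothesis is a first-order linear equation, since multiplication by
  \<open>c\<close> is minus the derivative of the transform. Its integrating factor is
  \<open>(p^2 + 1) powr (1/2 - a)\<close>, and the inhomogeneity \<open>\<beta>\<close> produces
  \<open>Prim\<close>. The right-hand side makes sense on all of \<open>Dom\<close>, which is the
  continuation past \<open>Re p = 0\<close>.\<close>

lemma Lap_closed_form:
  assumes pb: "pow_bounded v"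
    and ode: "\<And>p. Re p > 0 \<Longrightarrow> (p\<^sup>2 + 1) * Lap (\<lambda>c. of_real c * v c) p = p * (1 - 2 * a) * Lap v p + \<beta>"
  obtains C where "\<And>p. Re p > 0 \<Longrightarrow> Lap v p = (p\<^sup>2 + 1) powr (a - 1/2) * (C - \<beta> * Prim (- 1/2 - a) p)"
proof -
  define W where "W p = Lap v p * (p\<^sup>2 + 1) powr (1/2 - a) + \<beta> * Prim (- 1/2 - a) p" for p
  have "(W has_field_derivative 0) (at p)" if p: "Re p > 0" for p
  proof -
    have D: "p \<in> Dom" using p by (simp add: Dom_def)
    note nz = square_plus_one_notin[OF D]
    then have nz0: "p\<^sup>2 + 1 \<noteq> 0" by auto
    have pw: "(p\<^sup>2 + 1) powr (1/2 - a) = (p\<^sup>2 + 1) * (p\<^sup>2 + 1) powr (- 1/2 - a)"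
    proof -
      have "(p\<^sup>2 + 1) powr (1/2 - a) = (p\<^sup>2 + 1) powr (1 + (- 1/2 - a))" by simp
      also have "\<dots> = (p\<^sup>2 + 1) powr 1 * (p\<^sup>2 + 1) powr (- 1/2 - a)" by (rule powr_add)
      finally show ?thesis by simp
    qed
    have e: "1/2 - a - 1 = - 1/2 - a" by simp
    have "(W has_field_derivative
       (Lap v p * (2 * (1/2 - a) * p * (p\<^sup>2 + 1) powr (1/2 - a - 1)) + (- Lap (\<lambda>c. of_real c * v c) p) * (p\<^sup>2 + 1) powr (1/2 - a))
       + \<beta> * (p\<^sup>2 + 1) powr (- 1/2 - a)) (at p)"
      unfolding W_def[abs_def]
      by (intro DERIV_add DERIV_mult' DERIV_cmult DERIV_Lap pb p DERIV_one_plus_square_powr nz DERIV_Prim D)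
    also have "(Lap v p * (2 * (1/2 - a) * p * (p\<^sup>2 + 1) powr (1/2 - a - 1)) + (- Lap (\<lambda>c. of_real c * v c) p) * (p\<^sup>2 + 1) powr (1/2 - a))
       + \<beta> * (p\<^sup>2 + 1) powr (- 1/2 - a)
      = (p\<^sup>2 + 1) powr (- 1/2 - a) * (p * (1 - 2 * a) * Lap v p + \<beta> - (p\<^sup>2 + 1) * Lap (\<lambda>c. of_real c * v c) p)"
      unfolding pw e by (simp add: algebra_simps)
    also have "\<dots> = 0" unfolding ode[OF p] by simp
    finally show ?thesis .
  qed
  then obtain C where C: "\<And>p. Re p > 0 \<Longrightarrow> W p = C"
    using has_field_derivative_zero_constant[of "{c. Re c > 0}" W] convex_halfspace_Re_gt[of 0]
    by (auto simp: has_field_derivative_at_within)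
  show ?thesis
  proof (rule that)
    fix p assume p: "Re p > 0"
    have D: "p \<in> Dom" using p by (simp add: Dom_def)
    then have nz0: "p\<^sup>2 + 1 \<noteq> 0" using square_plus_one_notin by fastforce
    have e1: "(p\<^sup>2 + 1) powr (a - 1/2) * (p\<^sup>2 + 1) powr (1/2 - a) = 1" using nz0 by (simp flip: powr_add)
    have e2: "C - \<beta> * Prim (- 1/2 - a) p = Lap v p * (p\<^sup>2 + 1) powr (1/2 - a)"
      using C[OF p] by (simp add: W_def algebra_simps)
    have "Lap v p = ((p\<^sup>2 + 1) powr (a - 1/2) * (p\<^sup>2 + 1) powr (1/2 - a)) * Lap v p" unfolding e1 by simp
    also have "\<dots> = (p\<^sup>2 + 1) powr (a - 1/2) * (C - \<beta> * Prim (- 1/2 - a) p)"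
      unfolding e2 by (simp only: mult_ac)
    finally show "Lap v p = (p\<^sup>2 + 1) powr (a - 1/2) * (C - \<beta> * Prim (- 1/2 - a) p)" .
  qed
qed

text \<open>Adding the reflected function doubles even derivatives at 0 and removes the odd part, of
  which nothing else need be known; what remains is the binomial series in
  \<open>p^2\<close>.\<close>

lemma higher_deriv_even_part:
  assumes h: "f holomorphic_on ball 0 1"
    and even: "\<And>p. norm p < 1 \<Longrightarrow> f p + f (- p) = 2 * C * (p\<^sup>2 + 1) powr b"
  shows "(deriv ^^ (2 * m)) f 0 = C * fact (2 * m) * (b gchoose m)"
proof -
  have b: "0 \<in> ball (0::complex) 1" by simp
  have h': "(\<lambda>p. f (-1 * p)) holomorphic_on ball 0 1"
    by (rule holomorphic_on_compose_gen[OF _ h, unfolded o_def]) (auto intro!: holomorphic_intros)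
  have "(deriv ^^ (2 * m)) (\<lambda>p. f p + f (-1 * p)) 0 = (deriv ^^ (2 * m)) f 0 + (deriv ^^ (2 * m)) (\<lambda>p. f (-1 * p)) 0"
    by (rule higher_deriv_add[OF h h' open_ball b])
  also have "(deriv ^^ (2 * m)) (\<lambda>p. f (-1 * p)) 0 = (-1) ^ (2 * m) * (deriv ^^ (2 * m)) f (-1 * 0)"
    by (rule higher_deriv_compose_linear[OF h open_ball open_ball b]) auto
  finally have 1: "(deriv ^^ (2 * m)) (\<lambda>p. f p + f (-1 * p)) 0 = 2 * (deriv ^^ (2 * m)) f 0" by simp
  have fps: "(\<lambda>p. (1 + p ^ 2) powr b) has_fps_expansion (fps_binomial b oo fps_X ^ 2)"
    using has_fps_expansion_compose[OF has_fps_expansion_binomial_complex[of b] has_fps_expansion_power[OF has_fps_expansion_fps_X, of 2]]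
    by (simp add: o_def)
  have "(\<lambda>p. 2 * C * (1 + p ^ 2) powr b) has_fps_expansion (fps_const (2 * C) * (fps_binomial b oo fps_X ^ 2))"
    by (intro fps_expansion_intros fps)
  from fps_nth_fps_expansion[OF this, of "2 * m"]
  have "(deriv ^^ (2 * m)) (\<lambda>p. 2 * C * (1 + p ^ 2) powr b) 0 = fact (2 * m) * (2 * C * (b gchoose m))"
    by (simp add: fps_nth_compose_X_power fps_binomial_nth field_simps)
  moreover have "(deriv ^^ (2 * m)) (\<lambda>p. f p + f (-1 * p)) 0 = (deriv ^^ (2 * m)) (\<lambda>p. 2 * C * (1 + p ^ 2) powr b) 0"
  proof (rule higher_deriv_cong_ev)
    have "eventually (\<lambda>p. p \<in> ball (0::complex) 1) (nhds 0)" by (rule eventually_nhds_in_open) auto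
    then show "\<forall>\<^sub>F p in nhds 0. f p + f (-1 * p) = 2 * C * (1 + p ^ 2) powr b"
      by eventually_elim (use even in \<open>simp add: add.commute\<close>)
  qed simp
  ultimately show ?thesis using 1 by (simp add: mult_ac)
qed

text \<open>For \<open>c > 0\<close> this is \<open>(c / 2) powr (- n)\<close> times
  \<open>J\<close> of order \<open>n\<close>: the branching power is divided out, leaving an even
  function of \<open>c\<close> that is regular at 0.\<close>

definition uB :: "complex \<Rightarrow> real \<Rightarrow> complex" where
  "uB n c = Phi n (- ((of_real c / 2)\<^sup>2))"

definition uB' :: "complex \<Rightarrow> real \<Rightarrow> complex" where
  "uB' n c = - (of_real c / 2) * Phi (n + 1) (- ((of_real c / 2)\<^sup>2))"

lemma uB_0 [simp]: "uB n 0 = rGamma (n + 1)"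
  by (simp add: uB_def)

lemma DERIV_neg_half_square: "((\<lambda>z. - ((z / 2)\<^sup>2)) has_field_derivative - (z / 2)) (at (z :: complex))"
  by (auto intro!: derivative_eq_intros)

lemma uB_derivative: "(uB n has_vector_derivative uB' n c) (at c)"
proof -
  have "((\<lambda>z. Phi n (- ((z / 2)\<^sup>2))) has_field_derivative Phi (n + 1) (- ((of_real c / 2)\<^sup>2)) * (- (of_real c / 2))) (at (of_real c))"
    by (rule DERIV_chain2[OF DERIV_Phi DERIV_neg_half_square])
  from has_vector_derivative_real_field[OF this] show ?thesis
    unfolding uB_def[abs_def] uB'_def by (simp add: mult.commute)
qed

lemma uB'_derivative:
  assumes c: "c > 0"
  shows "(uB' n has_vector_derivative - (2 * n + 1) * uB' n c / of_real c - uB n c) (at c)"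
proof -
  define z where "z = complex_of_real c"
  have z: "z \<noteq> 0" using c by (simp add: z_def)
  have "((\<lambda>z. - (z / 2) * Phi (n + 1) (- ((z / 2)\<^sup>2))) has_field_derivative
      - (z / 2) * (Phi (n + 1 + 1) (- ((z / 2)\<^sup>2)) * (- (z / 2))) + - (1 / 2) * Phi (n + 1) (- ((z / 2)\<^sup>2))) (at z)"
    by (intro DERIV_mult' DERIV_minus DERIV_cdivide DERIV_ident DERIV_chain2[OF DERIV_Phi DERIV_neg_half_square])
  also have "- (z / 2) * (Phi (n + 1 + 1) (- ((z / 2)\<^sup>2)) * (- (z / 2))) + - (1 / 2) * Phi (n + 1) (- ((z / 2)\<^sup>2))
     = - (2 * n + 1) * (- (z / 2) * Phi (n + 1) (- ((z / 2)\<^sup>2))) / z - Phi n (- ((z / 2)\<^sup>2))"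
  proof -
    have e: "n + 1 + 1 = n + 2" by simp
    show ?thesis unfolding e Phi_contiguous[of n "- ((z / 2)\<^sup>2)"]
      using z by (simp add: field_simps power2_eq_square)
  qed
  finally have "((\<lambda>z. - (z / 2) * Phi (n + 1) (- ((z / 2)\<^sup>2))) has_field_derivative
      - (2 * n + 1) * uB' n c / of_real c - uB n c) (at (of_real c))"
    by (simp only: z_def uB_def uB'_def)
  from has_vector_derivative_real_field[OF this] show ?thesis unfolding uB'_def[abs_def] by simp
qed

lemma continuous_uB: "continuous_on A (uB n)" "continuous_on A (uB' n)"
  unfolding uB_def uB'_def by (intro continuous_intros; simp)+

lemma Bessel_J_uB: "Bessel_J n (of_real c) = of_real (c / 2) powr n * uB n c"
  by (simp add: Bessel_J_Phi uB_def)

lemma Bessel_J'_uB: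
  assumes c: "c > 0"
  shows "Bessel_J' n (of_real c) = n / of_real c * Bessel_J n (of_real c) + of_real (c / 2) powr n * uB' n c"
proof -
  have "complex_of_real (c / 2) powr (n + 1) = of_real (c / 2) powr n * of_real (c / 2)"
    using c by (simp add: powr_add)
  then show ?thesis unfolding Bessel_J'_def Bessel_J_Phi[of "n + 1"] uB'_def by simp
qed

text \<open>The power \<open>(c / 2) powr (- n)\<close> grows at most like \<open>sqrt c\<close>
  because \<open>\<bar>Re n\<bar> \<le> 1/2\<close>, and the decay \<open>1 / sqrt c\<close> of
  \<open>J\<close> and its derivative compensates exactly that. Compactness covers
  \<open>[0, 1]\<close>.\<close>

lemma uB_bounded:
  assumes n: "norm n < 1/2"
  obtains U where "U \<ge> 0" "\<And>c. c \<ge> 0 \<Longrightarrow> norm (uB n c) \<le> U" "\<And>c. c \<ge> 0 \<Longrightarrow> norm (uB' n c) \<le> U"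
proof -
  obtain B where B: "B \<ge> 0" "\<And>n t. norm n \<le> 1 \<Longrightarrow> t \<ge> 1 \<Longrightarrow>
     norm (Bessel_J n (of_real t)) \<le> B / sqrt t \<and> norm (Bessel_J' n (of_real t)) \<le> B / sqrt t"
    using Bessel_J_decay by blast
  have "bounded (uB n ` {0..1})" "bounded (uB' n ` {0..1})"
    by (intro compact_imp_bounded compact_continuous_image continuous_uB compact_Icc)+
  then obtain M1 M2 where M: "\<And>c. c \<in> {0..1} \<Longrightarrow> norm (uB n c) \<le> M1" "\<And>c. c \<in> {0..1} \<Longrightarrow> norm (uB' n c) \<le> M2"
    unfolding bounded_iff by blast
  have abs_Re_less_half: "\<bar>Re (- n)\<bar> \<le> 1/2" using n abs_Re_le_cmod[of n] by simp
  have large: "norm (uB n c) \<le> 3 * B \<and> norm (uB' n c) \<le> 6 * B" if c: "c \<ge> 1" for c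
  proof -
    have c0: "c > 0" using c by simp
    have inv: "of_real (c / 2) powr (- n) * complex_of_real (c / 2) powr n = 1"
      using c0 by (simp flip: powr_add)
    have pw: "norm (complex_of_real (c / 2) powr (- n)) \<le> 3 * sqrt c"
    proof -
      have "norm (complex_of_real (c / 2) powr (- n)) \<le> (c / 2) powr (1/2) + (c / 2) powr (- (1/2))"
        by (rule norm_powr_le) (use c0 abs_Re_less_half in auto)
      also have "(c / 2) powr (1/2) = sqrt (c / 2)" using c0 by (simp add: powr_half_sqrt)
      also have "(c / 2) powr (- (1/2)) = sqrt (2 / c)"
        using c0 by (simp add: powr_minus powr_half_sqrt real_sqrt_inverse[symmetric])
      also have "sqrt (c / 2) + sqrt (2 / c) \<le> sqrt c + sqrt (4 * c)"
      proof (intro add_mono real_sqrt_le_mono)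
        have "2 \<le> 4 * c * c" using mult_mono[OF c c] c by simp
        then show "2 / c \<le> 4 * c" using c0 by (simp add: field_simps)
      qed (use c in simp)
      also have "\<dots> = 3 * sqrt c" by (simp add: real_sqrt_mult)
      finally show ?thesis .
    qed
    have J: "norm (Bessel_J n (of_real c)) \<le> B / sqrt c" "norm (Bessel_J' n (of_real c)) \<le> B / sqrt c"
      using B(2)[of n c] n c by auto
    have "uB n c = of_real (c / 2) powr (- n) * Bessel_J n (of_real c)"
      unfolding Bessel_J_uB mult.assoc[symmetric] inv by simp
    then have "norm (uB n c) \<le> 3 * sqrt c * (B / sqrt c)"
      using pw J(1) B(1) c0 by (simp only: norm_mult) (intro mult_mono; simp)
    moreover have "uB' n c = of_real (c / 2) powr (- n) * (Bessel_J' n (of_real c) - n / of_real c * Bessel_J n (of_real c))"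
      unfolding Bessel_J'_uB[OF c0] using inv by (simp add: mult.assoc[symmetric])
    moreover have "norm (Bessel_J' n (of_real c) - n / of_real c * Bessel_J n (of_real c)) \<le> B / sqrt c + 1 * (B / sqrt c)"
    proof (rule order_trans[OF norm_triangle_ineq4 add_mono])
      have "norm (n / of_real c) \<le> 1" using n c by (simp add: norm_divide divide_le_eq)
      then show "norm (n / of_real c * Bessel_J n (of_real c)) \<le> 1 * (B / sqrt c)"
        unfolding norm_mult using J(1) by (intro mult_mono) auto
    qed (rule J)
    ultimately have "norm (uB n c) \<le> 3 * sqrt c * (B / sqrt c)" "norm (uB' n c) \<le> 3 * sqrt c * (B / sqrt c + 1 * (B / sqrt c))"
      using pw c0 by (simp_all only: norm_mult) (intro mult_mono; simp)
    then show ?thesis using c0 by simp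
  qed
  define U where "U = max M1 M2 + 6 * B"
  have M0: "M1 \<ge> 0" "M2 \<ge> 0" using M[of 0] order_trans[OF norm_ge_zero] by auto
  show ?thesis
  proof (rule that[of U])
    show "U \<ge> 0" using M0 B by (simp add: U_def)
    fix c :: real assume c: "c \<ge> 0"
    show "norm (uB n c) \<le> U" "norm (uB' n c) \<le> U"
      using M[of c] large[of c] c M0 B(1) unfolding U_def by (cases "c \<le> 1"; auto)+
  qed
qed

lemma powr_derivative_real:
  assumes "c > 0"
  shows "((\<lambda>c. complex_of_real c powr a) has_vector_derivative a * of_real c powr (a - 1)) (at c)"
  by (rule has_vector_derivative_real_field[OF has_field_derivative_powr[OF of_real_pos_notin_nonpos[OF assms]]])

text \<open>Constancy is obtained on the half-plane and on the disc, which are convex, and the two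
  constants are compared at the common point \<open>1/2\<close>.\<close>

lemma zero_derivative_Dom:
  assumes "\<And>p. p \<in> Dom \<Longrightarrow> (Z has_field_derivative 0) (at p)" "Re p > 0"
  shows "Z p = Z (0 :: complex)"
proof -
  obtain k where k: "\<And>p. Re p > 0 \<Longrightarrow> Z p = k"
    using has_field_derivative_zero_constant[of "{c. Re c > 0}" Z] convex_halfspace_Re_gt[of 0] assms(1)
    by (auto simp: has_field_derivative_at_within Dom_def)
  obtain l where l: "\<And>p. p \<in> ball 0 1 \<Longrightarrow> Z p = l"
    using has_field_derivative_zero_constant[of "ball 0 1" Z] assms(1)
    by (auto simp: has_field_derivative_at_within Dom_def)
  show ?thesis using k[of "1/2"] l[of "1/2"] k[OF assms(2)] l[of 0] by simp
qed

context
  fixes n :: complex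
  assumes n: "norm n < 1/2"
begin

lemma abs_Re_less_half: "\<bar>Re n\<bar> < 1/2" using n abs_Re_le_cmod[of n] by linarith

lemma pow_bounded_uB: "pow_bounded (uB n)"
proof (rule uB_bounded[OF n])
  fix U assume U: "U \<ge> 0" "\<And>c. c \<ge> 0 \<Longrightarrow> norm (uB n c) \<le> U"
  show ?thesis
  proof (rule pow_boundedI[OF continuous_uB(1), where \<sigma> = 0 and \<tau> = 0 and B = U])
    show "norm (uB n c) \<le> U * (c powr 0 + c powr 0)" if "c > 0" for c
      using U(2)[of c] U(1) that by simp
  qed auto
qed

text \<open>Up to the constant \<open>2 powr n\<close> this is \<open>c powr n\<close> times
  \<open>J\<close> of order \<open>n\<close>; it satisfies the equation of \<open>uB\<close> with
  \<open>- n\<close> in place of \<open>n\<close>.\<close>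

definition uM :: "real \<Rightarrow> complex" where "uM c = of_real c powr (2 * n) * uB n c"

definition uM' :: "real \<Rightarrow> complex" where
  "uM' c = 2 * n * of_real c powr (2 * n - 1) * uB n c + of_real c powr (2 * n) * uB' n c"

lemma pow_bounded_uM: "pow_bounded uM"
proof (rule uB_bounded[OF n])
  fix U assume U: "U \<ge> 0" "\<And>c. c \<ge> 0 \<Longrightarrow> norm (uB n c) \<le> U"
  show ?thesis
  proof (rule pow_boundedI[of _ "2 * Re n" "2 * Re n" U])
    show "continuous_on {0<..} uM" unfolding uM_def
      by (intro continuous_intros continuous_uB) (auto simp: complex_nonpos_Reals_iff)
    show "norm (uM c) \<le> U * (c powr (2 * Re n) + c powr (2 * Re n))" if "c > 0" for c
    proof -
      have "norm (uM c) \<le> c powr (2 * Re n) * U"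
        unfolding uM_def norm_mult using U(2)[of c] that by (subst norm_powr_real_powr) (auto intro!: mult_left_mono)
      also have "\<dots> \<le> U * (c powr (2 * Re n) + c powr (2 * Re n))" using U(1) by (simp add: algebra_simps)
      finally show ?thesis .
    qed
  qed (use abs_Re_less_half in auto)
qed

lemma Lap_uB_ode:
  assumes p: "Re p > 0"
  shows "(p\<^sup>2 + 1) * Lap (\<lambda>c. of_real c * uB n c) p = p * (1 - 2 * n) * Lap (uB n) p + 2 * n * rGamma (n + 1)"
proof (rule uB_bounded[OF n])
  fix U assume U: "U \<ge> 0" "\<And>c. c \<ge> 0 \<Longrightarrow> norm (uB n c) \<le> U" "\<And>c. c \<ge> 0 \<Longrightarrow> norm (uB' n c) \<le> U"
  have seq: "(\<lambda>k. f (1 / real (Suc k))) \<longlonglongrightarrow> f 0" if "continuous_on UNIV f" for f :: "real \<Rightarrow> complex"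
    using that isCont_tendsto_compose[OF _ LIMSEQ_Suc[OF lim_1_over_n], of f] by (simp add: continuous_on_eq_continuous_at)
  show ?thesis
  proof (rule Lap_bessel_ode[OF uB_derivative uB'_derivative pow_bounded_uB _ _ _ _ p, where K = "2 * U"])
    show "(\<lambda>k. of_real (1 / real (Suc k)) * uB' n (1 / real (Suc k)) + 2 * n * uB n (1 / real (Suc k))) \<longlonglongrightarrow> 2 * n * rGamma (n + 1)"
    proof -
      have "continuous_on UNIV (\<lambda>c. of_real c * uB' n c + 2 * n * uB n c)"
        by (intro continuous_intros continuous_uB)
      from seq[OF this] show ?thesis by simp
    qed
    show "(\<lambda>k. of_real (1 / real (Suc k)) * uB n (1 / real (Suc k))) \<longlonglongrightarrow> 0"
    proof -
      have "continuous_on UNIV (\<lambda>c. of_real c * uB n c)"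
        by (intro continuous_intros continuous_uB)
      from seq[OF this] show ?thesis by simp
    qed
    fix c :: real assume c: "c \<ge> 1"
    have "norm (uB n c) \<le> U * 1" using U(2)[of c] c by simp
    also have "\<dots> \<le> 2 * U * c" using U(1) c by (intro mult_mono) auto
    finally show "norm (uB n c) \<le> 2 * U * c" .
    have cc: "c \<le> c\<^sup>2" "1 \<le> c\<^sup>2" using c mult_left_mono[OF c, of c] mult_mono[OF c c] by (auto simp: power2_eq_square)
    have "norm (of_real c * uB' n c + 2 * n * uB n c) \<le> c * U + 1 * U"
    proof (rule order_trans[OF norm_triangle_ineq add_mono])
      show "norm (of_real c * uB' n c) \<le> c * U" using U(3)[of c] c by (simp add: norm_mult)
      have "norm (2 * n) \<le> 1" using n by (simp add: norm_mult)
      then show "norm (2 * n * uB n c) \<le> 1 * U"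
        unfolding norm_mult[of "2 * n"] using U(2)[of c] c by (intro mult_mono) auto
    qed
    also have "\<dots> \<le> c\<^sup>2 * U + c\<^sup>2 * U" using cc U(1) by (intro add_mono mult_right_mono) auto
    finally show "norm (of_real c * uB' n c + 2 * n * uB n c) \<le> 2 * U * c\<^sup>2" by simp
  qed
qed

text \<open>Here the boundary term at 0 vanishes, so no primitive occurs. The unsimplified
  \<open>- n\<close> and \<open>+ 0\<close> match the pattern of \<open>Lap_closed_form\<close> with
  parameter \<open>- n\<close> and inhomogeneity 0.\<close>

lemma Lap_uM_ode:
  assumes p: "Re p > 0"
  shows "(p\<^sup>2 + 1) * Lap (\<lambda>c. of_real c * uM c) p = p * (1 - 2 * (- n)) * Lap uM p + 0"
proof (rule uB_bounded[OF n])
  fix U assume U: "U \<ge> 0" "\<And>c. c \<ge> 0 \<Longrightarrow> norm (uB n c) \<le> U" "\<And>c. c \<ge> 0 \<Longrightarrow> norm (uB' n c) \<le> U"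
  have cp: "complex_of_real c powr (2 * n - 1) = of_real c powr (2 * n) / of_real c" if "c > 0" for c :: real
    using that by (simp add: powr_diff)
  \<comment> \<open>The terms with the bare power \<open>c powr (2 * n)\<close>, which need not tend
    to 0, cancel; the remainder carries an extra factor \<open>c\<close>.\<close>
  have e: "of_real c * uM' c + 2 * (- n) * uM c = of_real c * (of_real c powr (2 * n) * uB' n c)" if "c > 0" for c
    using that unfolding uM'_def uM_def cp[OF that] by (simp add: field_simps)
  have small: "(\<lambda>k. of_real (1 / real (Suc k)) * (of_real (1 / real (Suc k)) powr (2 * n) * f (1 / real (Suc k)))) \<longlonglongrightarrow> 0"
    if f: "\<And>c. c \<ge> 0 \<Longrightarrow> norm (f c) \<le> U" for f :: "real \<Rightarrow> complex"
  proof (rule Lim_null_comparison)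
    define q where "q = Re n"
    show "\<forall>\<^sub>F k in sequentially. norm (of_real (1 / real (Suc k)) * (of_real (1 / real (Suc k)) powr (2 * n) * f (1 / real (Suc k))))
        \<le> 1 / real (Suc k) * ((1 / real (Suc k)) powr (2 * q) * U)"
    proof (rule always_eventually, rule allI)
      fix k
      define c where "c = 1 / real (Suc k)"
      have c: "c > 0" by (simp add: c_def)
      have "norm (of_real c * (of_real c powr (2 * n) * f c)) = c * (c powr (2 * q) * norm (f c))"
        using c unfolding norm_mult by (subst norm_powr_real_powr) (auto simp: q_def)
      also have "\<dots> \<le> c * (c powr (2 * q) * U)" using c f[of c] by (intro mult_left_mono) auto
      finally show "norm (of_real (1 / real (Suc k)) * (of_real (1 / real (Suc k)) powr (2 * n) * f (1 / real (Suc k))))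
        \<le> 1 / real (Suc k) * ((1 / real (Suc k)) powr (2 * q) * U)" by (simp only: c_def)
    qed
    have q: "2 * q > -1" using abs_Re_less_half by (simp add: q_def)
    define s where "s = 2 * q + 1"
    have "(\<lambda>k. U * (1 / real (Suc k)) powr s) \<longlonglongrightarrow> U * 0"
      using q by (intro tendsto_mult_left) (simp add: s_def, real_asymp)
    moreover have "1 / real (Suc k) * ((1 / real (Suc k)) powr (2 * q) * U) = U * (1 / real (Suc k)) powr s" for k
      by (simp add: s_def powr_add del: of_nat_Suc)
    ultimately show "(\<lambda>k. 1 / real (Suc k) * ((1 / real (Suc k)) powr (2 * q) * U)) \<longlonglongrightarrow> 0" by simp
  qed
  have large: "norm (complex_of_real c powr (2 * n)) \<le> c" if "c \<ge> 1" for c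
  proof -
    have "norm (complex_of_real c powr (2 * n)) = c powr (2 * Re n)" using that by (subst norm_powr_real_powr) auto
    also have "\<dots> \<le> c powr 1" using that abs_Re_less_half by (intro powr_mono) auto
    finally show ?thesis using that by simp
  qed
  show ?thesis
  proof (rule Lap_bessel_ode[of uM uM', OF _ _ pow_bounded_uM _ _ _ _ p, where K = U])
    fix c :: real assume c: "c > 0"
    show "(uM has_vector_derivative uM' c) (at c)"
      using has_vector_derivative_mult[OF powr_derivative_real[OF c, of "2 * n"] uB_derivative[of n c]]
      unfolding uM_def[abs_def] uM'_def by (simp add: algebra_simps)
    have cp2: "complex_of_real c powr (2 * n - 1 - 1) = of_real c powr (2 * n) / of_real c / of_real c"
      using c unfolding powr_diff by simp
    have "(uM' has_vector_derivative
       (2 * n * (of_real c powr (2 * n - 1) * uB' n c + (2 * n - 1) * of_real c powr (2 * n - 1 - 1) * uB n c))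
       + (of_real c powr (2 * n) * (- (2 * n + 1) * uB' n c / of_real c - uB n c) + 2 * n * of_real c powr (2 * n - 1) * uB' n c)) (at c)"
      using has_vector_derivative_add[OF
          has_vector_derivative_mult_right[OF has_vector_derivative_mult[OF powr_derivative_real[OF c, of "2 * n - 1"] uB_derivative[of n c]], of "2 * n"]
          has_vector_derivative_mult[OF powr_derivative_real[OF c, of "2 * n"] uB'_derivative[OF c, of n]]]
      unfolding uM'_def[abs_def] by (simp only: mult.assoc)
    also have "(2 * n * (of_real c powr (2 * n - 1) * uB' n c + (2 * n - 1) * of_real c powr (2 * n - 1 - 1) * uB n c))
       + (of_real c powr (2 * n) * (- (2 * n + 1) * uB' n c / of_real c - uB n c) + 2 * n * of_real c powr (2 * n - 1) * uB' n c)
       = - (2 * (- n) + 1) * uM' c / of_real c - uM c"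
    proof -
      have "(2 * n * (P / z * B' + (2 * n - 1) * (P / z / z) * B)) + (P * (- (2 * n + 1) * B' / z - B) + 2 * n * (P / z) * B')
          = - (2 * (- n) + 1) * (2 * n * (P / z) * B + P * B') / z - P * B" if "z \<noteq> 0" for z P B B' :: complex
        using that by (simp add: field_simps power2_eq_square)
      from this[of "of_real c" "of_real c powr (2 * n)" "uB' n c" "uB n c"] c
      show ?thesis unfolding uM'_def uM_def cp[OF c] cp2 by simp
    qed
    finally show "(uM' has_vector_derivative - (2 * (- n) + 1) * uM' c / of_real c - uM c) (at c)" .
  next
    have *: "of_real (1 / real (Suc k)) * uM' (1 / real (Suc k)) + 2 * (- n) * uM (1 / real (Suc k))
       = of_real (1 / real (Suc k)) * (of_real (1 / real (Suc k)) powr (2 * n) * uB' n (1 / real (Suc k)))" for k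
      by (rule e) simp
    show "(\<lambda>k. of_real (1 / real (Suc k)) * uM' (1 / real (Suc k)) + 2 * (- n) * uM (1 / real (Suc k))) \<longlonglongrightarrow> 0"
      unfolding * by (rule small[OF U(3)])
    show "(\<lambda>k. of_real (1 / real (Suc k)) * uM (1 / real (Suc k))) \<longlonglongrightarrow> 0"
      unfolding uM_def by (rule small[OF U(2)])
  next
    fix c :: real assume c: "c \<ge> 1"
    show "norm (uM c) \<le> U * c"
      unfolding uM_def norm_mult using large[OF c] U(1) U(2)[of c] c by (subst mult.commute[of U]) (intro mult_mono; simp)
    have "of_real c * uM' c + 2 * (- n) * uM c = of_real c * (of_real c powr (2 * n) * uB' n c)"
      by (rule e) (use c in simp)
    moreover have "norm (of_real c * (of_real c powr (2 * n) * uB' n c)) \<le> c * (c * U)"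
      unfolding norm_mult using large[OF c] U(1) U(3)[of c] c by (intro mult_mono) auto
    ultimately show "norm (of_real c * uM' c + 2 * (- n) * uM c) \<le> U * c\<^sup>2"
      by (simp add: power2_eq_square mult_ac)
  qed
qed

text \<open>The derivative of \<open>p * (p^2 + 1) powr (- 1/2 - n)\<close> is a combination of the
  two integrands. The new exponent has real part below -1, so the new primitive converges along the
  positive axis.\<close>

lemma Prim_shift:
  assumes p: "Re p > 0"
  shows "2 * n * Prim (- 1/2 - n) p = (2 * n + 1) * Prim (- (n + 3/2)) p - p * (p\<^sup>2 + 1) powr (- 1/2 - n)"
proof -
  define Z where "Z p = p * (p\<^sup>2 + 1) powr (- 1/2 - n) + 2 * n * Prim (- 1/2 - n) p - (2 * n + 1) * Prim (- (n + 3/2)) p" for p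
  have "(Z has_field_derivative 0) (at p)" if D: "p \<in> Dom" for p
  proof -
    note nz = square_plus_one_notin[OF D]
    then have nz0: "p\<^sup>2 + 1 \<noteq> 0" by auto
    have pw: "(p\<^sup>2 + 1) powr (- 1/2 - n) = (p\<^sup>2 + 1) * (p\<^sup>2 + 1) powr (- (n + 3/2))"
    proof -
      have "(p\<^sup>2 + 1) powr (- 1/2 - n) = (p\<^sup>2 + 1) powr (1 + (- (n + 3/2)))" by simp
      also have "\<dots> = (p\<^sup>2 + 1) powr 1 * (p\<^sup>2 + 1) powr (- (n + 3/2))" by (rule powr_add)
      finally show ?thesis by simp
    qed
    have e: "- 1/2 - n - 1 = - (n + 3/2)" by simp
    have "(Z has_field_derivative (p * (2 * (- 1/2 - n) * p * (p\<^sup>2 + 1) powr (- 1/2 - n - 1)) + 1 * (p\<^sup>2 + 1) powr (- 1/2 - n))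
       + 2 * n * (p\<^sup>2 + 1) powr (- 1/2 - n) - (2 * n + 1) * (p\<^sup>2 + 1) powr (- (n + 3/2))) (at p)"
      unfolding Z_def[abs_def]
      by (intro DERIV_diff DERIV_add DERIV_mult' DERIV_ident DERIV_cmult DERIV_one_plus_square_powr nz DERIV_Prim D)
    then show ?thesis unfolding pw e by (rule DERIV_cong) (simp add: algebra_simps power2_eq_square)
  qed
  from zero_derivative_Dom[of Z, OF this p] have "Z p = 0" by (simp add: Z_def)
  then show ?thesis by (simp add: Z_def algebra_simps)
qed

lemma Prim_tendsto_Tint: "(\<lambda>k. Prim (- (n + 3/2)) (of_real (real (Suc k)))) \<longlonglongrightarrow> Tint (n + 3/2)"
proof -
  let ?E = "Prim (- (n + 3/2))" and ?f = "\<lambda>q. complex_of_real (1 + q\<^sup>2) powr (- (n + 3/2))"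
  have le: "norm (?f q) \<le> 1 / (1 + q\<^sup>2)" for q
    unfolding norm_Tint_integrand by (rule one_plus_square_powr_le) (use abs_Re_less_half in simp)
  have 1: "(\<lambda>k. integral {1 / real (Suc k)..real (Suc k)} ?f) \<longlonglongrightarrow> Tint (n + 3/2)"
    unfolding Tint_def by (rule integral_exhaust_pos[OF continuous_Tint_integrand integrable_inverse_one_plus_square le])
  have 2: "integral {1 / real (Suc k)..real (Suc k)} ?f = ?E (of_real (real (Suc k))) - ?E (of_real (1 / real (Suc k)))" for k
  proof (rule integral_unique[OF fundamental_theorem_of_calculus])
    show "1 / real (Suc k) \<le> real (Suc k)" by (simp add: field_simps)
    fix x assume "x \<in> {1 / real (Suc k)..real (Suc k)}"
    then have "x > 0" by (auto intro: less_le_trans[rotated])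
    then have "complex_of_real x \<in> Dom" by (simp add: Dom_def)
    from has_vector_derivative_real_field[OF DERIV_Prim[OF this, of "- (n + 3/2)"]]
    show "((\<lambda>x. ?E (of_real x)) has_vector_derivative ?f x) (at x within {1 / real (Suc k)..real (Suc k)})"
      unfolding real_square_plus_one .
  qed
  have "isCont ?E 0" by (rule DERIV_isCont[OF DERIV_Prim]) (simp add: Dom_def)
  moreover have "(\<lambda>k. complex_of_real (1 / real (Suc k))) \<longlonglongrightarrow> 0"
    using tendsto_of_real[OF LIMSEQ_Suc[OF lim_1_over_n], where 'a = complex] by simp
  ultimately have 3: "(\<lambda>k. ?E (of_real (1 / real (Suc k)))) \<longlonglongrightarrow> 0"
    using isCont_tendsto_compose by fastforce
  from tendsto_add[OF 1 3] show ?thesis unfolding 2 by simp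
qed

end

lemma Lap_scaled:
  assumes v: "pow_bounded v" and N: "N > 0"
  shows "integral {0<..} (\<lambda>t. exp (- of_real t) * v (t / N)) = of_real N * Lap v (of_real N)"
proof -
  have "((\<lambda>c. exp (- (of_real N * of_real c)) * v c) has_integral Lap v (of_real N)) {0<..}"
    unfolding Lap_def using N by (intro integrable_integral Lap_integrable[OF v]) auto
  from has_integral_scale_pos[OF this, of "1 / N"] N
  have "((\<lambda>t. exp (- of_real t) * v (t / N)) has_integral of_real N * Lap v (of_real N)) {0<..}"
    by (simp add: mult.commute)
  then show ?thesis by (rule integral_unique)
qed

text \<open>The closed form leaves one constant, found by letting \<open>p = N\<close> tend to
  infinity: after rescaling, only the value of \<open>uB\<close> at 0 matters and Euler's integral
  for \<open>Gamma (2 * n + 1)\<close> appears.\<close>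

lemma Lap_uM_eq:
  assumes n: "norm n < 1/2" and p: "Re p > 0"
  shows "Lap (uM n) p = (p\<^sup>2 + 1) powr (- n - 1/2) * (rGamma (n + 1) * Gamma (2 * n + 1))"
proof (rule uB_bounded[OF n])
  fix U assume U: "U \<ge> 0" "\<And>c. c \<ge> 0 \<Longrightarrow> norm (uB n c) \<le> U"
  obtain C where C: "\<And>p. Re p > 0 \<Longrightarrow> Lap (uM n) p = (p\<^sup>2 + 1) powr (- n - 1/2) * (C - 0 * Prim (- 1/2 - (- n)) p)"
    using Lap_closed_form[OF pow_bounded_uM[OF n] Lap_uM_ode[OF n]] by blast
  have Re: "Re (2 * n + 1) > 0" using abs_Re_less_half[OF n] by simp
  let ?N = "\<lambda>k. real (Suc k)"
  define f where "f k t = exp (- of_real t) * (of_real t powr (2 * n) * uB n (t / ?N k))" for k t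
  have fc: "continuous_on {0<..} (f k)" for k
    unfolding f_def
    by (intro continuous_on_mult continuous_on_powr_complex continuous_on_compose2[OF continuous_uB(1)[of UNIV]] continuous_intros) auto
  have fb: "norm (f k t) \<le> U * (t powr (2 * Re n) * exp (- (1 * t)))" if "t > 0" for k t
  proof -
    have "norm (f k t) = t powr (2 * Re n) * exp (- t) * norm (uB n (t / ?N k))"
      unfolding f_def norm_mult using that by (subst norm_powr_real_powr) auto
    also have "\<dots> \<le> t powr (2 * Re n) * exp (- t) * U" using that U(2)[of "t / ?N k"] by (intro mult_left_mono) auto
    finally show ?thesis by (simp add: mult_ac)
  qed
  have g: "(\<lambda>t. U * (t powr (2 * Re n) * exp (- (1 * t)))) integrable_on {0<..}"
    using abs_Re_less_half[OF n] by (intro integrable_on_mult_right integrable_powr_exp) auto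
  have lim: "(\<lambda>k. integral {0<..} (f k)) \<longlonglongrightarrow> integral {0<..} (\<lambda>t. exp (- of_real t) * (of_real t powr (2 * n) * rGamma (n + 1)))"
  proof (rule dominated_convergence(2)[OF _ g])
    show "f k integrable_on {0<..}" for k
      by (rule integrable_on_continuous_dominated[OF fc _ g fb]) auto
    show "(\<lambda>k. f k t) \<longlonglongrightarrow> exp (- of_real t) * (of_real t powr (2 * n) * rGamma (n + 1))" for t
    proof -
      have "isCont (uB n) 0" using continuous_uB(1)[of UNIV n] by (simp add: continuous_on_eq_continuous_at)
      moreover have "(\<lambda>k. t / ?N k) \<longlonglongrightarrow> 0" using tendsto_mult_left[OF LIMSEQ_Suc[OF lim_1_over_n], of t] by simp
      ultimately have "(\<lambda>k. uB n (t / ?N k)) \<longlonglongrightarrow> uB n 0" by (rule isCont_tendsto_compose)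
      then show ?thesis unfolding f_def uB_0 by (intro tendsto_intros)
    qed
  qed (use fb in auto)
  have rhs: "integral {0<..} (\<lambda>t. exp (- of_real t) * (of_real t powr (2 * n) * rGamma (n + 1))) = rGamma (n + 1) * Gamma (2 * n + 1)"
  proof -
    have "(\<lambda>t. exp (- of_real t) * (of_real t powr (2 * n) * rGamma (n + 1)))
        = (\<lambda>t. rGamma (n + 1) * (of_real t powr (2 * n + 1 - 1) * exp (- of_real t)))" by (simp add: mult_ac)
    then show ?thesis using Gamma_integral_exp[OF Re] by simp
  qed
  have lhs: "integral {0<..} (f k) = complex_of_real (1 + (1 / ?N k)\<^sup>2) powr (- n - 1/2) * C" for k
  proof -
    define N where "N = ?N k"
    have N: "N > 0" by (simp add: N_def)
    have eq: "exp (- of_real t) * uM n (t / N) = of_real N powr (- 2 * n) * f k t" if t: "t \<in> {0<..}" for t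
    proof -
      have "complex_of_real (t * (1 / N)) powr (2 * n) = of_real t powr (2 * n) * of_real (1 / N) powr (2 * n)"
        using t N powr_times_real[of "of_real t" "of_real (1 / N)" "2 * n"] by simp
      moreover have "complex_of_real (1 / N) powr (2 * n) = of_real N powr (- 2 * n)"
        using N Ln_of_real[of "1 / N"] Ln_of_real[of N] by (simp add: powr_def ln_div del: of_real_divide)
      ultimately show ?thesis by (simp add: uM_def[OF n] f_def N_def del: of_nat_Suc)
    qed
    have "of_real N * Lap (uM n) (of_real N) = integral {0<..} (\<lambda>t. of_real N powr (- 2 * n) * f k t)"
      unfolding Lap_scaled[OF pow_bounded_uM[OF n] N, symmetric] by (rule integral_cong[OF eq])
    then have 1: "of_real N * Lap (uM n) (of_real N) = of_real N powr (- 2 * n) * integral {0<..} (f k)" by simp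
    \<comment> \<open>Splitting off \<open>N^2\<close> makes both factors positive reals, for which
      principal powers multiply; \<open>N\<close> then cancels and a power of
      \<open>1 + 1 / N^2\<close> remains, which tends to 1.\<close>
    have "(complex_of_real N)\<^sup>2 + 1 = of_real (N\<^sup>2) * of_real (1 + (1 / N)\<^sup>2)" using N by (simp add: field_simps)
    then have "((complex_of_real N)\<^sup>2 + 1) powr (- n - 1/2) = of_real (N\<^sup>2) powr (- n - 1/2) * of_real (1 + (1 / N)\<^sup>2) powr (- n - 1/2)"
      using powr_times_real[of "of_real (N\<^sup>2)" "of_real (1 + (1 / N)\<^sup>2)" "- n - 1/2"] by simp
    also have "complex_of_real (N\<^sup>2) powr (- n - 1/2) = of_real N powr (2 * (- n - 1/2))"
      using of_real_sqrt_powr[of "N\<^sup>2" "- n - 1/2"] N by simp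
    also have "2 * (- n - 1/2) = - 2 * n - 1" by simp
    also have "complex_of_real N powr (- 2 * n - 1) = of_real N powr (- 2 * n) / of_real N" using N unfolding powr_diff by simp
    finally have 2: "((complex_of_real N)\<^sup>2 + 1) powr (- n - 1/2) = of_real N powr (- 2 * n) / of_real N * of_real (1 + (1 / N)\<^sup>2) powr (- n - 1/2)" .
    have "of_real N powr (- 2 * n) * integral {0<..} (f k) = of_real N powr (- 2 * n) * (of_real (1 + (1 / N)\<^sup>2) powr (- n - 1/2) * C)"
      unfolding 1[symmetric] using C[of "of_real N"] N unfolding 2 by (simp add: field_simps)
    then have "integral {0<..} (f k) = of_real (1 + (1 / N)\<^sup>2) powr (- n - 1/2) * C" using N by simp
    then show ?thesis by (simp only: N_def)
  qed
  have "(\<lambda>k. complex_of_real (1 + (1 / ?N k)\<^sup>2) powr (- n - 1/2) * C) \<longlonglongrightarrow> of_real (1 + 0\<^sup>2) powr (- n - 1/2) * C"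
    by (intro tendsto_mult tendsto_powr_complex tendsto_of_real tendsto_add tendsto_power LIMSEQ_Suc[OF lim_1_over_n] tendsto_const) auto
  then have "C = rGamma (n + 1) * Gamma (2 * n + 1)"
    using LIMSEQ_unique[OF lim] unfolding lhs rhs by simp
  then show ?thesis using C[OF p] by simp
qed

text \<open>Quadratic because \<open>uB\<close> depends on \<open>c\<close> through its square. The
  rate matters: in the transform at large \<open>N\<close> the resulting error
  \<open>1 / N^2\<close> is multiplied by a factor of size \<open>N\<close>.\<close>

lemma uB_minus_0_bound:
  assumes n: "norm n < 1/2"
  obtains K where "K \<ge> 0" "\<And>c. c \<ge> 0 \<Longrightarrow> norm (uB n c - uB n 0) \<le> K * c\<^sup>2"
proof (rule uB_bounded[OF n])
  fix U assume U: "U \<ge> 0" "\<And>c. c \<ge> 0 \<Longrightarrow> norm (uB n c) \<le> U"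
  have "bounded (Phi (n + 1) ` cball 0 1)"
    by (intro compact_imp_bounded compact_continuous_image continuous_intros) auto
  then obtain S where S: "\<And>y. y \<in> cball 0 1 \<Longrightarrow> norm (Phi (n + 1) y) \<le> S" unfolding bounded_iff by blast
  have S0: "S \<ge> 0" using S[of 0] order_trans[OF norm_ge_zero] by auto
  show ?thesis
  proof (rule that[of "S + 2 * U"])
    show "S + 2 * U \<ge> 0" using S0 U by simp
    fix c :: real assume c: "c \<ge> 0"
    show "norm (uB n c - uB n 0) \<le> (S + 2 * U) * c\<^sup>2"
    proof (cases "c \<le> 1")
      case True
      define y where "y = - ((complex_of_real c / 2)\<^sup>2)"
      have ny: "norm y = c\<^sup>2 / 4" using c by (simp add: y_def norm_power norm_divide power_divide)
      have "c\<^sup>2 \<le> 1" using True c by (simp add: power_le_one)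
      then have y: "norm y \<le> 1" using ny by simp
      have "norm (Phi n y - Phi n 0) \<le> S * norm (y - 0)"
        by (rule field_differentiable_bound[of "cball 0 1" "Phi n" "Phi (n + 1)"])
          (use S y in \<open>auto intro: DERIV_Phi has_field_derivative_at_within\<close>)
      also have "\<dots> \<le> S * c\<^sup>2"
      proof (intro mult_left_mono S0)
        show "norm (y - 0) \<le> c\<^sup>2" using ny zero_le_power2[of c] unfolding diff_zero by linarith
      qed
      also have "\<dots> \<le> (S + 2 * U) * c\<^sup>2" using U(1) by (intro mult_right_mono) auto
      finally show ?thesis by (simp add: uB_def y_def)
    next
      case False
      have "norm (uB n c - uB n 0) \<le> U + U" using U(2)[of c] U(2)[of 0] c
        by (intro order_trans[OF norm_triangle_ineq4] add_mono) auto
      also have "\<dots> \<le> (S + 2 * U) * 1" using S0 by simp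
      also have "\<dots> \<le> (S + 2 * U) * c\<^sup>2" using False S0 U(1) by (intro mult_left_mono) (auto simp: one_le_power)
      finally show ?thesis .
    qed
  qed
qed

text \<open>The constant is read off as \<open>p\<close> tends to infinity; \<open>Prim_shift\<close> replaces the primitive, which may diverge
  there, by a convergent one.\<close>

lemma Lap_uB_eq:
  assumes n: "norm n < 1/2" and p: "Re p > 0"
  shows "Lap (uB n) p = (p\<^sup>2 + 1) powr (n - 1/2) * (of_real (sqrt pi) * rGamma (n + 1/2) - 2 * n * rGamma (n + 1) * Prim (- 1/2 - n) p)"
proof (rule uB_minus_0_bound[OF n])
  fix K assume K: "K \<ge> 0" "\<And>c. c \<ge> 0 \<Longrightarrow> norm (uB n c - uB n 0) \<le> K * c\<^sup>2"
  let ?u0 = "rGamma (n + 1)"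
  obtain C where C: "\<And>p. Re p > 0 \<Longrightarrow> Lap (uB n) p = (p\<^sup>2 + 1) powr (n - 1/2) * (C - 2 * n * ?u0 * Prim (- 1/2 - n) p)"
    using Lap_closed_form[OF pow_bounded_uB[OF n] Lap_uB_ode[OF n]] by blast
  let ?N = "\<lambda>k. real (Suc k)"
  define I where "I = integral {0<..} (\<lambda>t::real. t powr 2 * exp (- (1 * t)))"
  have Iint: "(\<lambda>t::real. t powr 2 * exp (- (1 * t))) integrable_on {0<..}" by (rule integrable_powr_exp) auto
  have I0: "I \<ge> 0" unfolding I_def by (rule integral_nonneg[OF Iint]) auto
  have approx: "norm (of_real N * Lap (uB n) (of_real N) - ?u0) \<le> K * I / N\<^sup>2" if N: "N > 0" for N
  proof -
    have int: "(\<lambda>t. exp (- of_real t) * uB n (t / N)) integrable_on {0<..}"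
    proof (rule uB_bounded[OF n])
      fix U assume U: "U \<ge> 0" "\<And>c. c \<ge> 0 \<Longrightarrow> norm (uB n c) \<le> U"
      show ?thesis
      proof (rule integrable_on_continuous_dominated)
        show "continuous_on {0<..} (\<lambda>t. exp (- of_real t) * uB n (t / N))"
          using N by (intro continuous_on_mult continuous_on_compose2[OF continuous_uB(1)[of UNIV]] continuous_intros) auto
        show "(\<lambda>t. U * (t powr 0 * exp (- (1 * t)))) integrable_on {0<..}"
          by (intro integrable_on_mult_right integrable_powr_exp) auto
        show "norm (exp (- of_real t) * uB n (t / N)) \<le> U * (t powr 0 * exp (- (1 * t)))" if "t \<in> {0<..}" for t
          using that U(2)[of "t / N"] N by (simp add: norm_mult mult.commute)
      qed auto
    qed
    have int1: "(\<lambda>t. exp (- of_real t) * ?u0) integrable_on {0<..}"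
      using has_integral_mult_left[OF integral_exp_minus, of ?u0] by blast
    have "of_real N * Lap (uB n) (of_real N) - ?u0 = integral {0<..} (\<lambda>t. exp (- of_real t) * uB n (t / N) - exp (- of_real t) * ?u0)"
      unfolding integral_diff[OF int int1] Lap_scaled[OF pow_bounded_uB[OF n] N]
      using integral_unique[OF has_integral_mult_left[OF integral_exp_minus, of ?u0]] by (simp only: mult_1_left)
    also have "norm \<dots> \<le> integral {0<..} (\<lambda>t. K / N\<^sup>2 * (t powr 2 * exp (- (1 * t))))"
    proof (rule integral_norm_bound_integral)
      show "(\<lambda>t. exp (- of_real t) * uB n (t / N) - exp (- of_real t) * ?u0) integrable_on {0<..}"
        by (intro integrable_diff int int1)
      show "(\<lambda>t. K / N\<^sup>2 * (t powr 2 * exp (- (1 * t)))) integrable_on {0<..}"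
        by (intro integrable_on_mult_right Iint)
      fix t :: real assume "t \<in> {0<..}"
      then have t: "t > 0" by simp
      have "exp (- of_real t) * uB n (t / N) - exp (- of_real t) * ?u0 = exp (- of_real t) * (uB n (t / N) - uB n 0)"
        by (simp add: algebra_simps)
      also have "norm \<dots> \<le> exp (- t) * (K * (t / N)\<^sup>2)"
        unfolding norm_mult using K(2)[of "t / N"] t N by (intro mult_mono) auto
      also have "\<dots> = K / N\<^sup>2 * (t powr 2 * exp (- (1 * t)))" using t by (simp add: power_divide)
      finally show "norm (exp (- of_real t) * uB n (t / N) - exp (- of_real t) * ?u0) \<le> K / N\<^sup>2 * (t powr 2 * exp (- (1 * t)))" .
    qed
    also have "\<dots> = K * I / N\<^sup>2" by (simp add: I_def)
    finally show ?thesis .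
  qed
  have diff: "norm (C - ?u0 * (2 * n + 1) * Prim (- (n + 3/2)) (of_real (?N k))) \<le> (2 * (K * I) + norm ?u0) * (1 / ?N k)" for k
  proof -
    define N where "N = ?N k"
    have N: "N \<ge> 1" by (simp add: N_def)
    define z where "z = complex_of_real N"
    define A where "A = (z\<^sup>2 + 1) powr (- 1/2 - n)"
    have z: "Re z > 0" "z \<noteq> 0" using N by (auto simp: z_def)
    have nz: "z\<^sup>2 + 1 \<noteq> 0" using square_plus_one_notin[of z] z by (auto simp: Dom_def)
    have A: "(z\<^sup>2 + 1) powr (1/2 - n) = (z\<^sup>2 + 1) * A"
    proof -
      have "(z\<^sup>2 + 1) powr (1/2 - n) = (z\<^sup>2 + 1) powr (1 + (- 1/2 - n))" by simp
      also have "\<dots> = (z\<^sup>2 + 1) powr 1 * A" unfolding A_def by (rule powr_add)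
      finally show ?thesis by simp
    qed
    have e: "(z\<^sup>2 + 1) powr (1/2 - n) * (z\<^sup>2 + 1) powr (n - 1/2) = 1" using nz by (simp flip: powr_add)
    have "(z\<^sup>2 + 1) * A * Lap (uB n) z = ((z\<^sup>2 + 1) powr (1/2 - n) * (z\<^sup>2 + 1) powr (n - 1/2)) * (C - 2 * n * ?u0 * Prim (- 1/2 - n) z)"
      unfolding A[symmetric] C[OF z(1)] by (simp only: mult.assoc)
    then have "(z\<^sup>2 + 1) * A * Lap (uB n) z = C - ?u0 * (2 * n * Prim (- 1/2 - n) z)"
      unfolding e by (simp add: mult_ac)
    then have "C - ?u0 * (2 * n + 1) * Prim (- (n + 3/2)) z = A * ((z\<^sup>2 + 1) * Lap (uB n) z - ?u0 * z)"
      unfolding Prim_shift[OF n z(1)] A_def[symmetric] by (simp add: algebra_simps)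
    \<comment> \<open>The term \<open>?u0 * z\<close> left by the shift of the primitive cancels the
      leading growth of \<open>(z^2 + 1) * Lap (uB n) z\<close>; both remaining terms are of size
      \<open>1 / N\<close>, and \<open>A\<close> is at most 1 in modulus.\<close>
    also have "(z\<^sup>2 + 1) * Lap (uB n) z - ?u0 * z = (z\<^sup>2 + 1) / z * (z * Lap (uB n) z - ?u0) + ?u0 / z"
      using z(2) by (simp add: field_simps power2_eq_square)
    also have "norm (A * ((z\<^sup>2 + 1) / z * (z * Lap (uB n) z - ?u0) + ?u0 / z)) \<le> 1 * ((2 * N) * (K * I / N\<^sup>2) + norm ?u0 / N)"
      unfolding norm_mult
    proof (rule mult_mono)
      have "norm A = (1 + N\<^sup>2) powr Re (- 1/2 - n)" unfolding A_def z_def real_square_plus_one norm_Tint_integrand ..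
      also have "\<dots> \<le> (1 + N\<^sup>2) powr 0" using abs_Re_less_half[OF n] by (intro powr_mono) auto
      finally show "norm A \<le> 1" using one_plus_square_pos[of N] by simp
      have "norm ((z\<^sup>2 + 1) / z) \<le> 2 * N"
      proof -
        have "norm ((z\<^sup>2 + 1) / z) = (1 + N\<^sup>2) / N"
          unfolding z_def real_square_plus_one norm_divide norm_of_real using N one_plus_square_pos[of N] by simp
        also have "\<dots> \<le> 2 * N" using N mult_mono[of 1 N 1 N] by (simp add: field_simps power2_eq_square)
        finally show ?thesis .
      qed
      then have "norm ((z\<^sup>2 + 1) / z * (z * Lap (uB n) z - ?u0)) \<le> 2 * N * (K * I / N\<^sup>2)"
        unfolding norm_mult z_def using approx[of N] N by (intro mult_mono) auto
      moreover have "norm (?u0 / z) = norm ?u0 / N" using N by (simp add: norm_divide z_def)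
      ultimately show "norm ((z\<^sup>2 + 1) / z * (z * Lap (uB n) z - ?u0) + ?u0 / z) \<le> 2 * N * (K * I / N\<^sup>2) + norm ?u0 / N"
        by (intro order_trans[OF norm_triangle_ineq]) auto
    qed auto
    also have "\<dots> = (2 * (K * I) + norm ?u0) * (1 / N)" using N by (simp add: field_simps power2_eq_square)
    finally show ?thesis by (simp only: z_def N_def)
  qed
  have "(\<lambda>k. C - ?u0 * (2 * n + 1) * Prim (- (n + 3/2)) (of_real (?N k))) \<longlonglongrightarrow> 0"
  proof (rule Lim_null_comparison)
    show "\<forall>\<^sub>F k in sequentially. norm (C - ?u0 * (2 * n + 1) * Prim (- (n + 3/2)) (of_real (?N k))) \<le> (2 * (K * I) + norm ?u0) * (1 / ?N k)"
      using diff by (intro always_eventually) auto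
    show "(\<lambda>k. (2 * (K * I) + norm ?u0) * (1 / ?N k)) \<longlonglongrightarrow> 0"
      using tendsto_mult_left[OF LIMSEQ_Suc[OF lim_1_over_n], of "2 * (K * I) + norm ?u0"] by simp
  qed
  moreover have "(\<lambda>k. C - ?u0 * (2 * n + 1) * Prim (- (n + 3/2)) (of_real (?N k))) \<longlonglongrightarrow> C - ?u0 * (2 * n + 1) * Tint (n + 3/2)"
    by (intro tendsto_intros Prim_tendsto_Tint[OF n])
  ultimately have "C - ?u0 * (2 * n + 1) * Tint (n + 3/2) = 0" using LIMSEQ_unique by blast
  \<comment> \<open>Now the beta integral at \<open>n + 3/2\<close> enters; the factor
    \<open>2 n + 1\<close> lowers the argument of the reciprocal Gamma function from
    \<open>n + 3/2\<close> to \<open>n + 1/2\<close>.\<close>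
  then have "C = (2 * n + 1) * (?u0 * Tint (n + 3/2))" by (simp add: mult_ac)
  also have "\<dots> = (2 * n + 1) * (rGamma (n + 3/2 - 1/2) * Tint (n + 3/2))" by (simp add: add.commute)
  also have "\<dots> = (2 * n + 1) * (rGamma (n + 3/2) * (of_real (sqrt pi) / 2))"
    by (subst Tint_eq) (use abs_Re_less_half[OF n] in auto)
  also have "\<dots> = of_real (sqrt pi) * ((n + 1/2) * rGamma (n + 1/2 + 1))" by (simp add: field_simps)
  also have "\<dots> = of_real (sqrt pi) * rGamma (n + 1/2)" unfolding rGamma_plus1 ..
  finally show ?thesis using C[OF p] by simp
qed

section \<open>The Laplace transform of the integrand at the origin\<close>

lemma zero_in_Dom: "0 \<in> Dom" by (simp add: Dom_def)

lemma half_powr: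
  assumes y: "y > 0"
  shows "complex_of_real (y / 2) powr n = of_real y powr n * 2 powr (- n)"
proof -
  have L: "Ln (complex_of_real (y / 2)) = of_real (ln y) - of_real (ln 2)"
    using Ln_of_real[of "y / 2"] y by (simp only: ln_div of_real_diff) simp
  have "Ln (complex_of_real y) = of_real (ln y)" "Ln (2::complex) = of_real (ln 2)"
    using Ln_of_real[of y] Ln_of_real[of 2] y by simp_all
  moreover have "complex_of_real (y / 2) \<noteq> 0" "complex_of_real y \<noteq> 0" using y by auto
  ultimately show ?thesis unfolding powr_def L
    by (simp add: algebra_simps flip: exp_add)
qed

context
  fixes a :: complex and y Q :: real and e :: "nat \<Rightarrow> complex"
  assumes y: "y > 0" and e: "\<And>k. norm (e k) \<le> Q"
begin

text \<open>Taylor coefficients in \<open>c\<close> of \<open>Phi a (c y)\<close>, modified by a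
  bounded multiplier. With multipliers such as \<open>1 + (-1) ^ k\<close>, a single series holds
  \<open>Phi\<close> at \<open>c y\<close> and at \<open>- c y\<close>.\<close>

definition bc :: "nat \<Rightarrow> complex" where
  "bc k = e k * (rGamma (a + of_nat k + 1) / fact k) * of_real y ^ k"

lemma Q_nonneg: "Q \<ge> 0" using order_trans[OF norm_ge_zero e] .

lemma bc_partial_bound:
  assumes "\<epsilon> > 0"
  obtains S where "S > 0" "\<And>c m. c \<ge> 0 \<Longrightarrow> (\<Sum>k<m. norm (bc k * of_real c ^ k)) \<le> S * exp (\<epsilon> * c)"
proof -
  obtain N where N: "norm a \<le> real N" using real_arch_simple by blast
  have ey: "\<epsilon> / y > 0" using assms y by simp
  obtain S :: real where S: "S > 0" "\<And>(a::complex) y' n. norm a \<le> real N \<Longrightarrow>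
       (\<Sum>k<n. norm (rGamma (a + of_nat k + 1) / fact k) * norm (y'::complex) ^ k) \<le> S * exp (\<epsilon> / y * norm y')"
    by (rule Phi_terms_bound[OF ey, of N]) blast
  have "(\<Sum>k<m. norm (bc k * of_real c ^ k)) \<le> ((Q + 1) * S) * exp (\<epsilon> * c)" if c: "c \<ge> 0" for c m
  proof -
    have "(\<Sum>k<m. norm (bc k * of_real c ^ k)) \<le> (\<Sum>k<m. (Q + 1) * (norm (rGamma (a + of_nat k + 1) / fact k) * norm (complex_of_real (c * y)) ^ k))"
    proof (rule sum_mono)
      fix k
      have "norm (bc k * of_real c ^ k) = norm (e k) * (norm (rGamma (a + of_nat k + 1) / fact k) * norm (complex_of_real (c * y)) ^ k)"
      proof -
        have "bc k * of_real c ^ k = e k * ((rGamma (a + of_nat k + 1) / fact k) * complex_of_real (c * y) ^ k)"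
          by (simp only: bc_def of_real_mult power_mult_distrib mult_ac)
        then show ?thesis by (simp only: norm_mult norm_power)
      qed
      also have "\<dots> \<le> (Q + 1) * (norm (rGamma (a + of_nat k + 1) / fact k) * norm (complex_of_real (c * y)) ^ k)"
        using e[of k] by (intro mult_right_mono) auto
      finally show "norm (bc k * of_real c ^ k) \<le> \<dots>" .
    qed
    also have "\<dots> = (Q + 1) * (\<Sum>k<m. norm (rGamma (a + of_nat k + 1) / fact k) * norm (complex_of_real (c * y)) ^ k)"
      by (simp only: sum_distrib_left)
    also have "\<dots> \<le> (Q + 1) * (S * exp (\<epsilon> / y * norm (complex_of_real (c * y))))"
      using Q_nonneg by (intro mult_left_mono S N) auto
    also have "norm (complex_of_real (c * y)) = c * y" unfolding norm_of_real using c y by simp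
    also have "\<epsilon> / y * (c * y) = \<epsilon> * c" using y by simp
    finally show ?thesis by (simp add: mult_ac)
  qed
  then show ?thesis using S(1) Q_nonneg by (intro that[of "(Q + 1) * S"]) auto
qed

lemma bc_summable: "c \<ge> 0 \<Longrightarrow> summable (\<lambda>k. bc k * of_real c ^ k)"
proof (rule bc_partial_bound[OF zero_less_one])
  fix S assume c: "c \<ge> 0" and S: "\<And>c m. c \<ge> 0 \<Longrightarrow> (\<Sum>k<m. norm (bc k * of_real c ^ k)) \<le> S * exp (1 * c)"
  have "summable (\<lambda>k. norm (bc k * of_real c ^ k))"
  proof (rule bounded_imp_summable)
    show "(\<Sum>k\<le>m. norm (bc k * of_real c ^ k)) \<le> S * exp (1 * c)" for m
      using S[OF c, of "Suc m"] unfolding lessThan_Suc_atMost .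
  qed auto
  then show ?thesis by (rule summable_norm_cancel)
qed

text \<open>The partial sums are bounded by a multiple of \<open>exp (Re p / 2 * c)\<close>, so half
  of the exponential weight is left to dominate them all, for every \<open>Re p > 0\<close>.\<close>

lemma Lap_series:
  assumes v: "pow_bounded v" and p: "Re p > 0"
  shows "(\<lambda>c. exp (- (p * of_real c)) * (v c * (\<Sum>k. bc k * of_real c ^ k))) integrable_on {0<..}" (is ?th1)
    and "(\<lambda>k. bc k * Lap (\<lambda>c. of_real (c ^ k) * v c) p) sums Lap (\<lambda>c. v c * (\<Sum>k. bc k * of_real c ^ k)) p" (is ?th2)
proof -
  have p2: "Re p / 2 > 0" using p by simp
  obtain S where S: "S > 0" "\<And>c m. c \<ge> 0 \<Longrightarrow> (\<Sum>k<m. norm (bc k * of_real c ^ k)) \<le> S * exp (Re p / 2 * c)"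
    using bc_partial_bound[OF p2] by blast
  obtain g where g: "g integrable_on {0<..}" "\<And>c. c > 0 \<Longrightarrow> norm (v c) * exp (- (Re p / 2 * c)) \<le> g c"
    using pow_bounded_dominant[OF v p2] by blast
  define f where "f m c = exp (- (p * of_real c)) * (v c * (\<Sum>k<m. bc k * of_real c ^ k))" for m c
  have f_eq: "f m = (\<lambda>c. \<Sum>k<m. bc k * (exp (- (p * of_real c)) * (of_real (c ^ k) * v c)))" for m
    by (simp add: f_def fun_eq_iff sum_distrib_left mult_ac)
  have int: "(\<lambda>c. exp (- (p * of_real c)) * (of_real (c ^ k) * v c)) integrable_on {0<..}" for k
    by (rule Lap_integrable[OF pow_bounded_mult_power[OF v] p])
  have fint: "f m integrable_on {0<..}" for m
    unfolding f_eq by (intro integrable_sum integrable_on_mult_right int) auto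
  have fval: "integral {0<..} (f m) = (\<Sum>k<m. bc k * Lap (\<lambda>c. of_real (c ^ k) * v c) p)" for m
    unfolding f_eq Lap_def by (subst integral_sum) (auto intro: integrable_on_mult_right int simp del: of_real_power)
  have gS: "(\<lambda>c. S * g c) integrable_on {0<..}" by (intro integrable_on_mult_right g)
  have dom: "norm (f m c) \<le> S * g c" if "c \<in> {0<..}" for m c
  proof -
    have c: "c > 0" using that by simp
    have "norm (\<Sum>k<m. bc k * of_real c ^ k) \<le> S * exp (Re p / 2 * c)"
      using S(2)[of c m] c by (intro order_trans[OF norm_sum]) auto
    then have "norm (f m c) \<le> exp (- (Re p * c)) * (norm (v c) * (S * exp (Re p / 2 * c)))"
      unfolding f_def norm_mult by (intro mult_mono) auto
    also have "\<dots> = S * (norm (v c) * (exp (- (Re p * c)) * exp (Re p / 2 * c)))" by simp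
    also have "exp (- (Re p * c)) * exp (Re p / 2 * c) = exp (- (Re p / 2 * c))" by (simp flip: exp_add)
    also have "S * (norm (v c) * exp (- (Re p / 2 * c))) \<le> S * g c" using S(1) g(2)[OF c] by (intro mult_left_mono) auto
    finally show ?thesis .
  qed
  have conv: "(\<lambda>m. f m c) \<longlonglongrightarrow> exp (- (p * of_real c)) * (v c * (\<Sum>k. bc k * of_real c ^ k))" if "c \<in> {0<..}" for c
    unfolding f_def using summable_LIMSEQ[OF bc_summable[of c]] that by (intro tendsto_intros) auto
  show ?th1 by (rule dominated_convergence(1)[OF fint gS dom conv])
  show ?th2 using dominated_convergence(2)[OF fint gS dom conv]
    unfolding sums_def fval Lap_def[of "\<lambda>c. v c * (\<Sum>k. bc k * of_real c ^ k)"] .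
qed

text \<open>The moments at \<open>p = 0\<close> may diverge, but for \<open>Re p > 0\<close> they
  are derivatives of the continuation \<open>\<Lambda>\<close>, which has limits at 0. Cauchy's
  estimates cost only \<open>fact k * 2 ^ k\<close>, and the coefficients contain two factorials, so
  Tannery's theorem moves the limit inside.\<close>

lemma Lap_series_limit:
  assumes v: "pow_bounded v" and h: "\<Lambda> holomorphic_on Dom" and eq: "\<And>p. Re p > 0 \<Longrightarrow> Lap v p = \<Lambda> p"
  shows "(\<lambda>j. Lap (\<lambda>c. v c * (\<Sum>k. bc k * of_real c ^ k)) (of_real (1 / real (Suc j))))
    \<longlonglongrightarrow> (\<Sum>k. bc k * ((-1) ^ k * (deriv ^^ k) \<Lambda> 0))"
proof -
  let ?p = "\<lambda>j. complex_of_real (1 / real (Suc j))"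
  define T where "T k j = bc k * ((-1) ^ k * (deriv ^^ k) \<Lambda> (?p j))" for k j
  have LT: "Lap (\<lambda>c. v c * (\<Sum>k. bc k * of_real c ^ k)) (?p j) = (\<Sum>k. T k j)" for j
  proof -
    have p: "Re (?p j) > 0" by simp
    have "Lap (\<lambda>c. of_real (c ^ k) * v c) (?p j) = (-1) ^ k * (deriv ^^ k) \<Lambda> (?p j)" for k
    proof -
      have "(deriv ^^ k) (Lap v) (?p j) = (deriv ^^ k) \<Lambda> (?p j)"
      proof (rule higher_deriv_cong_ev)
        have "eventually (\<lambda>q. q \<in> {q. Re q > 0}) (nhds (?p j))"
          using p by (intro eventually_nhds_in_open open_Re_pos) auto
        then show "\<forall>\<^sub>F q in nhds (?p j). Lap v q = \<Lambda> q" by eventually_elim (use eq in auto)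
      qed simp
      moreover have "(-1) ^ k * ((-1) ^ k * Lap (\<lambda>c. of_real (c ^ k) * v c) (?p j)) = Lap (\<lambda>c. of_real (c ^ k) * v c) (?p j)"
        by (simp flip: mult.assoc power_mult_distrib)
      ultimately show ?thesis using higher_deriv_Lap[OF v p, of k] by metis
    qed
    then show ?thesis using sums_unique[OF Lap_series(2)[OF v p]] by (simp add: T_def)
  qed
  \<comment> \<open>Around each point of modulus at most \<open>1/4\<close> the disc of radius
    \<open>1/2\<close> lies in this compact disc, so one \<open>M\<close> serves all Cauchy
    estimates.\<close>
  have sub: "cball 0 (3/4) \<subseteq> Dom" by (auto simp: Dom_def)
  have "bounded (\<Lambda> ` cball 0 (3/4))"
    by (intro compact_imp_bounded compact_continuous_image holomorphic_on_imp_continuous_on holomorphic_on_subset[OF h sub]) auto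
  then obtain M where M: "M > 0" "\<And>q. q \<in> cball 0 (3/4) \<Longrightarrow> norm (\<Lambda> q) \<le> M" unfolding bounded_pos by auto
  have cauchy: "norm ((deriv ^^ k) \<Lambda> q) \<le> fact k * M / (1/2) ^ k" if q: "norm q \<le> 1/4" for q k
  proof (rule Cauchy_inequality)
    have s: "cball q (1/2) \<subseteq> cball 0 (3/4)"
    proof
      fix x assume "x \<in> cball q (1/2)"
      then show "x \<in> cball 0 (3/4)" using q norm_triangle_ineq[of q "x - q"] by (auto simp: dist_norm norm_minus_commute)
    qed
    show "\<Lambda> holomorphic_on ball q (1/2)"
      by (rule holomorphic_on_subset[OF h subset_trans[OF ball_subset_cball subset_trans[OF s sub]]])
    show "continuous_on (cball q (1/2)) \<Lambda>"
      using s sub by (intro holomorphic_on_imp_continuous_on holomorphic_on_subset[OF h]) auto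
    show "norm (\<Lambda> x) \<le> M" if "norm (q - x) = 1/2" for x
      using s that by (intro M subsetD[OF s]) (auto simp: dist_norm)
  qed simp
  obtain N where N: "norm a \<le> real N" using real_arch_simple by blast
  obtain S :: real where S: "S > 0"
    "\<And>(a::complex) k. norm a \<le> real N \<Longrightarrow> norm (rGamma (a + of_nat k + 1)) \<le> S * 2 ^ k / fact k"
    by (rule rGamma_shift_bound[of N]) blast
  \<comment> \<open>From \<open>j = 3\<close> on, \<open>1 / (j + 1) \<le> 1/4\<close>. The base
    \<open>4 * y\<close> collects a 2 from the reciprocal Gamma bound and a 2 from the Cauchy
    radius; one factorial of the coefficient pays for the derivative, the other stays.\<close>
  have Tb: "norm (T k j) \<le> Q * S * M * ((4 * y) ^ k / fact k)" if j: "j \<ge> 3" for k j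
  proof -
    have "norm (?p j) \<le> 1/4" unfolding norm_of_real using j by (simp add: field_simps)
    note D = cauchy[OF this, of k]
    have "norm (T k j) = norm (e k) * norm (rGamma (a + of_nat k + 1)) / fact k * y ^ k * norm ((deriv ^^ k) \<Lambda> (?p j))"
      unfolding T_def bc_def using y by (simp add: norm_mult norm_divide norm_power)
    also have "\<dots> \<le> Q * (S * 2 ^ k / fact k) / fact k * y ^ k * (fact k * M / (1/2) ^ k)"
      using e[of k] S(2)[OF N, of k] D y Q_nonneg S(1) M(1)
      by (intro mult_mono divide_right_mono) (auto intro!: mult_nonneg_nonneg divide_nonneg_nonneg)
    also have "\<dots> = Q * S * M * ((4 * y) ^ k / fact k)"
    proof -
      have "(2::real) ^ k * 2 ^ k = 4 ^ k" by (simp flip: power_mult_distrib)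
      then show ?thesis by (simp add: power_divide power_mult_distrib field_simps)
    qed
    finally show ?thesis .
  qed
  have "((\<lambda>j. suminf (\<lambda>k. T k j)) \<longlongrightarrow> suminf (\<lambda>k. bc k * ((-1) ^ k * (deriv ^^ k) \<Lambda> 0))) sequentially"
  proof (rule conjunct2[OF conjunct2[OF tannerys_theorem]])
    show "((\<lambda>j. T k j) \<longlongrightarrow> bc k * ((-1) ^ k * (deriv ^^ k) \<Lambda> 0)) sequentially" for k
    proof -
      have "(deriv ^^ k) \<Lambda> holomorphic_on Dom" by (rule holomorphic_higher_deriv[OF h open_Dom])
      then have "isCont ((deriv ^^ k) \<Lambda>) 0"
        using holomorphic_on_imp_continuous_on[of "(deriv ^^ k) \<Lambda>" Dom] continuous_on_eq_continuous_at[OF open_Dom] zero_in_Dom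
        by blast
      moreover have "?p \<longlonglongrightarrow> 0" using tendsto_of_real[OF LIMSEQ_Suc[OF lim_1_over_n], where 'a = complex] by simp
      ultimately have "(\<lambda>j. (deriv ^^ k) \<Lambda> (?p j)) \<longlonglongrightarrow> (deriv ^^ k) \<Lambda> 0" by (rule isCont_tendsto_compose)
      then show ?thesis unfolding T_def by (intro tendsto_intros)
    qed
    show "\<forall>\<^sub>F (k, j) in at_top \<times>\<^sub>F sequentially. norm (T k j) \<le> Q * S * M * ((4 * y) ^ k / fact k)"
      unfolding eventually_prod_filter
      by (intro exI[of _ "\<lambda>_. True"] exI[of _ "\<lambda>j. j \<ge> 3"]) (use Tb in auto)
    show "summable (\<lambda>k. Q * S * M * ((4 * y) ^ k / fact k))"
      using summable_exp_generic[of "4 * y"] by (intro summable_mult) (simp add: field_simps scaleR_conv_of_real)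
  qed auto
  then show ?thesis unfolding LT .
qed

end

section \<open>Duplication formula and summation of the limiting series\<close>

lemma higher_deriv_odd_zero:
  assumes h: "f holomorphic_on ball 0 1" and even: "\<And>p. norm p < 1 \<Longrightarrow> f (- p) = f p" and k: "odd k"
  shows "(deriv ^^ k) f (0::complex) = 0"
proof -
  have "(deriv ^^ k) (\<lambda>p. f (-1 * p)) 0 = (-1) ^ k * (deriv ^^ k) f (-1 * 0)"
    by (rule higher_deriv_compose_linear[OF h open_ball[of 0 1] open_ball]) auto
  moreover have "(deriv ^^ k) (\<lambda>p. f (-1 * p)) 0 = (deriv ^^ k) f 0"
  proof (rule higher_deriv_cong_ev)
    have "eventually (\<lambda>p. p \<in> ball (0::complex) 1) (nhds 0)" by (rule eventually_nhds_in_open) auto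
    then show "\<forall>\<^sub>F p in nhds 0. f (-1 * p) = f p" by eventually_elim (use even in simp)
  qed simp
  ultimately show ?thesis using k by simp
qed

lemma rGamma_duplication:
  assumes z: "Re z > 0"
  shows "rGamma (2 * z) = 2 powr (1 - 2 * z) * of_real (sqrt pi) * rGamma z * rGamma (z + 1/2)"
proof -
  have ni: "w \<notin> \<int>\<^sub>\<le>\<^sub>0" if "Re w > 0" for w using that by (auto elim!: nonpos_Ints_cases)
  have G: "Gamma w * rGamma w = 1" if "Re w > 0" for w
    using ni[OF that] by (simp add: Gamma_def rGamma_eq_zero_iff)
  have r: "Re z > 0" "Re (z + 1/2) > 0" "Re (2 * z) > 0" using z by auto
  have p2: "exp ((1 - 2 * z) * of_real (ln 2)) = 2 powr (1 - 2 * z)"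
    using Ln_of_real[of 2] by (simp add: powr_def)
  have "Gamma z * Gamma (z + 1/2) = 2 powr (1 - 2 * z) * of_real (sqrt pi) * Gamma (2 * z)"
    using Gamma_legendre_duplication[OF ni ni] r p2 by simp
  then have "(Gamma z * Gamma (z + 1/2)) * (rGamma z * rGamma (z + 1/2) * rGamma (2 * z))
     = 2 powr (1 - 2 * z) * of_real (sqrt pi) * Gamma (2 * z) * (rGamma z * rGamma (z + 1/2) * rGamma (2 * z))" by simp
  then have "(Gamma z * rGamma z) * (Gamma (z + 1/2) * rGamma (z + 1/2)) * rGamma (2 * z)
     = 2 powr (1 - 2 * z) * of_real (sqrt pi) * rGamma z * rGamma (z + 1/2) * (Gamma (2 * z) * rGamma (2 * z))"
    by (simp only: mult_ac)
  then show ?thesis unfolding G[OF r(1)] G[OF r(2)] G[OF r(3)] by simp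
qed

text \<open>The crux of the summation: Legendre's formula at \<open>a + m + 1/2\<close> splits the
  Gamma factor of doubled argument, and one of the two factors cancels against the Pochhammer symbol
  in the binomial coefficient. What is left is the general coefficient of \<open>Phi a\<close>, with
  \<open>- 1/4\<close> supplying the argument \<open>- (y / 2)^2\<close>.\<close>

lemma coefficient_duplication:
  assumes a: "\<bar>Re a\<bar> < 1/2"
  shows "rGamma (2 * a + of_nat (2 * m) + 1) * ((- a - 1/2) gchoose m)
     = (2 powr (- 2 * a) * of_real (sqrt pi) * rGamma (a + 1/2)) * (rGamma (a + of_nat m + 1) / fact m * (- 1/4) ^ m)"
proof -
  define z where "z = a + of_nat m + 1/2"
  have z: "Re z > 0" using a by (simp add: z_def)
  have e1: "2 * a + of_nat (2 * m) + 1 = 2 * z" and e2: "z + 1/2 = a + of_nat m + 1" and e3: "1 - 2 * z = - 2 * a + - of_nat (2 * m)"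
    and e4: "a + 1/2 + of_nat m = z"
    by (simp_all add: z_def algebra_simps)
  have p: "(2::complex) powr (1 - 2 * z) = 2 powr (- 2 * a) * (1/4) ^ m"
  proof -
    have "(2::complex) powr (- of_nat (2 * m)) = inverse (2 powr (of_nat (2 * m)))" by (rule powr_minus)
    also have "(2::complex) powr (of_nat (2 * m)) = 2 ^ (2 * m)" by (intro powr_nat') auto
    also have "\<dots> = 4 ^ m" by (simp add: power_mult)
    finally have "(2::complex) powr (- of_nat (2 * m)) = (1/4) ^ m" by (simp add: power_one_over inverse_eq_divide)
    then show ?thesis unfolding e3 powr_add by simp
  qed
  have g: "(- a - 1/2) gchoose m = (-1) ^ m * pochhammer (a + 1/2) m / fact m"
    by (simp add: gbinomial_pochhammer add.commute)
  have ph: "pochhammer (a + 1/2) m * rGamma z = rGamma (a + 1/2)"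
    using pochhammer_rGamma[of "a + 1/2" m] by (simp add: e4)
  have sgn: "(-1) ^ m * (1/4) ^ m = (- 1/4 :: complex) ^ m" by (simp flip: power_mult_distrib)
  have "rGamma (2 * a + of_nat (2 * m) + 1) * ((- a - 1/2) gchoose m)
     = 2 powr (- 2 * a) * of_real (sqrt pi) * (pochhammer (a + 1/2) m * rGamma z) * (rGamma (a + of_nat m + 1) / fact m * ((-1) ^ m * (1/4) ^ m))"
    unfolding e1 rGamma_duplication[OF z] e2 p g by simp
  then show ?thesis unfolding ph sgn .
qed

lemma suminf_even_terms:
  fixes f :: "nat \<Rightarrow> complex"
  assumes "\<And>k. odd k \<Longrightarrow> f k = 0"
  shows "suminf f = (\<Sum>m. f (2 * m))"
proof -
  have "(\<Sum>m. f (2 * m)) = suminf f"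
  proof (rule suminf_mono_reindex)
    show "strict_mono (\<lambda>m::nat. 2 * m)" by (auto simp: strict_mono_def)
    fix k assume "k \<notin> range (\<lambda>m::nat. 2 * m)"
    then have "odd k" by (auto elim!: evenE)
    then show "f k = 0" by (rule assms)
  qed
  then show ?thesis ..
qed

lemma Phi_suminf_scaled:
  assumes "\<And>m. f m = K * (rGamma (a + of_nat m + 1) / fact m * x ^ m)"
  shows "suminf f = K * Phi a x"
  using sums_unique[OF sums_mult[OF Phi_sums[of a x], of K]] assms by presburger

context
  fixes n :: complex and y :: real
  assumes n: "0 < norm n" "norm n < 1/2" and y: "y > 0"
begin

text \<open>In both multipliers the 1 comes from the \<open>I\<close> functions in \<open>K\<close>
  and the alternating sign from the \<open>J\<close> functions in \<open>Y\<close>; in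
  \<open>eM\<close> the cosine is the one in the definition of \<open>Y\<close>. Since
  \<open>eL\<close> vanishes for odd \<open>k\<close>, only even derivatives of the transform of
  \<open>uB\<close> are needed.\<close>

definition eL :: "nat \<Rightarrow> complex" where "eL k = 1 + (-1) ^ k"
definition eM :: "nat \<Rightarrow> complex" where "eM k = 1 + cos (2 * n * of_real pi) * (-1) ^ k"

lemma eL_bound: "norm (eL k) \<le> 2"
  unfolding eL_def by (rule order_trans[OF norm_triangle_ineq]) (simp add: norm_power)

lemma eM_bound: "norm (eM k) \<le> 1 + norm (cos (2 * n * of_real pi))"
  unfolding eM_def by (rule order_trans[OF norm_triangle_ineq]) (simp add: norm_mult norm_power)

abbreviation "bL \<equiv> bc (- 2 * n) y eL"
abbreviation "bM \<equiv> bc (2 * n) y eM"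

lemma bL_sum: "(\<Sum>k. bL k * of_real c ^ k) = Phi (- 2 * n) (of_real (c * y)) + Phi (- 2 * n) (- of_real (c * y))"
proof -
  have "(\<lambda>k. bL k * of_real c ^ k) sums (Phi (- 2 * n) (of_real (c * y)) + Phi (- 2 * n) (- of_real (c * y)))"
    using sums_add[OF Phi_sums[of "- 2 * n" "of_real (c * y)"] Phi_sums[of "- 2 * n" "- of_real (c * y)"]]
    unfolding bc_def[OF y eL_bound] eL_def power_minus[of "of_real c * of_real y"] of_real_mult power_mult_distrib
    by (simp add: add_divide_distrib algebra_simps)
  then show ?thesis by (simp add: sums_iff)
qed

lemma bM_sum: "(\<Sum>k. bM k * of_real c ^ k) = Phi (2 * n) (of_real (c * y)) + cos (2 * n * of_real pi) * Phi (2 * n) (- of_real (c * y))"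
proof -
  have "(\<lambda>k. bM k * of_real c ^ k) sums (Phi (2 * n) (of_real (c * y)) + cos (2 * n * of_real pi) * Phi (2 * n) (- of_real (c * y)))"
    using sums_add[OF Phi_sums[of "2 * n" "of_real (c * y)"] sums_mult[OF Phi_sums[of "2 * n" "- of_real (c * y)"], of "cos (2 * n * of_real pi)"]]
    unfolding bc_def[OF y eM_bound] eM_def power_minus[of "of_real c * of_real y"] of_real_mult power_mult_distrib
    by (simp add: add_divide_distrib algebra_simps)
  then show ?thesis by (simp add: sums_iff)
qed

lemma abs_Re_order_less_half: "\<bar>Re n\<bar> < 1/2" by (rule abs_Re_less_half[OF n(2)])

text \<open>Only even derivatives occur, and oddness of \<open>Prim\<close> removes it from the even
  part. Duplication sums the rest; the two reciprocal Gamma values at \<open>1/2 + n\<close> and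
  \<open>1/2 - n\<close> combine to the cosine by reflection.\<close>

lemma limit_L:
  "(\<lambda>j. Lap (\<lambda>c. uB n c * (\<Sum>k. bL k * of_real c ^ k)) (of_real (1 / real (Suc j))))
    \<longlonglongrightarrow> 2 * (2 powr (2 * n) * cos (of_real pi * n)) * Phi (- n) (- ((of_real y / 2)\<^sup>2))"
proof -
  define C where "C = of_real (sqrt pi) * rGamma (n + 1/2)"
  define \<beta> where "\<beta> = 2 * n * rGamma (n + 1)"
  define \<Lambda> where "\<Lambda> p = (p\<^sup>2 + 1) powr (n - 1/2) * (C - \<beta> * Prim (- 1/2 - n) p)" for p
  have P: "Prim (- 1/2 - n) holomorphic_on Dom"
    unfolding holomorphic_on_open[OF open_Dom] using DERIV_Prim by blast
  have h: "\<Lambda> holomorphic_on Dom"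
    unfolding \<Lambda>_def using square_plus_one_notin by (intro holomorphic_intros P) auto
  have "(deriv ^^ (2 * m)) \<Lambda> 0 = C * fact (2 * m) * ((n - 1/2) gchoose m)" for m
  proof (rule higher_deriv_even_part)
    show "\<Lambda> holomorphic_on ball 0 1" by (rule holomorphic_on_subset[OF h]) (auto simp: Dom_def)
    show "\<Lambda> p + \<Lambda> (- p) = 2 * C * (p\<^sup>2 + 1) powr (n - 1/2)" if "norm p < 1" for p
      unfolding \<Lambda>_def Prim_odd[OF that] by (simp add: algebra_simps)
  qed
  note D = this
  have lim: "(\<lambda>j. Lap (\<lambda>c. uB n c * (\<Sum>k. bL k * of_real c ^ k)) (of_real (1 / real (Suc j))))
    \<longlonglongrightarrow> (\<Sum>k. bL k * ((-1) ^ k * (deriv ^^ k) \<Lambda> 0))"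
    by (rule Lap_series_limit[OF y eL_bound pow_bounded_uB[OF n(2)] h])
      (use Lap_uB_eq[OF n(2)] in \<open>simp add: \<Lambda>_def C_def \<beta>_def\<close>)
  have "(\<Sum>k. bL k * ((-1) ^ k * (deriv ^^ k) \<Lambda> 0)) = (\<Sum>m. bL (2 * m) * ((-1) ^ (2 * m) * (deriv ^^ (2 * m)) \<Lambda> 0))"
    by (rule suminf_even_terms) (simp add: bc_def[OF y eL_bound] eL_def)
  also have "\<dots> = (2 * C * (2 powr (2 * n) * of_real (sqrt pi) * rGamma (- n + 1/2))) * Phi (- n) (- ((of_real y / 2)\<^sup>2))"
  proof (rule Phi_suminf_scaled)
    fix m
    \<comment> \<open>The \<open>fact (2 * m)\<close> of the derivative cancels the factorial of the
      coefficient, leaving a reciprocal Gamma value times a binomial coefficient, ready for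
      duplication.\<close>
    have "bL (2 * m) * ((-1) ^ (2 * m) * (deriv ^^ (2 * m)) \<Lambda> 0)
        = 2 * C * (of_real y ^ (2 * m)) * (rGamma (2 * (- n) + of_nat (2 * m) + 1) * ((- (- n) - 1/2) gchoose m))"
      unfolding D bc_def[OF y eL_bound] eL_def by simp
    also have "\<dots> = 2 * C * (2 powr (2 * n) * of_real (sqrt pi) * rGamma (- n + 1/2)) * (rGamma (- n + of_nat m + 1) / fact m * (of_real y ^ (2 * m) * (- 1/4) ^ m))"
      using abs_Re_order_less_half by (subst coefficient_duplication) auto
    also have "of_real y ^ (2 * m) * (- 1/4) ^ m = (- ((complex_of_real y / 2)\<^sup>2)) ^ m"
      by (simp add: power_mult power_divide flip: power_mult_distrib)
    finally show "bL (2 * m) * ((-1) ^ (2 * m) * (deriv ^^ (2 * m)) \<Lambda> 0)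
       = (2 * C * (2 powr (2 * n) * of_real (sqrt pi) * rGamma (- n + 1/2))) * (rGamma (- n + of_nat m + 1) / fact m * (- ((complex_of_real y / 2)\<^sup>2)) ^ m)" .
  qed
  also have "2 * C * (2 powr (2 * n) * of_real (sqrt pi) * rGamma (- n + 1/2)) = 2 * (2 powr (2 * n) * cos (of_real pi * n))"
  proof -
    have "rGamma (n + 1/2) * rGamma (1 - (n + 1/2)) = sin (of_real pi * (n + 1/2)) / of_real pi"
      by (rule rGamma_reflection_complex)
    also have "1 - (n + 1/2) = - n + 1/2" by simp
    also have "sin (of_real pi * (n + 1/2)) = cos (of_real pi * n)"
      by (simp add: distrib_left sin_add)
    finally have 1: "rGamma (n + 1/2) * rGamma (- n + 1/2) = cos (of_real pi * n) / of_real pi" .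
    have 2: "complex_of_real (sqrt pi) * of_real (sqrt pi) = of_real pi" by (simp flip: of_real_mult)
    have "2 * C * (2 powr (2 * n) * of_real (sqrt pi) * rGamma (- n + 1/2))
       = 2 * 2 powr (2 * n) * (complex_of_real (sqrt pi) * of_real (sqrt pi)) * (rGamma (n + 1/2) * rGamma (- n + 1/2))"
      unfolding C_def by (simp only: mult_ac)
    then show ?thesis unfolding 1 2 by simp
  qed
  finally show ?thesis using lim by simp
qed

text \<open>Here the odd coefficients survive but the transform is even, so its odd derivatives at 0
  vanish. The remaining constant is 1 by duplication at \<open>m = 0\<close>.\<close>

lemma limit_M:
  "(\<lambda>j. Lap (\<lambda>c. uM n c * (\<Sum>k. bM k * of_real c ^ k)) (of_real (1 / real (Suc j))))
    \<longlonglongrightarrow> (1 + cos (2 * n * of_real pi)) * Phi n (- ((of_real y / 2)\<^sup>2))"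
proof -
  define C where "C = rGamma (n + 1) * Gamma (2 * n + 1)"
  define \<Lambda> where "\<Lambda> p = (p\<^sup>2 + 1) powr (- n - 1/2) * C" for p
  have h: "\<Lambda> holomorphic_on Dom"
    unfolding \<Lambda>_def using square_plus_one_notin by (intro holomorphic_intros) auto
  have hb: "\<Lambda> holomorphic_on ball 0 1" by (rule holomorphic_on_subset[OF h]) (auto simp: Dom_def)
  have D: "(deriv ^^ (2 * m)) \<Lambda> 0 = C * fact (2 * m) * ((- n - 1/2) gchoose m)" for m
    by (rule higher_deriv_even_part[OF hb]) (simp add: \<Lambda>_def)
  have D0: "(deriv ^^ k) \<Lambda> 0 = 0" if "odd k" for k
    by (rule higher_deriv_odd_zero[OF hb _ that]) (simp add: \<Lambda>_def)
  have lim: "(\<lambda>j. Lap (\<lambda>c. uM n c * (\<Sum>k. bM k * of_real c ^ k)) (of_real (1 / real (Suc j))))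
    \<longlonglongrightarrow> (\<Sum>k. bM k * ((-1) ^ k * (deriv ^^ k) \<Lambda> 0))"
    by (rule Lap_series_limit[OF y eM_bound pow_bounded_uM[OF n(2)] h])
      (use Lap_uM_eq[OF n(2)] in \<open>simp add: \<Lambda>_def C_def\<close>)
  have "(\<Sum>k. bM k * ((-1) ^ k * (deriv ^^ k) \<Lambda> 0)) = (\<Sum>m. bM (2 * m) * ((-1) ^ (2 * m) * (deriv ^^ (2 * m)) \<Lambda> 0))"
    by (rule suminf_even_terms) (simp add: D0)
  also have "\<dots> = ((1 + cos (2 * n * of_real pi)) * (C * (2 powr (- 2 * n) * of_real (sqrt pi) * rGamma (n + 1/2)))) * Phi n (- ((of_real y / 2)\<^sup>2))"
  proof (rule Phi_suminf_scaled)
    fix m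
    have "bM (2 * m) * ((-1) ^ (2 * m) * (deriv ^^ (2 * m)) \<Lambda> 0)
        = (1 + cos (2 * n * of_real pi)) * C * (of_real y ^ (2 * m)) * (rGamma (2 * n + of_nat (2 * m) + 1) * ((- n - 1/2) gchoose m))"
      unfolding D bc_def[OF y eM_bound] eM_def by simp
    also have "\<dots> = (1 + cos (2 * n * of_real pi)) * C * (2 powr (- 2 * n) * of_real (sqrt pi) * rGamma (n + 1/2)) * (rGamma (n + of_nat m + 1) / fact m * (of_real y ^ (2 * m) * (- 1/4) ^ m))"
      using abs_Re_order_less_half by (subst coefficient_duplication) auto
    also have "of_real y ^ (2 * m) * (- 1/4) ^ m = (- ((complex_of_real y / 2)\<^sup>2)) ^ m"
      by (simp add: power_mult power_divide flip: power_mult_distrib)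
    finally show "bM (2 * m) * ((-1) ^ (2 * m) * (deriv ^^ (2 * m)) \<Lambda> 0)
       = ((1 + cos (2 * n * of_real pi)) * (C * (2 powr (- 2 * n) * of_real (sqrt pi) * rGamma (n + 1/2)))) * (rGamma (n + of_nat m + 1) / fact m * (- ((complex_of_real y / 2)\<^sup>2)) ^ m)"
      by (simp only: mult.assoc)
  qed
  also have "C * (2 powr (- 2 * n) * of_real (sqrt pi) * rGamma (n + 1/2)) = 1"
  proof -
    have "rGamma (2 * n + 1) = 2 powr (- 2 * n) * of_real (sqrt pi) * rGamma (n + 1/2) * rGamma (n + 1)"
      using coefficient_duplication[OF abs_Re_order_less_half, of 0] by simp
    then have "C * (2 powr (- 2 * n) * of_real (sqrt pi) * rGamma (n + 1/2)) = Gamma (2 * n + 1) * rGamma (2 * n + 1)"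
      unfolding C_def by (simp only: mult_ac)
    moreover have "2 * n + 1 \<notin> \<int>\<^sub>\<le>\<^sub>0" using abs_Re_order_less_half by (auto elim!: nonpos_Ints_cases simp: complex_eq_iff)
    ultimately show ?thesis by (simp add: Gamma_def rGamma_eq_zero_iff)
  qed
  finally show ?thesis using lim by simp
qed

text \<open>The prefactor \<open>pi / (2 sin (2 pi n))\<close> of the bracket times the
  \<open>2 powr (- n)\<close> split off from \<open>(c / 2) powr n\<close> in
  \<open>J\<close>.\<close>

definition kap :: complex where "kap = 2 powr (- n) * of_real pi / (2 * sin (2 * n * of_real pi))"

text \<open>The power \<open>c powr n\<close> from \<open>J\<close> cancels
  \<open>c powr (- n)\<close> in one half of the bracket, leaving \<open>uB\<close>, and doubles to
  \<open>c powr (2 * n)\<close> in the other, giving \<open>uM\<close>.\<close>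

lemma JK_series:
  assumes c: "c > 0"
  shows "JK n y c = kap * (of_real y powr (- n) * (uB n c * (\<Sum>k. bL k * of_real c ^ k))
     - of_real y powr n * (uM n c * (\<Sum>k. bM k * of_real c ^ k)))"
proof -
  have n0: "n \<noteq> 0" using n by auto
  have cy: "c * y > 0" using c y by simp
  define P where "P = complex_of_real c powr n"
  have P: "P \<noteq> 0" using c by (simp add: P_def)
  have "complex_of_real (c * y) powr s = of_real c powr s * of_real y powr s" for s
    using c y powr_times_real[of "of_real c" "of_real y" s] by simp
  then have 1: "complex_of_real (c * y) powr (- n) = inverse P * of_real y powr (- n)" "complex_of_real (c * y) powr n = P * of_real y powr n"
    by (simp_all add: P_def powr_minus)
  have 2: "complex_of_real (c / 2) powr n = P * 2 powr (- n)" unfolding P_def by (rule half_powr[OF c])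
  have 3: "uM n c = P * P * uB n c"
    unfolding uM_def[OF n(2)] P_def by (simp flip: powr_add)
  have key: "P * T * u * (p / 2 * ((inverse P * Yi * L - P * Y * M) * iS)) = (T * p / 2 * iS) * (Yi * (u * L) - Y * (P * P * u * M))"
    for T u p Yi Y L M iS :: complex
  proof -
    have "P * T * u * (p / 2 * ((inverse P * Yi * L - P * Y * M) * iS))
        = (T * p / 2 * iS) * (Yi * (u * L) * (P * inverse P) - Y * (P * P * u * M))" by (simp add: algebra_simps)
    then show ?thesis using P by simp
  qed
  have kap: "kap = 2 powr (- n) * of_real pi / 2 * inverse (sin (2 * n * of_real pi))"
    unfolding kap_def divide_inverse inverse_mult_distrib by (simp only: mult_ac)
  show ?thesis
    unfolding JK_def Bessel_J_uB KYq_eq[OF cy n0 n(2)] 1 2 3 bL_sum bM_sum kap divide_inverse[of _ "sin (2 * n * of_real pi)"]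
    by (rule key)
qed

text \<open>With \<open>s\<close> and \<open>t\<close> the sine and cosine of \<open>pi n\<close>,
  the sine in \<open>kap\<close> is \<open>2 s t\<close>, while the two limits carry
  \<open>2 t\<close> and \<open>1 + cos (2 pi n) = 2 t^2\<close>. Cancelling \<open>2 t\<close>
  leaves exactly the quotient that defines \<open>Y\<close>.\<close>

lemma Lap_JK_limit:
  "(\<lambda>j. Lap (JK n y) (of_real (1 / real (Suc j)))) \<longlonglongrightarrow> - (of_real pi / 2) * Yq n (of_real y)"
proof -
  let ?p = "\<lambda>j. complex_of_real (1 / real (Suc j))"
  define A where "A = Phi (- n) (- ((of_real y / 2)\<^sup>2))"
  define B where "B = Phi n (- ((of_real y / 2)\<^sup>2))"
  have eq: "Lap (JK n y) (?p j) = kap * (of_real y powr (- n) * Lap (\<lambda>c. uB n c * (\<Sum>k. bL k * of_real c ^ k)) (?p j)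
     - of_real y powr n * Lap (\<lambda>c. uM n c * (\<Sum>k. bM k * of_real c ^ k)) (?p j))" for j
  proof -
    have p: "Re (?p j) > 0" by simp
    let ?L = "\<lambda>c. exp (- (?p j * of_real c)) * (uB n c * (\<Sum>k. bL k * of_real c ^ k))"
    let ?M = "\<lambda>c. exp (- (?p j * of_real c)) * (uM n c * (\<Sum>k. bM k * of_real c ^ k))"
    have L: "?L integrable_on {0<..}" by (rule Lap_series(1)[OF y eL_bound pow_bounded_uB[OF n(2)] p])
    have M: "?M integrable_on {0<..}" by (rule Lap_series(1)[OF y eM_bound pow_bounded_uM[OF n(2)] p])
    have "Lap (JK n y) (?p j) = integral {0<..} (\<lambda>c. kap * (of_real y powr (- n) * ?L c - of_real y powr n * ?M c))"
      unfolding Lap_def by (rule integral_cong) (simp add: JK_series algebra_simps)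
    also have "\<dots> = kap * (of_real y powr (- n) * integral {0<..} ?L - of_real y powr n * integral {0<..} ?M)"
      using integrable_on_mult_right[OF L, of "of_real y powr (- n)"] integrable_on_mult_right[OF M, of "of_real y powr n"]
      by (simp only: integral_mult_right integral_diff)
    finally show ?thesis by (simp only: Lap_def)
  qed
  have lim: "(\<lambda>j. Lap (JK n y) (?p j)) \<longlonglongrightarrow> kap * (of_real y powr (- n) * (2 * (2 powr (2 * n) * cos (of_real pi * n)) * A)
     - of_real y powr n * ((1 + cos (2 * n * of_real pi)) * B))"
    unfolding eq A_def B_def by (intro tendsto_intros limit_L limit_M)
  define s where "s = sin (n * of_real pi)"
  define t where "t = cos (n * of_real pi)"
  have n0: "n \<noteq> 0" using n by auto
  have nz: "sin (m * of_real pi) \<noteq> 0" if "m \<noteq> 0" "norm m < 1" for m :: complex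
  proof
    assume "sin (m * of_real pi) = 0"
    then obtain k where "m * of_real pi = of_int k * of_real pi" unfolding sin_eq_0 by auto
    then have "m = of_int k" by simp
    then show False using small_notin_Ints[OF that] by auto
  qed
  have s0: "s \<noteq> 0" unfolding s_def by (rule nz) (use n0 n in auto)
  have sin2: "sin (2 * n * of_real pi) = 2 * s * t" unfolding s_def t_def using sin_double[of "n * of_real pi"] by (simp add: mult_ac)
  have "sin (2 * n * of_real pi) \<noteq> 0" by (rule nz) (use n0 n in \<open>auto simp: norm_mult\<close>)
  then have t0: "t \<noteq> 0" using sin2 by auto
  have cos2: "1 + cos (2 * n * of_real pi) = 2 * t * t"
    unfolding t_def using cos_double_cos[of "n * of_real pi"] by (simp add: mult_ac power2_eq_square)
  have cost: "cos (of_real pi * n) = t" by (simp add: t_def mult.commute)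
  define Y1 where "Y1 = complex_of_real y powr n"
  define T1 where "T1 = (2::complex) powr n"
  have YT: "Y1 \<noteq> 0" "T1 \<noteq> 0" using y by (auto simp: Y1_def T1_def)
  have pw: "complex_of_real y powr (- n) = inverse Y1" "(2::complex) powr (- n) = inverse T1" "(2::complex) powr (2 * n) = T1 * T1"
    by (simp_all add: Y1_def T1_def powr_minus flip: powr_add)
  have half: "(complex_of_real y / 2) powr n = Y1 / T1"
    using half_powr[OF y, of n] unfolding pw(2) Y1_def[symmetric] of_real_divide of_real_numeral divide_inverse[of Y1 T1] .
  then have half': "(complex_of_real y / 2) powr (- n) = T1 / Y1" by (simp add: powr_minus)
  have key: "inverse T1 * p / (2 * (2 * s * t)) * (inverse Y1 * (2 * (T1 * T1 * t) * A) - Y1 * (2 * t * t * B))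
     = - (p / 2) * ((Y1 / T1 * B * t - T1 / Y1 * A) / s)" for p :: complex
  proof -
    have "inverse Y1 * (2 * (T1 * T1 * t) * A) - Y1 * (2 * t * t * B) = 2 * t * T1 * (T1 / Y1 * A - t * (Y1 / T1 * B))"
      using YT by (simp add: field_simps)
    moreover have "inverse T1 * p / (2 * (2 * s * t)) * (2 * t * T1 * x) = p / 2 * (x / s)" for x
      using YT s0 t0 by (simp add: field_simps)
    moreover have "p / 2 * ((T1 / Y1 * A - t * (Y1 / T1 * B)) / s) = - (p / 2) * ((Y1 / T1 * B * t - T1 / Y1 * A) / s)"
      by (simp add: diff_divide_distrib algebra_simps)
    ultimately show ?thesis by (simp only:)
  qed
  have kap: "kap = inverse T1 * of_real pi / (2 * (2 * s * t))" unfolding kap_def pw sin2 ..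
  have Yq: "Yq n (of_real y) = (Y1 / T1 * B * t - T1 / Y1 * A) / s"
    unfolding Yq_def Bessel_J_Phi half half' A_def B_def s_def t_def ..
  have "kap * (of_real y powr (- n) * (2 * (2 powr (2 * n) * cos (of_real pi * n)) * A)
     - of_real y powr n * ((1 + cos (2 * n * of_real pi)) * B)) = - (of_real pi / 2) * Yq n (of_real y)"
    unfolding kap Yq pw cost cos2 Y1_def[symmetric] by (rule key)
  then show ?thesis using lim by simp
qed

end

section \<open>The improper integral\<close>

lemma powr_quarter_tendsto_0: "((\<lambda>R. B * R powr (- 1/4)) \<longlongrightarrow> 0) at_top" for B :: real
proof -
  have "((\<lambda>R::real. R powr (- 1/4)) \<longlongrightarrow> 0) at_top" by real_asymp
  from tendsto_mult_left[OF this, of B] show ?thesis by simp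
qed

text \<open>The tail bound makes the truncated integrals Cauchy, and Abel's theorem names their
  limit. The rate is recorded with a constant common to all small orders, as the passage to order 0
  requires.\<close>

lemma JK_improper_nonzero:
  assumes y: "y > 0" and r: "0 < r" "r < 1/2"
  obtains B where "B \<ge> 0" "\<And>n R. 0 < norm n \<Longrightarrow> norm n \<le> r \<Longrightarrow> R \<ge> 1 \<Longrightarrow>
     JK n y integrable_on {0..R} \<and> norm (integral {0..R} (JK n y) - - (of_real pi / 2) * Yq n (of_real y)) \<le> B * R powr (- 1/4)"
proof -
  obtain B where B: "B \<ge> 0" "\<And>n R R'. 0 < norm n \<Longrightarrow> norm n \<le> r \<Longrightarrow> 1 \<le> R \<Longrightarrow> R \<le> R' \<Longrightarrow>
     norm (integral {R..R'} (JK n y)) \<le> B * R powr (- 1/4)"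
    using JK_tail[OF y r] by blast
  have "JK n y integrable_on {0..R} \<and> norm (integral {0..R} (JK n y) - - (of_real pi / 2) * Yq n (of_real y)) \<le> B * R powr (- 1/4)"
    if n: "0 < norm n" "norm n \<le> r" and R: "R \<ge> 1" for n R
  proof -
    have n2: "norm n < 1/2" using n r by simp
    note pb = pow_bounded_JK[OF y n(1) n2]
    have int: "JK n y integrable_on {0..R}" for R using pow_bounded_integral_Icc[OF pb] by blast
    define F where "F R = integral {0..R} (JK n y)" for R
    have FB: "norm (F R' - F R) \<le> B * R powr (- 1/4)" if "1 \<le> R" "R \<le> R'" for R R'
    proof -
      have "F R + integral {R..R'} (JK n y) = F R'"
        unfolding F_def by (rule Henstock_Kurzweil_Integration.integral_combine[OF _ that(2) int]) (use that in simp)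
      then have "F R' - F R = integral {R..R'} (JK n y)" by (simp add: algebra_simps)
      then show ?thesis using B(2)[OF n that] by simp
    qed
    have seq: "filterlim (\<lambda>k. real (Suc k)) at_top sequentially"
      by (rule filterlim_compose[OF filterlim_real_sequentially filterlim_Suc])
    have "Cauchy (\<lambda>k. F (real (Suc k)))"
    proof (rule CauchyI')
      fix \<epsilon> :: real assume "\<epsilon> > 0"
      then have "eventually (\<lambda>k. B * real (Suc k) powr (- 1/4) < \<epsilon>) sequentially"
        using order_tendstoD(2)[OF filterlim_compose[OF powr_quarter_tendsto_0 seq]] by blast
      then obtain M where M: "\<And>k. k \<ge> M \<Longrightarrow> B * real (Suc k) powr (- 1/4) < \<epsilon>"
        unfolding eventually_sequentially by blast
      show "\<exists>M. \<forall>m\<ge>M. \<forall>n>m. dist (F (real (Suc m))) (F (real (Suc n))) < \<epsilon>"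
      proof (intro exI allI impI)
        fix m k assume "M \<le> m" "m < k"
        then have "norm (F (real (Suc k)) - F (real (Suc m))) \<le> B * real (Suc m) powr (- 1/4)" by (intro FB) auto
        also have "\<dots> < \<epsilon>" using M[OF \<open>M \<le> m\<close>] .
        finally show "dist (F (real (Suc m))) (F (real (Suc k))) < \<epsilon>" by (simp add: dist_norm norm_minus_commute)
      qed
    qed
    then obtain l where l: "(\<lambda>k. F (real (Suc k))) \<longlonglongrightarrow> l" using Cauchy_convergent convergent_def by blast
    have Fl: "norm (F R - l) \<le> B * R powr (- 1/4)" if "R \<ge> 1" for R
    proof -
      have "(\<lambda>k. norm (F (real (Suc k)) - F R)) \<longlonglongrightarrow> norm (l - F R)" by (intro tendsto_intros l)
      moreover have "eventually (\<lambda>k. norm (F (real (Suc k)) - F R) \<le> B * R powr (- 1/4)) sequentially"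
        using filterlim_at_top[THEN iffD1, OF seq, rule_format, of R] by eventually_elim (use FB that in auto)
      ultimately have "norm (l - F R) \<le> B * R powr (- 1/4)"
        by (rule tendsto_upperbound) simp
      then show ?thesis by (simp add: norm_minus_commute)
    qed
    have "((\<lambda>R. F R - l) \<longlongrightarrow> 0) at_top"
    proof (rule Lim_null_comparison[OF _ powr_quarter_tendsto_0])
      show "\<forall>\<^sub>F R in at_top. norm (F R - l) \<le> B * R powr (- 1/4)"
        using eventually_ge_at_top[of 1] by eventually_elim (rule Fl)
    qed
    then have "(F \<longlongrightarrow> l) at_top" by (rule LIM_zero_cancel)
    then have "(\<lambda>j. Lap (JK n y) (of_real (1 / real (Suc j)))) \<longlonglongrightarrow> l"
      unfolding F_def[abs_def] by (rule Abel_Laplace[OF pb])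
    then have "l = - (of_real pi / 2) * Yq n (of_real y)" using Lap_JK_limit[OF n(1) n2 y] LIMSEQ_unique by blast
    then show ?thesis using Fl[OF R] int unfolding F_def by simp
  qed
  then show ?thesis using B(1) by (intro that) auto
qed

section \<open>Limits of the quotients at order 0\<close>

lemma sin_quotient_limit:
  assumes f: "(f has_field_derivative f') (at 0)" "f 0 = 0"
  shows "((\<lambda>m. f m / sin (m * of_real pi)) \<longlongrightarrow> f' / of_real pi) (at (0 :: complex))"
proof -
  have 1: "((\<lambda>m. f m / m) \<longlongrightarrow> f') (at 0)" using f by (simp add: has_field_derivative_iff)
  have "((\<lambda>m::complex. sin (m * of_real pi)) has_field_derivative of_real pi) (at 0)"
    by (auto intro!: derivative_eq_intros)
  then have 2: "((\<lambda>m::complex. sin (m * of_real pi) / m) \<longlongrightarrow> of_real pi) (at 0)" by (simp add: has_field_derivative_iff)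
  have "((\<lambda>m. (f m / m) / (sin (m * of_real pi) / m)) \<longlongrightarrow> f' / of_real pi) (at 0)"
    by (intro tendsto_divide 1 2) auto
  then show ?thesis by (rule Lim_transform_eventually) (auto simp: eventually_at_filter)
qed

lemma DERIV_Bessel_J_order:
  assumes "z \<noteq> 0"
  shows "((\<lambda>m. Bessel_J m z) has_field_derivative Ln (z / 2) * Phi 0 (- ((z / 2)\<^sup>2)) + Phi_order_deriv (- ((z / 2)\<^sup>2))) (at 0)"
proof -
  have "((\<lambda>m. (z / 2) powr m) has_field_derivative Ln (z / 2)) (at 0)"
    using assms by (auto intro!: derivative_eq_intros)
  from DERIV_mult'[OF this DERIV_Phi_order[of "- ((z / 2)\<^sup>2)"]] assms show ?thesis
    unfolding Bessel_J_Phi by (simp add: add.commute)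
qed

lemma Yq_tendsto:
  assumes z: "z \<noteq> 0"
  shows "((\<lambda>m. Yq m z) \<longlongrightarrow> 2 * (Ln (z / 2) * Phi 0 (- ((z / 2)\<^sup>2)) + Phi_order_deriv (- ((z / 2)\<^sup>2))) / of_real pi) (at 0)"
proof -
  let ?d = "Ln (z / 2) * Phi 0 (- ((z / 2)\<^sup>2)) + Phi_order_deriv (- ((z / 2)\<^sup>2))"
  have m: "((\<lambda>m. Bessel_J (- m) z) has_field_derivative - ?d) (at 0)"
    using DERIV_chain2[of "\<lambda>m. Bessel_J m z" ?d uminus 0 "- 1"] DERIV_Bessel_J_order[OF z] DERIV_minus[OF DERIV_ident, of 0 UNIV] by simp
  have c: "((\<lambda>m::complex. cos (m * of_real pi)) has_field_derivative 0) (at 0)"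
    by (auto intro!: derivative_eq_intros)
  have "((\<lambda>m. Bessel_J m z * cos (m * of_real pi) - Bessel_J (- m) z) has_field_derivative 2 * ?d) (at 0)"
    by (rule DERIV_cong[OF DERIV_diff[OF DERIV_mult'[OF DERIV_Bessel_J_order[OF z] c] m]]) simp
  from sin_quotient_limit[OF this] show ?thesis unfolding Yq_def by simp
qed

text \<open>At order 0 the quotient tends to \<open>2 / pi\<close> times the derivative of
  \<open>J\<close> in the order. This evaluates \<open>Lim\<close> and yields a formula in which
  holomorphy in \<open>z\<close> can be seen.\<close>

lemma Bessel_Y_0:
  assumes "z \<noteq> 0"
  shows "Bessel_Y 0 z = 2 * (Ln (z / 2) * Phi 0 (- ((z / 2)\<^sup>2)) + Phi_order_deriv (- ((z / 2)\<^sup>2))) / of_real pi"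
  unfolding Bessel_Y_def using tendsto_Lim[OF _ Yq_tendsto[OF assms]] by (simp add: Yq_def)

lemma Yq_tendsto_Bessel_Y: "z \<noteq> 0 \<Longrightarrow> ((\<lambda>m. Yq m z) \<longlongrightarrow> Bessel_Y 0 z) (at 0)"
  using Yq_tendsto[of z] Bessel_Y_0[of z] by simp

text \<open>For \<open>K\<close> it is enough that \<open>Lim\<close> is a genuine limit, so the
  derivative of the numerator in the order is left unevaluated.\<close>

lemma Bessel_K_tendsto:
  assumes z: "z \<noteq> 0"
  shows "((\<lambda>m. of_real pi / 2 * (Bessel_I (- m) z - Bessel_I m z) / sin (m * of_real pi)) \<longlongrightarrow> Bessel_K 0 z) (at 0)"
proof -
  define f where "f m = of_real pi / 2 * (Bessel_I (- m) z - Bessel_I m z)" for m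
  have "f holomorphic_on UNIV" unfolding f_def Bessel_I_Phi using z by (intro holomorphic_intros) auto
  then have "(f has_field_derivative deriv f 0) (at 0)" by (rule holomorphic_derivI) auto
  then have lim: "((\<lambda>m. f m / sin (m * of_real pi)) \<longlongrightarrow> deriv f 0 / of_real pi) (at 0)"
    by (rule sin_quotient_limit) (simp add: f_def)
  then have "Bessel_K 0 z = deriv f 0 / of_real pi"
    unfolding Bessel_K_def using tendsto_Lim[OF _ lim] by (simp add: f_def)
  then show ?thesis using lim by (simp add: f_def)
qed

lemma KYq_tendsto:
  assumes c: "c > 0" and N: "N \<longlonglongrightarrow> 0" "\<And>j. N j \<noteq> 0" "\<And>j. norm (N j) < 1/2"
  shows "(\<lambda>j. KYq (N j) c) \<longlonglongrightarrow> KYq 0 c"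
proof -
  define w where "w = complex_of_real (2 * sqrt c)"
  have w: "w \<noteq> 0" using c by (simp add: w_def)
  have ni: "2 * N j \<notin> \<int>" for j using small_notin_Ints[of "2 * N j"] N(2,3)[of j] by (simp add: norm_mult)
  have "(\<lambda>j. 2 * N j) \<longlonglongrightarrow> 0" using tendsto_mult_left[OF N(1), of 2] by simp
  then have fl: "filterlim (\<lambda>j. 2 * N j) (at 0) sequentially"
    using N(2) by (auto simp: filterlim_at)
  have "KYq (N j) c = of_real pi / 2 * (Bessel_I (- (2 * N j)) w - Bessel_I (2 * N j) w) / sin (2 * N j * of_real pi)
      - of_real pi / 2 * Yq (2 * N j) w" for j
    unfolding KYq_def Bessel_Y_eq[OF ni] using ni[of j] by (simp add: Bessel_K_def w_def)
  moreover have "(\<lambda>j. of_real pi / 2 * (Bessel_I (- (2 * N j)) w - Bessel_I (2 * N j) w) / sin (2 * N j * of_real pi)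
      - of_real pi / 2 * Yq (2 * N j) w) \<longlonglongrightarrow> Bessel_K 0 w - of_real pi / 2 * Bessel_Y 0 w"
    by (intro tendsto_diff tendsto_mult_left filterlim_compose[OF Bessel_K_tendsto[OF w] fl] filterlim_compose[OF Yq_tendsto_Bessel_Y[OF w] fl])
  ultimately show ?thesis by (simp add: KYq_def w_def)
qed

text \<open>Order 0 is a limit of small nonzero orders, the estimates being uniform.\<close>

lemma JK_improper:
  assumes y: "y > 0" and n: "norm n < 1/2"
  obtains B where "\<And>R. R \<ge> 1 \<Longrightarrow>
     JK n y integrable_on {0..R} \<and> norm (integral {0..R} (JK n y) - - (of_real pi / 2) * Bessel_Y n (of_real y)) \<le> B * R powr (- 1/4)"
proof (cases "n = 0")
  case False
  then have n0: "0 < norm n" by simp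
  obtain B where B: "\<And>m R. 0 < norm m \<Longrightarrow> norm m \<le> norm n \<Longrightarrow> R \<ge> 1 \<Longrightarrow>
     JK m y integrable_on {0..R} \<and> norm (integral {0..R} (JK m y) - - (of_real pi / 2) * Yq m (of_real y)) \<le> B * R powr (- 1/4)"
    by (rule JK_improper_nonzero[OF y n0 n]) blast
  have "n \<notin> \<int>" using False n by (intro small_notin_Ints) auto
  then show ?thesis using B[OF n0 order_refl] by (intro that[of B]) (simp add: Bessel_Y_eq)
next
  case True
  have r: "(0::real) < 1/3" "(1/3::real) < 1/2" by auto
  obtain B where B: "\<And>m R. 0 < norm m \<Longrightarrow> norm m \<le> 1/3 \<Longrightarrow> R \<ge> 1 \<Longrightarrow>
     JK m y integrable_on {0..R} \<and> norm (integral {0..R} (JK m y) - - (of_real pi / 2) * Yq m (of_real y)) \<le> B * R powr (- 1/4)"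
    by (rule JK_improper_nonzero[OF y r]) blast
  \<comment> \<open>The orders \<open>1 / (j + 3)\<close>: nonzero, tending to 0, and of modulus at
    most \<open>1/3\<close>, the radius for which \<open>B\<close> was obtained.\<close>
  define N where "N j = complex_of_real (1 / real (Suc (j + 2)))" for j
  have Nn: "norm (N j) = 1 / real (Suc (j + 2))" for j unfolding N_def norm_of_real by simp
  have N: "N \<longlonglongrightarrow> 0" "\<And>j. N j \<noteq> 0" "\<And>j. 0 < norm (N j)" "\<And>j. norm (N j) \<le> 1/3" "\<And>j. norm (N j) < 1/2"
  proof -
    show "N \<longlonglongrightarrow> 0"
      using LIMSEQ_ignore_initial_segment[OF tendsto_of_real[OF LIMSEQ_Suc[OF lim_1_over_n], where 'a = complex], of 2]
      unfolding N_def by simp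
    show 1: "0 < norm (N j)" for j unfolding Nn by simp
    show "N j \<noteq> 0" for j using 1[of j] by auto
    show 2: "norm (N j) \<le> 1/3" for j unfolding Nn by (simp add: field_simps)
    show "norm (N j) < 1/2" for j using 2[of j] by simp
  qed
  have fl: "filterlim N (at 0) sequentially" using N(1,2) by (auto simp: filterlim_at)
  have main: "JK 0 y integrable_on {0..R} \<and> norm (integral {0..R} (JK 0 y) - - (of_real pi / 2) * Bessel_Y 0 (of_real y)) \<le> B * R powr (- 1/4)"
    if R: "R \<ge> 1" for R
  proof -
    have R0: "R > 0" using R by simp
    obtain C where C: "\<And>n c. 0 < norm n \<Longrightarrow> norm n \<le> 1/3 \<Longrightarrow> 0 < c \<Longrightarrow> c \<le> R \<Longrightarrow> norm (JK n y c) \<le> C * c powr (- 2 * (1/3))"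
      by (rule JK_near_0[OF y r R0]) blast
    have int: "JK (N j) y integrable_on {0<..R}" for j
    proof -
      have "JK (N j) y integrable_on {0..R}" using B[OF N(3,4) R] by blast
      then show ?thesis by (rule integrable_spike_set) (auto intro: negligible_subset[of "{0}"])
    qed
    have g: "(\<lambda>c. C * c powr (- 2 * (1/3))) integrable_on {0<..R}"
      using R0 by (intro integrable_on_mult_right integrable_on_powr_from_0') auto
    have dom: "norm (JK (N j) y c) \<le> C * c powr (- 2 * (1/3))" if "c \<in> {0<..R}" for j c
      using C[OF N(3,4)] that by simp
    have conv: "(\<lambda>j. JK (N j) y c) \<longlonglongrightarrow> JK 0 y c" if "c \<in> {0<..R}" for c
    proof -
      have c: "c > 0" "c * y > 0" using that y by auto
      have "isCont (\<lambda>m. Bessel_J m (of_real c)) 0"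
        using DERIV_isCont[OF DERIV_Bessel_J_order[of "of_real c"]] c by simp
      then have "(\<lambda>j. Bessel_J (N j) (of_real c)) \<longlonglongrightarrow> Bessel_J 0 (of_real c)"
        using N(1) by (rule isCont_tendsto_compose)
      then show ?thesis unfolding JK_def by (intro tendsto_mult KYq_tendsto[OF c(2) N(1,2,5)])
    qed
    have "JK 0 y integrable_on {0<..R}" by (rule dominated_convergence(1)[OF int g dom conv])
    then have int0: "JK 0 y integrable_on {0..R}"
      by (rule integrable_spike_set) (auto intro: negligible_subset[of "{0}"])
    have eq: "integral {0<..R} f = integral {0..R} f" for f :: "real \<Rightarrow> complex"
      by (rule integral_spike_set) (auto intro: negligible_subset[of "{0}"])
    have "(\<lambda>j. integral {0<..R} (JK (N j) y)) \<longlonglongrightarrow> integral {0<..R} (JK 0 y)"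
      by (rule dominated_convergence(2)[OF int g dom conv])
    then have lim: "(\<lambda>j. integral {0..R} (JK (N j) y)) \<longlonglongrightarrow> integral {0..R} (JK 0 y)" unfolding eq .
    have limY: "(\<lambda>j. Yq (N j) (of_real y)) \<longlonglongrightarrow> Bessel_Y 0 (of_real y)"
      using filterlim_compose[OF Yq_tendsto_Bessel_Y fl] y by simp
    have "norm (integral {0..R} (JK 0 y) - - (of_real pi / 2) * Bessel_Y 0 (of_real y)) \<le> B * R powr (- 1/4)"
    proof (rule tendsto_upperbound)
      show "(\<lambda>j. norm (integral {0..R} (JK (N j) y) - - (of_real pi / 2) * Yq (N j) (of_real y))) \<longlonglongrightarrow>
         norm (integral {0..R} (JK 0 y) - - (of_real pi / 2) * Bessel_Y 0 (of_real y))"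
        by (intro tendsto_intros lim limY)
      show "\<forall>\<^sub>F j in sequentially. norm (integral {0..R} (JK (N j) y) - - (of_real pi / 2) * Yq (N j) (of_real y)) \<le> B * R powr (- 1/4)"
        using B[OF N(3,4) R] by (intro always_eventually) auto
    qed simp
    with int0 show ?thesis by blast
  qed
  show ?thesis using main True by (intro that[of B]) simp
qed

text \<open>The gauge integral over an unbounded set is tested on intervals containing a large ball.
  Such an interval starts at or below 0, where the integrand is extended by 0, so only its right end
  matters and no absolute convergence is needed.\<close>

lemma has_integral_pos_improper:
  fixes f :: "real \<Rightarrow> complex"
  assumes f: "\<And>R. R \<ge> 1 \<Longrightarrow> f integrable_on {0..R}"
    and lim: "((\<lambda>R. integral {0..R} f) \<longlongrightarrow> l) at_top"
  shows "(f has_integral l) {0<..}"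
  unfolding has_integral_alt'[of f]
proof (intro conjI allI impI)
  let ?h = "\<lambda>x. if x \<in> {0<..} then f x else 0"
  have hf: "(?h has_integral integral {0..b} f) {a..b}" if "a \<le> 0" "b \<ge> 1" for a b
  proof -
    have "(f has_integral integral {0..b} f) {0..b}" using f[OF that(2)] by blast
    then have "((\<lambda>x. if x \<in> {0..b} then f x else 0) has_integral integral {0..b} f) {a..b}"
      using that by (subst has_integral_restrict) auto
    then show ?thesis by (rule has_integral_spike[of "{0}", rotated 2]) auto
  qed
  show "?h integrable_on cbox a b" for a b
  proof -
    have "?h integrable_on {min a 0..max b 1}" using hf[of "min a 0" "max b 1"] by auto
    then show ?thesis unfolding cbox_interval by (rule integrable_subinterval_real) auto
  qed
  fix \<epsilon> :: real assume "\<epsilon> > 0"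
  then have "eventually (\<lambda>R. dist (integral {0..R} f) l < \<epsilon>) at_top" using lim by (rule tendstoD[rotated])
  then obtain R0 where R0: "\<And>R. R \<ge> R0 \<Longrightarrow> norm (integral {0..R} f - l) < \<epsilon>"
    by (auto simp: eventually_at_top_linorder dist_norm)
  define M where "M = max R0 1"
  \<comment> \<open>Radius \<open>2 * M\<close>, because the ball is open and \<open>M\<close>
    itself must lie inside it.\<close>
  show "\<exists>B>0. \<forall>a b. ball 0 B \<subseteq> cbox a b \<longrightarrow> norm (integral (cbox a b) ?h - l) < \<epsilon>"
  proof (intro exI[of _ "2 * M"] conjI allI impI)
    show "2 * M > 0" by (simp add: M_def)
    fix a b :: real assume sub: "ball 0 (2 * M) \<subseteq> cbox a b"
    have "0 \<in> ball (0::real) (2 * M)" "M \<in> ball 0 (2 * M)" by (auto simp: M_def)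
    then have "(0::real) \<in> cbox a b" "M \<in> cbox a b" using sub by blast+
    then have "a \<le> 0" "M \<le> b" by auto
    moreover from this have "b \<ge> 1" "b \<ge> R0" by (auto simp: M_def)
    ultimately show "norm (integral (cbox a b) ?h - l) < \<epsilon>"
      using integral_unique[OF hf[of a b]] R0[of b] by simp
  qed
qed

lemma has_integral_JK:
  assumes y: "y > 0" and n: "norm n < 1/2"
  shows "(JK n y has_integral - (of_real pi / 2) * Bessel_Y n (of_real y)) {0<..}"
proof -
  obtain B where B: "\<And>R. R \<ge> 1 \<Longrightarrow> JK n y integrable_on {0..R} \<and>
      norm (integral {0..R} (JK n y) - - (of_real pi / 2) * Bessel_Y n (of_real y)) \<le> B * R powr (- 1/4)"
    using JK_improper[OF y n] by blast
  show ?thesis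
  proof (rule has_integral_pos_improper)
    show "JK n y integrable_on {0..R}" if "R \<ge> 1" for R using B[OF that] by blast
    have "((\<lambda>R. integral {0..R} (JK n y) - - (of_real pi / 2) * Bessel_Y n (of_real y)) \<longlongrightarrow> 0) at_top"
    proof (rule Lim_null_comparison[OF _ powr_quarter_tendsto_0])
      show "\<forall>\<^sub>F R in at_top. norm (integral {0..R} (JK n y) - - (of_real pi / 2) * Bessel_Y n (of_real y)) \<le> B * R powr (- 1/4)"
        using eventually_ge_at_top[of 1] by eventually_elim (use B in blast)
    qed
    then show "((\<lambda>R. integral {0..R} (JK n y)) \<longlongrightarrow> - (of_real pi / 2) * Bessel_Y n (of_real y)) at_top"
      by (rule LIM_zero_cancel)
  qed
qed

text \<open>For nonzero order \<open>Y\<close> is a fixed combination of two \<open>J\<close>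
  functions. At order 0 it is a pointwise limit, which does not show holomorphy by itself; the
  logarithmic formula does.\<close>

lemma holomorphic_Bessel_Y:
  assumes n: "norm n < 1/2"
  shows "Bessel_Y n holomorphic_on - \<real>\<^sub>\<le>\<^sub>0"
proof (cases "n = 0")
  case False
  have "n \<notin> \<int>" using False n by (intro small_notin_Ints) auto
  then have "Bessel_Y n = (\<lambda>z. (Bessel_J n z * cos (n * of_real pi) - Bessel_J (- n) z) / sin (n * of_real pi))"
    by (simp add: fun_eq_iff Bessel_Y_eq Yq_def)
  moreover have "(\<lambda>z. (Bessel_J n z * cos (n * of_real pi) - Bessel_J (- n) z) * inverse (sin (n * of_real pi))) holomorphic_on - \<real>\<^sub>\<le>\<^sub>0"
    by (intro holomorphic_on_mult holomorphic_on_diff holomorphic_on_const holomorphic_Bessel_J_arg)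
  ultimately show ?thesis by (simp add: divide_inverse)
next
  case True
  have P: "(\<lambda>z. Phi_order_deriv (- ((z / 2)\<^sup>2))) holomorphic_on - \<real>\<^sub>\<le>\<^sub>0"
    by (rule holomorphic_on_compose_gen[OF _ holomorphic_Phi_order_deriv, unfolded o_def]) (auto intro!: holomorphic_intros)
  have "(\<lambda>z. 2 * (Ln (z / 2) * Phi 0 (- ((z / 2)\<^sup>2)) + Phi_order_deriv (- ((z / 2)\<^sup>2))) / of_real pi) holomorphic_on - \<real>\<^sub>\<le>\<^sub>0"
    using half_notin_nonpos_Reals by (intro holomorphic_intros P) auto
  then show ?thesis unfolding True
    by (rule holomorphic_transform) (rule Bessel_Y_0[symmetric], auto)
qed

theorem theorem17:
  fixes \<nu> z :: complex
  assumes "norm \<nu> < 1 / 2" and "z \<in> - \<real>\<^sub>\<le>\<^sub>0"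
  shows "\<exists>F. F holomorphic_on (- \<real>\<^sub>\<le>\<^sub>0) \<and>
    (\<forall>x::real. x > 0 \<longrightarrow>
      ((\<lambda>c. Bessel_J \<nu> (of_real c * of_real x) *
          (Bessel_K (2 * \<nu>) (2 * of_real (sqrt c))
            - of_real pi / 2 * Bessel_Y (2 * \<nu>) (2 * of_real (sqrt c))))
        has_integral F (of_real x)) {0<..}) \<and>
    F z = - (of_real pi / (2 * z)) * Bessel_Y \<nu> (1 / z)"
proof (intro exI[of _ "\<lambda>z. - (of_real pi / (2 * z)) * Bessel_Y \<nu> (1 / z)"] conjI allI impI)
  \<comment> \<open>The continuation \<open>F\<close> is the claimed right-hand side itself, so its
    holomorphy reduces to inversion mapping the slit plane into itself, and the last conjunct
    becomes trivial.\<close>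
  have "1 / w \<in> - \<real>\<^sub>\<le>\<^sub>0" if "w \<in> - \<real>\<^sub>\<le>\<^sub>0" for w :: complex
  proof
    assume "1 / w \<in> \<real>\<^sub>\<le>\<^sub>0"
    then obtain r where r: "1 / w = of_real r" "r \<le> 0" by (auto elim: nonpos_Reals_cases)
    have "w = 1 / (1 / w)" by simp
    then have "w = of_real (1 / r)" unfolding r(1) by simp
    moreover have "1 / r \<le> 0" using r(2) by (simp add: divide_le_0_iff)
    then have "complex_of_real (1 / r) \<in> \<real>\<^sub>\<le>\<^sub>0" by (simp only: nonpos_Reals_of_real_iff)
    ultimately show False using that by simp
  qed
  then have "(\<lambda>w. 1 / w) ` (- \<real>\<^sub>\<le>\<^sub>0) \<subseteq> - (\<real>\<^sub>\<le>\<^sub>0 :: complex set)" by blast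
  moreover have "(\<lambda>w::complex. 1 / w) holomorphic_on - \<real>\<^sub>\<le>\<^sub>0" by (intro holomorphic_intros) auto
  ultimately have "(\<lambda>w. Bessel_Y \<nu> (1 / w)) holomorphic_on - \<real>\<^sub>\<le>\<^sub>0"
    using holomorphic_on_compose_gen[OF _ holomorphic_Bessel_Y[OF assms(1)]] by (simp only: o_def)
  then show "(\<lambda>z. - (of_real pi / (2 * z)) * Bessel_Y \<nu> (1 / z)) holomorphic_on - \<real>\<^sub>\<le>\<^sub>0"
    by (intro holomorphic_intros) auto
next
  fix x :: real assume x: "x > 0"
  have y: "1 / x > 0" using x by simp
  have "((\<lambda>c. JK \<nu> (1 / x) (x * c)) has_integral - (of_real pi / 2) * Bessel_Y \<nu> (of_real (1 / x)) / of_real x) {0<..}"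
    by (rule has_integral_scale_pos[OF has_integral_JK[OF y assms(1)] x])
  moreover have "JK \<nu> (1 / x) (x * c) = Bessel_J \<nu> (of_real c * of_real x) *
      (Bessel_K (2 * \<nu>) (2 * of_real (sqrt c)) - of_real pi / 2 * Bessel_Y (2 * \<nu>) (2 * of_real (sqrt c)))" for c
    using x by (simp add: JK_def KYq_def mult.commute)
  moreover have "- (of_real pi / 2) * Bessel_Y \<nu> (of_real (1 / x)) / of_real x
      = - (of_real pi / (2 * of_real x)) * Bessel_Y \<nu> (1 / of_real x)" by simp
  ultimately show "((\<lambda>c. Bessel_J \<nu> (of_real c * of_real x) *
          (Bessel_K (2 * \<nu>) (2 * of_real (sqrt c)) - of_real pi / 2 * Bessel_Y (2 * \<nu>) (2 * of_real (sqrt c))))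
        has_integral - (of_real pi / (2 * of_real x)) * Bessel_Y \<nu> (1 / of_real x)) {0<..}"
    by simp
qed simp

end
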